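(* Let $d\ge 1$, $T\in(0,\infty)$, $x\in\mathbb{R}^d$, and let $V,F:\mathbb{R}^d\to\mathbb{R}$ satisfy: (V1) $V$ is of class $\mathcal{C}^2$; (V2) there is a compact $K\subset\mathbb{R}^d$ such that the Hessian satisfies $\nabla^2V(y)\ge 0$ for all $y\notin K$; (F1) there is a function $G:\mathbb{R}_+\to\mathbb{R}_+$ such that $F(y)=G(\|y\|)$ for all $y\in\mathbb{R}^d$; (F2) $G$ is an even polynomial function with $\deg(G)\ge 2$ and $G(0)=0$; (F3) $\lim_{r\to+\infty}G(r)=+\infty$. Let $J_N$ ($N\ge 2$) and $J_\infty$ be the functionals on $\mathcal{C}([0,T];\mathbb{R}^d)$ defined in the context. Then for every absolutely continuous function $f:[0,T]\to\mathbb{R}^d$ with $f(0)=x$, $$\lim_{N\to+\infty}J_N(f)=J_\infty(f).$$ Moreover, the convergence is uniform with respect to $f$ on any compact subset of $\mathcal{C}([0,T];\mathbb{R}^d)$ endowed with the uniform topology; that is, for every such compact subset $\mathcal{K}$ and every $\varepsilon>0$ there is $N_0$ such that for all $N\ge N_0$ and all $f\in\mathcal{K}$, $J_N(f)\le J_\infty(f)+\varepsilon$ and $J_\infty(f)\le J_N(f)+\varepsilon$ (as inequalities in $[0,+\infty]$).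
   Context: $\|\cdot\|$ is the Euclidean norm on $\mathbb{R}^d$. $\mathcal{H}_x$ is the set of absolutely continuous functions $f:[0,T]\to\mathbb{R}^d$ with $f(0)=x$. All functionals take values in $[0,+\infty]$. $\Psi_\infty^x$ is the solution of $\Psi_\infty^x(t)=x-\int_0^t\nabla V(\Psi_\infty^x(s))\,ds$, $t\in[0,T]$. The functional $J_\infty$ (the rate function of the self-stabilizing diffusion) is $$J_\infty(f):=\frac14\int_0^T\left\|\dot f(t)+\nabla V(f(t))+\nabla F\left(f(t)-\Psi_\infty^x(t)\right)\right\|^2dt$$ if $f\in\mathcal{H}_x$, and $J_\infty(f):=+\infty$ otherwise. For $N\ge 2$ and $f_1,\dots,f_N\in\mathcal{H}_x$, $$I^N(f_1,\dots,f_N):=\frac14\sum_{i=1}^N\int_0^T\left\|\dot f_i(t)+\nabla V(f_i(t))+\frac1N\sum_{k=1}^N\nabla F\left(f_i(t)-f_k(t)\right)\right\|^2dt,$$ and $I^N(f_1,\dots,f_N):=+\infty$ if at least one $f_i$ does not belong to $\mathcal{H}_x$. The functional $J_N$ (the rate function of the first particle in the mean-field system of $N$ particles) is $$J_N(f):=\inf_{f_2,\dots,f_N\in\mathcal{H}_x}I^N(f,f_2,\dots,f_N).$$ *)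

theory Defs
  imports "HOL-Analysis.Analysis"
begin

definition gradient :: "('a::real_inner \<Rightarrow> real) \<Rightarrow> 'a \<Rightarrow> 'a" where
  "gradient f y = (THE D. GDERIV f y :> D)"

definition hessian :: "(real ^ 'n \<Rightarrow> real) \<Rightarrow> real ^ 'n \<Rightarrow> real ^ 'n ^ 'n" where
  "hessian f y = jacobian (gradient f) (at y)"

definition class_C2 :: "(real ^ 'n \<Rightarrow> real) \<Rightarrow> bool" where
  "class_C2 f \<longleftrightarrow>
     (\<forall>y. f differentiable (at y)) \<and>
     (\<forall>y. gradient f differentiable (at y)) \<and>
     continuous_on UNIV (hessian f)"

definition pos_semidef :: "real ^ 'n ^ 'n \<Rightarrow> bool" where
  "pos_semidef A \<longleftrightarrow> (\<forall>h. 0 \<le> h \<bullet> (A *v h))"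

definition abs_cont_on_interval :: "real \<Rightarrow> real \<Rightarrow> (real \<Rightarrow> 'a::real_normed_vector) \<Rightarrow> bool" where
  "abs_cont_on_interval a b f \<longleftrightarrow>
     (\<forall>\<epsilon>>0. \<exists>\<delta>>0. \<forall>(n::nat) (s::nat \<Rightarrow> real) (t::nat \<Rightarrow> real).
        (\<forall>i<n. a \<le> s i \<and> s i \<le> t i \<and> t i \<le> b) \<and>
        (\<forall>i<n. \<forall>j<n. i \<noteq> j \<longrightarrow> {s i<..<t i} \<inter> {s j<..<t j} = {}) \<and>
        (\<Sum>i<n. t i - s i) < \<delta> \<longrightarrow>
        (\<Sum>i<n. norm (f (t i) - f (s i))) < \<epsilon>)"

text \<open>
  Functions on \<open>[0,T]\<close> are total functions on the reals of which only the values on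
  \<open>{0..T}\<close> matter: all notions below (including the derivative, which is taken
  within \<open>{0..T}\<close>) are insensitive to the values outside.
\<close>

definition HH :: "real \<Rightarrow> real ^ 'n \<Rightarrow> (real \<Rightarrow> real ^ 'n) set" where
  "HH T x = {f. abs_cont_on_interval 0 T f \<and> f 0 = x}"

definition is_Psi :: "real \<Rightarrow> real ^ 'n \<Rightarrow> (real ^ 'n \<Rightarrow> real) \<Rightarrow> (real \<Rightarrow> real ^ 'n) \<Rightarrow> bool" where
  "is_Psi T x V \<Psi> \<longleftrightarrow>
     continuous_on {0..T} \<Psi> \<and>
     (\<forall>t\<in>{0..T}. \<Psi> t = x - integral {0..t} (\<lambda>s. gradient V (\<Psi> s)))"

text \<open>
  For the potentials under consideration, the solution exists and is unique on \<open>{0..T}\<close>;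
  the choice operator only picks its (irrelevant) values outside \<open>{0..T}\<close>.
\<close>

definition Psi_inf :: "real \<Rightarrow> real ^ 'n \<Rightarrow> (real ^ 'n \<Rightarrow> real) \<Rightarrow> real \<Rightarrow> real ^ 'n" where
  "Psi_inf T x V = (SOME \<Psi>. is_Psi T x V \<Psi>)"

text \<open>
  An absolutely continuous function is differentiable only almost everywhere; where it is not,
  \<^const>\<open>vector_derivative\<close> has an arbitrary value, which does not affect the integrals.
\<close>

definition J_inf ::
  "real \<Rightarrow> real ^ 'n \<Rightarrow> (real ^ 'n \<Rightarrow> real) \<Rightarrow> (real ^ 'n \<Rightarrow> real) \<Rightarrow> (real \<Rightarrow> real ^ 'n) \<Rightarrow> ennreal" where
  "J_inf T x V F f =
     (if f \<in> HH T x then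
        ennreal (1/4) * (\<integral>\<^sup>+t\<in>{0..T}. ennreal ((norm
          (vector_derivative f (at t within {0..T}) + gradient V (f t)
            + gradient F (f t - Psi_inf T x V t)))\<^sup>2) \<partial>lborel)
      else \<infinity>)"

text \<open>The particles \<open>f\<^sub>1, \<dots>, f\<^sub>N\<close> are the values \<open>fs 1, \<dots>, fs N\<close>.\<close>

definition I_N ::
  "real \<Rightarrow> real ^ 'n \<Rightarrow> (real ^ 'n \<Rightarrow> real) \<Rightarrow> (real ^ 'n \<Rightarrow> real) \<Rightarrow> nat \<Rightarrow> (nat \<Rightarrow> real \<Rightarrow> real ^ 'n) \<Rightarrow> ennreal" where
  "I_N T x V F N fs =
     (if \<forall>i\<in>{1..N}. fs i \<in> HH T x then
        ennreal (1/4) * (\<Sum>i=1..N. \<integral>\<^sup>+t\<in>{0..T}. ennreal ((norm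
          (vector_derivative (fs i) (at t within {0..T}) + gradient V (fs i t)
            + (1 / real N) *\<^sub>R (\<Sum>k=1..N. gradient F (fs i t - fs k t))))\<^sup>2) \<partial>lborel)
      else \<infinity>)"

definition J_N ::
  "real \<Rightarrow> real ^ 'n \<Rightarrow> (real ^ 'n \<Rightarrow> real) \<Rightarrow> (real ^ 'n \<Rightarrow> real) \<Rightarrow> nat \<Rightarrow> (real \<Rightarrow> real ^ 'n) \<Rightarrow> ennreal" where
  "J_N T x V F N f =
     (INF fs \<in> {fs. fs 1 = f \<and> (\<forall>i\<in>{2..N}. fs i \<in> HH T x)}. I_N T x V F N fs)"

text \<open>The space \<open>C([0,T]; \<real>\<^sup>d)\<close> with the supremum metric.\<close>

definition path_space :: "real \<Rightarrow> (real \<Rightarrow> real ^ 'n) metric" where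
  "path_space T = cfunspace (top_of_set {0..T}) euclidean_metric"

end

theory Submission
  imports Defs
begin

text \<open>
  Write \<open>v\<close> and \<open>D\<close> for the gradients of \<open>V\<close> and \<open>F\<close>, \<open>\<Psi>\<close> for the noiseless path, \<open>f\<close> for the path of the
  first particle and \<open>f\<^sub>2, \<dots>, f\<^sub>N\<close> for the others. The limit functional measures
  \<open>a = f' + v f + D (f - \<Psi>)\<close>, the first summand of \<open>I\<^sup>N\<close> measures \<open>a - e\<close>, where \<open>e\<close> is the gap
  between the limiting force and the force that the particles exert, and with the residuals
  \<open>r\<^sub>k\<close> of the other particles
  \<open>4 (I\<^sup>N - J\<^sub>\<infinity>) = \<integral> \<Sum>\<^sub>k |r\<^sub>k|\<^sup>2 + |e|\<^sup>2 - 2 \<langle>a, e\<rangle>\<close>, the sum being over \<open>k \<ge> 2\<close>.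
  The estimates have to be uniform over paths with arbitrarily large \<open>\<integral> |f'|\<^sup>2\<close>, so the term
  \<open>\<langle>f', e\<rangle>\<close> cannot be estimated by the Cauchy-Schwarz inequality. But \<open>e\<close> is a sum of gradients:
  up to terms without \<open>f'\<close>, \<open>\<langle>f', e\<rangle>\<close> is the time derivative of
  \<open>F (\<Psi> - f) - (1/N) \<Sum>\<^sub>k F (f\<^sub>k - f)\<close>. After this integration by parts
  (\<open>cost_difference\<close>, \<open>boundary_rate_integral\<close>, \<open>action_difference\<close>) what remains, the
  \<^emph>\<open>defect\<close>, depends on the values of \<open>f\<close> only, and all bounds are uniform over paths that share a bound in
  the supremum norm, as the members of a compact set do.

  For the upper bound let all other particles follow \<open>\<Psi>\<close>; the defect is then of order \<open>1/N\<close>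
  (\<open>action_upper_bound\<close>).

  The lower bound (\<open>action_lower_bound\<close>) takes two steps, and only configurations with
  \<open>I\<^sup>N < J\<^sub>\<infinity>\<close> matter. First, the total cost of the other particles is then at most a
  constant independent of \<open>N\<close> (\<open>defect_coercive\<close>): far away from \<open>f\<close> they are pulled back by
  the interaction, and this pull enters the defect with a favourable sign and dominates everything
  else by the pairwise inequality \<open>pair_coercive\<close>. Second, since the cost is bounded,
  a Gronwall argument (\<open>spread_rate\<close>, \<open>spread_Gronwall\<close>) bounds the \<^emph>\<open>sum\<close>
  \<open>\<Sum>\<^sub>k |f\<^sub>k - \<Psi>|\<^sup>2\<close>, not only the average. So all particles stay in a fixed ball,
  where the forces are Lipschitz, their mean distance to \<open>\<Psi>\<close> is of order \<open>N\<^sup>-\<^sup>1\<^sup>/\<^sup>2\<close>, and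
  the defect is at least \<open>- K / sqrt N\<close> (\<open>defect_small\<close>).

  The calculus behind this is developed first: an absolutely continuous function is
  differentiable almost everywhere (\<open>abs_cont_differentiable_ae\<close>, by Vitali coverings) and is
  the integral of its derivative (\<open>abs_cont_FTC\<close>, by a gauge argument); and the noiseless path
  exists although \<open>v\<close> is only locally Lipschitz (\<open>dissipative_ode_exists\<close>).
\<close>

section \<open>Bounds on compact sets\<close>

lemma compact_continuous_bound:
  assumes "compact S" "continuous_on S f"
  shows "\<exists>B\<ge>0. \<forall>x\<in>S. norm (f x) \<le> B"
proof -
  have "bounded (f ` S)" using assms by (intro compact_imp_bounded compact_continuous_image)
  then obtain B where "B > 0" "\<And>y. y \<in> f ` S \<Longrightarrow> norm y \<le> B" unfolding bounded_pos by blast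
  then show ?thesis by (intro exI[of _ B]) auto
qed

lemma bounded_gradient_Lipschitz:
  fixes \<phi> :: "'a::euclidean_space \<Rightarrow> real"
  assumes \<phi>: "\<And>y. (\<phi> has_derivative (\<lambda>h. D y \<bullet> h)) (at y)"
    and L: "\<And>y. y \<in> cball 0 R \<Longrightarrow> norm (D y) \<le> L" and yz: "y \<in> cball 0 R" "z \<in> cball 0 R"
  shows "norm (\<phi> y - \<phi> z) \<le> L * norm (y - z)"
proof (rule differentiable_bound[OF convex_cball, of 0 R \<phi> "\<lambda>y h. D y \<bullet> h"])
  fix w assume w: "w \<in> cball (0::'a) R"
  show "(\<phi> has_derivative (\<lambda>h. D w \<bullet> h)) (at w within cball 0 R)"
    using \<phi> has_derivative_at_withinI by blast
  show "onorm (\<lambda>h. D w \<bullet> h) \<le> L"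
  proof (rule onorm_le)
    fix h
    have "norm (D w \<bullet> h) \<le> norm (D w) * norm h" by (simp add: Cauchy_Schwarz_ineq2)
    also have "\<dots> \<le> L * norm h" using L[OF w] by (intro mult_right_mono) auto
    finally show "norm (D w \<bullet> h) \<le> L * norm h" .
  qed
qed (use yz in auto)

section \<open>Absolutely continuous functions are differentiable almost everywhere\<close>

lemma increment_sum_division:
  fixes f :: "real \<Rightarrow> 'a::real_normed_vector"
  assumes "\<D> division_of {a..b}" "a \<le> b"
  shows "(\<Sum>k\<in>\<D>. f (Sup k) - f (Inf k)) = f b - f a"
proof -
  have fin: "finite \<D>" using assms by auto
  have tag: "(\<lambda>k. (Inf k, k)) ` \<D> tagged_division_of {a..b}"
  proof (rule tagged_division_ofI)
    fix x K assume "(x, K) \<in> (\<lambda>k. (Inf k, k)) ` \<D>"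
    then have K: "K \<in> \<D>" "x = Inf K" by auto
    then obtain u v where uv: "K = cbox u v" "K \<noteq> {}"
      using division_ofD(3)[OF assms(1) K(1)] division_ofD(4)[OF assms(1) K(1)] by blast
    show "x \<in> K" using uv K by auto
    show "K \<subseteq> {a..b}" using K assms by auto
    show "\<exists>a b. K = cbox a b" using uv by auto
  next
    fix x1 K1 x2 K2
    assume "(x1, K1) \<in> (\<lambda>k. (Inf k, k)) ` \<D>" "(x2, K2) \<in> (\<lambda>k. (Inf k, k)) ` \<D>"
      "(x1, K1) \<noteq> (x2, K2)"
    then have "K1 \<in> \<D>" "K2 \<in> \<D>" "K1 \<noteq> K2" by auto
    then show "interior K1 \<inter> interior K2 = {}" by (rule division_ofD(5)[OF assms(1)])
  next
    have "{K. \<exists>x. (x, K) \<in> (\<lambda>k. (Inf k, k)) ` \<D>} = \<D>" by auto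
    then show "\<Union>{K. \<exists>x. (x, K) \<in> (\<lambda>k. (Inf k, k)) ` \<D>} = {a..b}"
      using division_ofD(6)[OF assms(1)] by simp
  qed (use fin in auto)
  have "(\<Sum>k\<in>\<D>. f (Sup k) - f (Inf k))
      = sum (\<lambda>(x,K). f(Sup K) - f(Inf K)) ((\<lambda>k. (Inf k, k)) ` \<D>)"
    by (subst sum.reindex) (auto simp: inj_on_def)
  also have "\<dots> = f b - f a"
    by (rule additive_tagged_division_1[OF assms(2) tag])
  finally show ?thesis .
qed

definition nonoverlapping_intervals :: "real \<Rightarrow> real \<Rightarrow> nat \<Rightarrow> (nat \<Rightarrow> real) \<Rightarrow> (nat \<Rightarrow> real) \<Rightarrow> bool" where
  "nonoverlapping_intervals a b n s t \<longleftrightarrow>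
     (\<forall>i<n. a \<le> s i \<and> s i \<le> t i \<and> t i \<le> b) \<and>
     (\<forall>i<n. \<forall>j<n. i \<noteq> j \<longrightarrow> {s i<..<t i} \<inter> {s j<..<t j} = {})"

lemma abs_cont_iff:
  "abs_cont_on_interval a b f \<longleftrightarrow> (\<forall>\<epsilon>>0. \<exists>\<delta>>0. \<forall>n s t. nonoverlapping_intervals a b n s t \<longrightarrow>
     (\<Sum>i<n. t i - s i) < \<delta> \<longrightarrow> (\<Sum>i<n. norm (f (t i) - f (s i))) < \<epsilon>)"
  unfolding abs_cont_on_interval_def nonoverlapping_intervals_def imp_conjL conj_assoc ..

text \<open>
  The form of absolute continuity that fits coverings and gauges: families of intervals become
  finite sets of closed intervals with disjoint interiors.
\<close>

lemma abs_cont_division: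
  fixes f :: "real \<Rightarrow> 'a::real_normed_vector"
  assumes f: "abs_cont_on_interval a b f" and "\<epsilon> > 0"
  obtains \<delta> where "\<delta> > 0"
    "\<And>\<D>. \<D> division_of \<Union>\<D> \<Longrightarrow> \<Union>\<D> \<subseteq> {a..b} \<Longrightarrow> (\<Sum>k\<in>\<D>. measure lborel k) < \<delta> \<Longrightarrow>
       (\<Sum>k\<in>\<D>. norm (f (Sup k) - f (Inf k))) < \<epsilon>"
proof -
  obtain \<delta> where \<delta>: "\<delta> > 0" and *: "\<forall>n s t. nonoverlapping_intervals a b n s t \<longrightarrow>
     (\<Sum>i<n. t i - s i) < \<delta> \<longrightarrow> (\<Sum>i<n. norm (f (t i) - f (s i))) < \<epsilon>"
    using f \<open>\<epsilon> > 0\<close> unfolding abs_cont_iff by blast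
  show thesis
  proof (rule that[OF \<delta>])
    fix \<D> assume D: "\<D> division_of \<Union>\<D>" "\<Union>\<D> \<subseteq> {a..b}" "(\<Sum>k\<in>\<D>. measure lborel k) < \<delta>"
    then have "finite \<D>" by auto
    then obtain h where h: "bij_betw h {..<card \<D>} \<D>"
      using ex_bij_betw_nat_finite atLeast0LessThan by metis
    have hk: "\<exists>u v. h i = {u..v} \<and> u \<le> v" if "i < card \<D>" for i
    proof -
      have "h i \<in> \<D>" using h that by (auto simp: bij_betw_def)
      then obtain u v where "h i = cbox u v" "h i \<noteq> {}"
        using division_ofD(3)[OF D(1)] division_ofD(4)[OF D(1)] by blast
      then show ?thesis by auto
    qed
    have "(\<Sum>i<card \<D>. norm (f (Sup (h i)) - f (Inf (h i)))) < \<epsilon>"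
    proof (rule *[rule_format])
      have "\<forall>i<card \<D>. a \<le> Inf (h i) \<and> Inf (h i) \<le> Sup (h i) \<and> Sup (h i) \<le> b"
      proof (intro allI impI)
        fix i assume i: "i < card \<D>"
        then have "h i \<in> \<D>" using h by (auto simp: bij_betw_def)
        with D have "h i \<subseteq> {a..b}" by auto
        with hk[OF i] show "a \<le> Inf (h i) \<and> Inf (h i) \<le> Sup (h i) \<and> Sup (h i) \<le> b"
          by auto
      qed
      moreover have "\<forall>i<card \<D>. \<forall>j<card \<D>. i \<noteq> j \<longrightarrow>
          {Inf (h i)<..<Sup (h i)} \<inter> {Inf (h j)<..<Sup (h j)} = {}"
      proof (intro allI impI)
        fix i j assume ij: "i < card \<D>" "j < card \<D>" "i \<noteq> j"
        then have "h i \<in> \<D>" "h j \<in> \<D>" "h i \<noteq> h j"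
          using h by (auto simp: bij_betw_def inj_on_def)
        then have "interior (h i) \<inter> interior (h j) = {}"
          using D(1) by blast
        then show "{Inf (h i)<..<Sup (h i)} \<inter> {Inf (h j)<..<Sup (h j)} = {}"
          using hk[OF ij(1)] hk[OF ij(2)] by (auto simp: interior_atLeastAtMost_real)
      qed
      ultimately show "nonoverlapping_intervals a b (card \<D>) (\<lambda>i. Inf (h i)) (\<lambda>i. Sup (h i))"
        unfolding nonoverlapping_intervals_def by blast
      have "(\<Sum>i<card \<D>. Sup (h i) - Inf (h i)) = (\<Sum>i<card \<D>. measure lborel (h i))"
        by (rule sum.cong) (use hk in fastforce)+
      also have "\<dots> = (\<Sum>k\<in>\<D>. measure lborel k)"
        by (rule sum.reindex_bij_betw[OF h])
      finally show "(\<Sum>i<card \<D>. Sup (h i) - Inf (h i)) < \<delta>" using D(3) by simp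
    qed
    also have "(\<Sum>i<card \<D>. norm (f (Sup (h i)) - f (Inf (h i))))
        = (\<Sum>k\<in>\<D>. norm (f (Sup k) - f (Inf k)))"
      by (rule sum.reindex_bij_betw[OF h])
    finally show "(\<Sum>k\<in>\<D>. norm (f (Sup k) - f (Inf k))) < \<epsilon>" .
  qed
qed

lemma abs_cont_imp_continuous:
  fixes f :: "real \<Rightarrow> 'a::real_normed_vector"
  assumes f: "abs_cont_on_interval a b f"
  shows "continuous_on {a..b} f"
  unfolding continuous_on_iff
proof (intro ballI allI impI)
  fix x e :: real assume x: "x \<in> {a..b}" and "e > 0"
  obtain \<delta> where \<delta>: "\<delta> > 0" and *: "\<forall>n s t. nonoverlapping_intervals a b n s t \<longrightarrow>
     (\<Sum>i<n. t i - s i) < \<delta> \<longrightarrow> (\<Sum>i<n. norm (f (t i) - f (s i))) < e"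
    using f \<open>e > 0\<close> unfolding abs_cont_iff by blast
  have "dist (f y) (f x) < e" if y: "y \<in> {a..b}" "dist y x < \<delta>" for y
  proof (cases "x \<le> y")
    case True
    then show ?thesis
      using *[rule_format, of 1 "\<lambda>_. x" "\<lambda>_. y"] y x
      by (simp add: nonoverlapping_intervals_def dist_norm)
  next
    case False
    then show ?thesis
      using *[rule_format, of 1 "\<lambda>_. y" "\<lambda>_. x"] y x
      by (simp add: nonoverlapping_intervals_def dist_norm norm_minus_commute)
  qed
  then show "\<exists>d>0. \<forall>x'\<in>{a..b}. dist x' x < d \<longrightarrow> dist (f x') (f x) < e"
    using \<delta> by blast
qed

lemma measure_Union_disjoint_intervals:
  fixes \<D> :: "real set set"
  assumes "finite \<D>" "pairwise disjnt \<D>" "\<And>k. k \<in> \<D> \<Longrightarrow> \<exists>u w. k = {u..w}"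
  shows "measure lebesgue (\<Union>\<D>) = (\<Sum>k\<in>\<D>. measure lborel k)" "\<Union>\<D> \<in> lmeasurable"
proof -
  have lm: "k \<in> lmeasurable" if "k \<in> \<D>" for k using assms(3)[OF that] by auto
  then show "\<Union>\<D> \<in> lmeasurable" using assms by (intro fmeasurable.finite_Union) auto
  have "measure lebesgue (\<Union>\<D>) = (\<Sum>k\<in>\<D>. measure lebesgue k)"
    using assms(1,2) lm
    by (intro measure_negligible_finite_Union) (auto simp: pairwise_def disjnt_def)
  also have "\<dots> = (\<Sum>k\<in>\<D>. measure lborel k)"
  proof (rule sum.cong)
    fix k assume "k \<in> \<D>"
    then obtain u w where "k = {u..w}" using assms(3) by blast
    then show "measure lebesgue k = measure lborel k" by simp
  qed simp
  finally show "measure lebesgue (\<Union>\<D>) = (\<Sum>k\<in>\<D>. measure lborel k)" .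
qed

text \<open>
  Vitali's theorem gives countably many disjoint intervals; as they lie in a set of finite measure,
  finitely many already exhaust \<open>E\<close> up to \<open>\<epsilon>\<close>, and absolute continuity speaks about finitely many
  intervals.
\<close>

lemma Vitali_finite_intervals:
  fixes E U :: "real set"
  assumes E: "E \<in> lmeasurable" and U: "U \<in> lmeasurable" and "\<epsilon> > 0"
    and cover: "\<And>x d. x \<in> E \<Longrightarrow> d > 0 \<Longrightarrow>
       \<exists>u w. u < w \<and> u \<le> x \<and> x \<le> w \<and> w - u < d \<and> {u..w} \<subseteq> U \<and> P u w"
  obtains \<C> where "finite \<C>" "pairwise disjnt \<C>"
    "\<And>k. k \<in> \<C> \<Longrightarrow> \<exists>u w. k = {u..w} \<and> u < w \<and> {u..w} \<subseteq> U \<and> P u w"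
    "measure lebesgue (E - \<Union>\<C>) < \<epsilon>"
proof -
  define K where "K = {(u,w). u < w \<and> {u..w} \<subseteq> U \<and> P u w}"
  let ?a = "\<lambda>(u,w). (u + w) / 2 :: real" and ?r = "\<lambda>(u,w). (w - u) / 2 :: real"
  have cb: "cball (?a i) (?r i) = {fst i..snd i}" for i
    by (cases i) (auto simp: cball_eq_atLeastAtMost field_simps)
  obtain C where C: "countable C" "C \<subseteq> K"
     "pairwise (\<lambda>i j. disjnt (cball (?a i) (?r i)) (cball (?a j) (?r j))) C"
     "negligible(E - (\<Union>i \<in> C. cball (?a i) (?r i)))"
  proof (rule Vitali_covering_theorem_cballs[of K ?r E ?a])
    show "0 < ?r i" if "i \<in> K" for i using that by (auto simp: K_def)
    fix x d :: real assume "x \<in> E" "d > 0"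
    from cover[OF this] obtain u w where uw: "u < w" "u \<le> x" "x \<le> w" "w - u < d" "{u..w} \<subseteq> U" "P u w"
      by blast
    then show "\<exists>i. i \<in> K \<and> x \<in> cball (?a i) (?r i) \<and> ?r i < d"
      by (intro exI[of _ "(u,w)"]) (auto simp: K_def cball_eq_atLeastAtMost field_simps)
  qed auto
  define \<D> where "\<D> = (\<lambda>i. {fst i..snd i}) ` C"
  have D: "\<exists>u w. k = {u..w} \<and> u < w \<and> {u..w} \<subseteq> U \<and> P u w" if "k \<in> \<D>" for k
    using that C(2) by (fastforce simp: \<D>_def K_def)
  have disj: "pairwise disjnt \<D>"
    using C(3) unfolding cb \<D>_def by (auto simp: pairwise_def)
  have neg: "negligible (E - \<Union>\<D>)"
    using C(4) unfolding cb \<D>_def by simp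
  have cD: "countable \<D>" using C by (simp add: \<D>_def)
  have lmD: "k \<in> lmeasurable" if "k \<in> \<D>" for k using D[OF that] by auto
  have subU: "\<Union>\<D> \<subseteq> U" using D by fast
  have UD: "\<Union>\<D> \<in> lmeasurable"
    by (rule fmeasurableI2[OF U subU]) (use cD lmD in \<open>auto intro!: sets.countable_Union\<close>)
  obtain \<C> where cC: "\<C> \<subseteq> \<D>" "finite \<C>" "measure lebesgue (\<Union>\<D>) - \<epsilon> < measure lebesgue (\<Union>\<C>)"
  proof (rule measure_countable_Union_approachable[OF cD \<open>\<epsilon> > 0\<close>, of "measure lebesgue U"])
    fix D' assume "D' \<subseteq> \<D>" "finite D'"
    then show "measure lebesgue (\<Union> D') \<le> measure lebesgue U"
      using U lmD subU by (intro measure_mono_fmeasurable) (auto intro!: sets.finite_Union)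
  qed (use lmD in auto)
  have UC: "\<Union>\<C> \<in> lmeasurable" using cC lmD by (intro fmeasurable.finite_Union) auto
  have "measure lebesgue (E - \<Union>\<C>) \<le> measure lebesgue ((E - \<Union>\<D>) \<union> (\<Union>\<D> - \<Union>\<C>))"
    using E UD UC by (intro measure_mono_fmeasurable) (auto intro!: fmeasurable.Un fmeasurable.Diff)
  also have "\<dots> \<le> measure lebesgue (E - \<Union>\<D>) + measure lebesgue (\<Union>\<D> - \<Union>\<C>)"
    using E UD UC by (intro measure_Un_le) auto
  also have "measure lebesgue (\<Union>\<D> - \<Union>\<C>) = measure lebesgue (\<Union>\<D>) - measure lebesgue (\<Union>\<C>)"
    using UD UC cC by (intro measurable_measure_Diff) auto
  also have "measure lebesgue (E - \<Union>\<D>) = 0" using neg by (rule negligible_imp_measure0)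
  finally have "measure lebesgue (E - \<Union>\<C>) < \<epsilon>" using cC(3) by simp
  then show thesis
    using that[OF cC(2) pairwise_subset[OF disj cC(1)]] D cC(1) by (meson subsetD)
qed

text \<open>
  When the intervals of \<open>\<D>\<close> lie inside those of \<open>\<C>\<close>, what is left over can be cut into
  intervals again, and increments are additive. Taking the identity for \<open>f\<close> gives the same statement for
  lengths.
\<close>

lemma nested_intervals_remainder:
  fixes \<C> \<D> :: "real set set"
  assumes C: "finite \<C>" "pairwise disjnt \<C>" "\<And>k. k \<in> \<C> \<Longrightarrow> \<exists>u w. k = {u..w} \<and> u < w"
    and D: "finite \<D>" "pairwise disjnt \<D>" "\<And>k. k \<in> \<D> \<Longrightarrow> \<exists>u w. k = {u..w} \<and> u < w"
    and sub: "\<And>k. k \<in> \<D> \<Longrightarrow> \<exists>I\<in>\<C>. k \<subseteq> I"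
  obtains \<R> where "\<R> division_of \<Union>\<R>" "\<Union>\<R> \<subseteq> \<Union>\<C>"
    "\<forall>f :: real \<Rightarrow> real. (\<Sum>k\<in>\<R>. f (Sup k) - f (Inf k))
        = (\<Sum>k\<in>\<C>. f (Sup k) - f (Inf k)) - (\<Sum>k\<in>\<D>. f (Sup k) - f (Inf k))"
proof -
  define DI where "DI I = {k\<in>\<D>. k \<subseteq> I}" for I
  have "\<exists>q. DI I \<subseteq> q \<and> q division_of I" if I: "I \<in> \<C>" for I
  proof -
    obtain a b where ab: "I = cbox a b" using C(3)[OF I] box_real(2) by metis
    have "DI I division_of \<Union>(DI I)"
    proof (rule division_ofI)
      fix k assume "k \<in> DI I"
      then have "k \<in> \<D>" by (simp add: DI_def)
      then obtain u w where k: "k = {u..w}" "u < w" using D(3) by metis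
      then show "k \<noteq> {}" "\<exists>a b. k = cbox a b" by auto
    next
      fix k1 k2 assume "k1 \<in> DI I" "k2 \<in> DI I" "k1 \<noteq> k2"
      then have "disjnt k1 k2" using D(2) by (auto simp: DI_def pairwise_def)
      then show "interior k1 \<inter> interior k2 = {}"
        using interior_subset by (fastforce simp: disjnt_def)
    qed (use D(1) in \<open>auto simp: DI_def\<close>)
    then obtain q where "DI I \<subseteq> q" "q division_of cbox a b"
      using partial_division_extend_interval[of "DI I" a b] ab by (auto simp: DI_def)
    then show ?thesis using ab by blast
  qed
  then obtain q where q: "\<And>I. I \<in> \<C> \<Longrightarrow> DI I \<subseteq> q I" "\<And>I. I \<in> \<C> \<Longrightarrow> q I division_of I"
    by metis
  define \<R> where "\<R> = (\<Union>I\<in>\<C>. q I - DI I)"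
  have fq: "finite (q I)" if "I \<in> \<C>" for I using q(2)[OF that] by (rule division_ofD(1))
  have qsub: "k \<subseteq> I" "k \<noteq> {}" "\<exists>a b. k = cbox a b" if "I \<in> \<C>" "k \<in> q I" for I k
    using division_ofD(2,3,4)[OF q(2)[OF that(1)] that(2)] by auto
  have Rdiv: "\<R> division_of \<Union>\<R>"
  proof (rule division_ofI)
    show "finite \<R>" using C(1) fq by (auto simp: \<R>_def)
    fix k1 k2 assume k: "k1 \<in> \<R>" "k2 \<in> \<R>" "k1 \<noteq> k2"
    then obtain I1 I2 where I: "I1 \<in> \<C>" "k1 \<in> q I1" "I2 \<in> \<C>" "k2 \<in> q I2"
      by (auto simp: \<R>_def)
    show "interior k1 \<inter> interior k2 = {}"
    proof (cases "I1 = I2")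
      case True
      then show ?thesis using division_ofD(5)[OF q(2)[OF I(1)] I(2)] I k by auto
    next
      case False
      then have "I1 \<inter> I2 = {}" using C(2) I by (auto simp: pairwise_def disjnt_def)
      then show ?thesis using qsub(1)[OF I(1,2)] qsub(1)[OF I(3,4)] interior_subset by blast
    qed
  qed (use qsub in \<open>fastforce simp: \<R>_def\<close>)+
  have Rsub: "\<Union>\<R> \<subseteq> \<Union>\<C>" using qsub(1) by (fastforce simp: \<R>_def)
  have D_eq: "\<D> = (\<Union>I\<in>\<C>. DI I)" using sub by (auto simp: DI_def)
  have eq: "(\<Sum>k\<in>\<R>. f (Sup k) - f (Inf k))
        = (\<Sum>k\<in>\<C>. f (Sup k) - f (Inf k)) - (\<Sum>k\<in>\<D>. f (Sup k) - f (Inf k))" for f :: "real \<Rightarrow> real"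
  proof -
    let ?g = "\<lambda>k. f (Sup k) - f (Inf k)"
    have disj: "q I1 \<inter> q I2 = {}" if "I1 \<in> \<C>" "I2 \<in> \<C>" "I1 \<noteq> I2" for I1 I2
    proof (rule ccontr)
      assume "q I1 \<inter> q I2 \<noteq> {}"
      then obtain k where k: "k \<in> q I1" "k \<in> q I2" by auto
      have "I1 \<inter> I2 = {}" using C(2) that by (auto simp: pairwise_def disjnt_def)
      then show False using qsub(1,2)[OF that(1) k(1)] qsub(1)[OF that(2) k(2)] by auto
    qed
    have "sum ?g \<R> = (\<Sum>I\<in>\<C>. sum ?g (q I - DI I))"
      unfolding \<R>_def using disj fq C(1) by (intro sum.UNION_disjoint) blast+
    also have "\<dots> = (\<Sum>I\<in>\<C>. sum ?g (q I) - sum ?g (DI I))"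
      using fq q(1) by (intro sum.cong sum_diff) auto
    also have "\<dots> = (\<Sum>I\<in>\<C>. sum ?g (q I)) - (\<Sum>I\<in>\<C>. sum ?g (DI I))"
      by (rule sum_subtractf)
    also have "(\<Sum>I\<in>\<C>. sum ?g (q I)) = (\<Sum>I\<in>\<C>. ?g I)"
    proof (rule sum.cong)
      fix I assume I: "I \<in> \<C>"
      then obtain u w where uw: "I = {u..w}" "u < w" using C(3) by metis
      then show "sum ?g (q I) = ?g I"
        using increment_sum_division[of "q I" u w f] q(2)[OF I] by simp
    qed simp
    also have "(\<Sum>I\<in>\<C>. sum ?g (DI I)) = sum ?g \<D>"
    proof -
      have "sum ?g (\<Union>I\<in>\<C>. DI I) = (\<Sum>I\<in>\<C>. sum ?g (DI I))"
      proof (rule sum.UNION_disjoint)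
        show "\<forall>i\<in>\<C>. \<forall>j\<in>\<C>. i \<noteq> j \<longrightarrow> DI i \<inter> DI j = {}"
          using disj q(1) by blast
      qed (use C(1) D(1) in \<open>auto simp: DI_def\<close>)
      then show ?thesis using D_eq by simp
    qed
    finally show ?thesis .
  qed
  show thesis using that[OF Rdiv Rsub] eq by blast
qed

text \<open>
  Points in arbitrarily short intervals over which the mean slope of \<open>f\<close> exceeds \<open>q\<close>. The point is
  required to lie strictly inside the interval: this makes the set a countable intersection of
  open sets, so that no outer measures are needed. For continuous \<open>f\<close> the one-sided
  difference quotients are recovered as limits.
\<close>

definition steep_points :: "real \<Rightarrow> real \<Rightarrow> (real \<Rightarrow> real) \<Rightarrow> real \<Rightarrow> real set" where
  "steep_points a b f q = (\<Inter>n. \<Union>{{u<..<w} | u w. a \<le> u \<and> u < w \<and> w \<le> b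
      \<and> w - u < inverse (real (Suc n)) \<and> q * (w - u) < f w - f u})"

lemma steep_points_borel: "steep_points a b f q \<in> sets borel"
  unfolding steep_points_def by (rule sets.countable_INT'') (auto intro!: borel_open open_Union)

lemma steep_points_subset: "steep_points a b f q \<subseteq> {a<..<b}"
  unfolding steep_points_def by fastforce

lemma steep_points_lmeasurable: "steep_points a b f q \<in> lmeasurable"
proof (rule fmeasurableI2)
  show "{a<..<b} \<in> lmeasurable" by simp
  show "steep_points a b f q \<in> sets lebesgue" using steep_points_borel by auto
qed (rule steep_points_subset)

lemma steep_pointsD:
  assumes "t \<in> steep_points a b f q" "d > 0"
  obtains u w where "a \<le> u" "u < t" "t < w" "w \<le> b" "w - u < d" "q * (w - u) < f w - f u"
proof -
  obtain n where n: "inverse (real (Suc n)) < d" using reals_Archimedean[OF assms(2)] by auto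
  from assms(1) obtain u w where "t \<in> {u<..<w}" "a \<le> u" "w \<le> b"
      "w - u < inverse (real (Suc n))" "q * (w - u) < f w - f u"
    unfolding steep_points_def by blast
  then show thesis using n by (intro that[of u w]) auto
qed

lemma steep_pointsD_open:
  assumes "t \<in> steep_points a b f q" "d > 0" "open U" "t \<in> U"
  shows "\<exists>u w. u < w \<and> u \<le> t \<and> t \<le> w \<and> w - u < d \<and> {u..w} \<subseteq> U \<and>
     (a \<le> u \<and> w \<le> b \<and> q * (w - u) < f w - f u)"
proof -
  obtain r where r: "r > 0" "ball t r \<subseteq> U" using assms(3,4) openE by blast
  obtain u w where uw: "a \<le> u" "u < t" "t < w" "w \<le> b" "w - u < min d r" "q * (w - u) < f w - f u"
    using steep_pointsD[OF assms(1), of "min d r"] assms(2) r(1) by auto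
  have "{u..w} \<subseteq> ball t r" using uw by (auto simp: ball_eq_greaterThanLessThan)
  then show ?thesis using uw r(2) by (intro exI[of _ u] exI[of _ w]) auto
qed

text \<open>
  Let \<open>s\<close> be the measure of the set. Cover it by short intervals of slope below \<open>p\<close>, and inside
  these cover it again by intervals of slope above \<open>q\<close>. Both families have total length
  close to \<open>s\<close>, so the first has total increment at most about \<open>p * s\<close>, the second at
  least about \<open>q * s\<close>. The remainder has small length, hence by absolute continuity a
  small increment, so \<open>q * s \<le> p * s\<close> in the limit.
\<close>

lemma steep_points_separated:
  assumes f: "abs_cont_on_interval a b f" and pq: "p < q"
  shows "negligible (steep_points a b f q \<inter> steep_points a b (\<lambda>t. - f t) (- p))"
proof -
  define E where "E = steep_points a b f q \<inter> steep_points a b (\<lambda>t. - f t) (- p)"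
  define s where "s = measure lebesgue E"
  have E: "E \<in> lmeasurable" using steep_points_lmeasurable by (auto simp: E_def)
  have "s = 0"
  proof (rule ccontr)
    assume "s \<noteq> 0"
    then have s: "s > 0" by (simp add: s_def zero_less_measure_iff)
    define c where "c = \<bar>p\<bar> + \<bar>q\<bar> + 1"
    have c: "c > 0" unfolding c_def by linarith
    \<comment> \<open>An error of \<open>(\<bar>p\<bar> + \<bar>q\<bar> + 1) * \<eta>\<close> is still smaller than \<open>(q - p) * s\<close>.\<close>
    define \<eta> where "\<eta> = (q - p) * s / (2 * c)"
    have \<eta>: "\<eta> > 0" using s pq c by (simp add: \<eta>_def)
    have "c * \<eta> = (q - p) * s / 2"
      using c by (simp add: \<eta>_def)
    moreover have "(q - p) * s > 0" using s pq by simp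
    ultimately have \<eta>2: "(\<bar>p\<bar> + \<bar>q\<bar> + 1) * \<eta> < (q - p) * s" unfolding c_def by linarith
    obtain \<delta> where \<delta>: "\<delta> > 0" and ac:
      "\<And>\<D>. \<D> division_of \<Union>\<D> \<Longrightarrow> \<Union>\<D> \<subseteq> {a..b} \<Longrightarrow> (\<Sum>k\<in>\<D>. measure lborel k) < \<delta> \<Longrightarrow>
         (\<Sum>k\<in>\<D>. norm (f (Sup k) - f (Inf k))) < \<eta>"
      using abs_cont_division[OF f \<eta>] by metis
    define \<rho> where "\<rho> = min \<delta> \<eta> / 4"
    have \<rho>: "\<rho> > 0" "4 * \<rho> \<le> \<delta>" "4 * \<rho> \<le> \<eta>" using \<delta> \<eta> by (auto simp: \<rho>_def)
    obtain U0 where U0: "open U0" "E \<subseteq> U0" "U0 - E \<in> lmeasurable" "emeasure lebesgue (U0 - E) < ennreal \<rho>"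
      using sets_lebesgue_outer_open[of E \<rho>] E \<rho> by auto
    define U where "U = U0 \<inter> {a<..<b}"
    have EU: "E \<subseteq> U" using U0 steep_points_subset by (fastforce simp: U_def E_def)
    have oU: "open U" using U0 by (auto simp: U_def)
    have U: "U \<in> lmeasurable" by (rule fmeasurableI2[of "{a<..<b}"]) (use oU in \<open>auto simp: U_def\<close>)
    have Um: "measure lebesgue U \<le> s + \<rho>"
    proof -
      have "measure lebesgue (U0 - E) < \<rho>"
        using U0(3,4) \<rho>(1) by (simp add: emeasure_eq_measure2 ennreal_less_iff)
      moreover have "measure lebesgue (U - E) \<le> measure lebesgue (U0 - E)"
        using U0(3) U E by (intro measure_mono_fmeasurable) (auto simp: U_def)
      moreover have "measure lebesgue (U - E) = measure lebesgue U - s"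
        unfolding s_def using U E EU by (intro measurable_measure_Diff) auto
      ultimately show ?thesis by simp
    qed
    obtain \<C> where C: "finite \<C>" "pairwise disjnt \<C>"
      "\<And>k. k \<in> \<C> \<Longrightarrow> \<exists>u w. k = {u..w} \<and> u < w \<and> {u..w} \<subseteq> U \<and>
          (a \<le> u \<and> w \<le> b \<and> - p * (w - u) < - f w - - f u)"
      "measure lebesgue (E - \<Union>\<C>) < \<rho>"
    proof (rule Vitali_finite_intervals[OF E U \<rho>(1),
            of "\<lambda>u w. a \<le> u \<and> w \<le> b \<and> - p * (w - u) < - f w - - f u"])
      fix x d :: real assume x: "x \<in> E" and d: "d > 0"
      then have "x \<in> steep_points a b (\<lambda>t. - f t) (- p)" "x \<in> U"
        using EU by (auto simp: E_def)
      then show "\<exists>u w. u < w \<and> u \<le> x \<and> x \<le> w \<and> w - u < d \<and> {u..w} \<subseteq> U \<and>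
          (a \<le> u \<and> w \<le> b \<and> - p * (w - u) < - f w - - f u)"
        using steep_pointsD_open[OF _ d oU] by blast
    qed auto
    define E1 where "E1 = E \<inter> (\<Union>k\<in>\<C>. interior k)"
    have "open (\<Union>k\<in>\<C>. interior k)" by auto
    then have E1: "E1 \<in> lmeasurable"
      unfolding E1_def
      by (metis E borel_open fmeasurable_Int_fmeasurable sets_completionI_sets sets_lborel)
    obtain \<D> where D: "finite \<D>" "pairwise disjnt \<D>"
      "\<And>k. k \<in> \<D> \<Longrightarrow> \<exists>u w. k = {u..w} \<and> u < w \<and> {u..w} \<subseteq> U \<and>
          ((\<exists>I\<in>\<C>. {u..w} \<subseteq> I) \<and> q * (w - u) < f w - f u)"
      "measure lebesgue (E1 - \<Union>\<D>) < \<rho>"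
    proof (rule Vitali_finite_intervals[OF E1 U \<rho>(1),
            of "\<lambda>u w. (\<exists>I\<in>\<C>. {u..w} \<subseteq> I) \<and> q * (w - u) < f w - f u"])
      fix x d :: real assume x: "x \<in> E1" and d: "d > 0"
      then obtain I where I: "I \<in> \<C>" "x \<in> interior I" by (auto simp: E1_def)
      have xs: "x \<in> steep_points a b f q" "x \<in> U" using x EU by (auto simp: E1_def E_def)
      have "\<exists>u w. u < w \<and> u \<le> x \<and> x \<le> w \<and> w - u < d \<and> {u..w} \<subseteq> U \<inter> interior I \<and>
          (a \<le> u \<and> w \<le> b \<and> q * (w - u) < f w - f u)"
        by (rule steep_pointsD_open[OF xs(1) d]) (use oU xs(2) I in auto)
      then show "\<exists>u w. u < w \<and> u \<le> x \<and> x \<le> w \<and> w - u < d \<and> {u..w} \<subseteq> U \<and>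
          ((\<exists>I\<in>\<C>. {u..w} \<subseteq> I) \<and> q * (w - u) < f w - f u)"
        using I(1) interior_subset[of I] by (meson Int_subset_iff subset_trans)
    qed auto
    have C_int: "\<exists>u w. k = {u..w} \<and> u < w" if "k \<in> \<C>" for k using C(3)[OF that] by blast
    have D_int: "\<exists>u w. k = {u..w} \<and> u < w" if "k \<in> \<D>" for k using D(3)[OF that] by blast
    have D_sub: "\<exists>I\<in>\<C>. k \<subseteq> I" if "k \<in> \<D>" for k using D(3)[OF that] by blast
    have CU: "\<Union>\<C> \<subseteq> U" using C(3) by fast
    have DU: "\<Union>\<D> \<subseteq> U" using D(3) by fast
    obtain \<R> where R: "\<R> division_of \<Union>\<R>" "\<Union>\<R> \<subseteq> \<Union>\<C>"
      "\<forall>f :: real \<Rightarrow> real. (\<Sum>k\<in>\<R>. f (Sup k) - f (Inf k))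
        = (\<Sum>k\<in>\<C>. f (Sup k) - f (Inf k)) - (\<Sum>k\<in>\<D>. f (Sup k) - f (Inf k))"
      by (rule nested_intervals_remainder[OF C(1,2) C_int D(1,2) D_int D_sub])
    define cC where "cC = (\<Sum>k\<in>\<C>. Sup k - Inf k)"
    define cD where "cD = (\<Sum>k\<in>\<D>. Sup k - Inf k)"
    have cC: "measure lebesgue (\<Union>\<C>) = cC" "\<Union>\<C> \<in> lmeasurable"
    proof -
      have iv: "\<exists>u w. k = {u..w}" if "k \<in> \<C>" for k using C_int[OF that] by metis
      have "measure lborel k = Sup k - Inf k" if k: "k \<in> \<C>" for k
      proof -
        obtain u w where "k = {u..w}" "u < w" using C_int[OF k] by metis
        then show ?thesis by simp
      qed
      then show "measure lebesgue (\<Union>\<C>) = cC" "\<Union>\<C> \<in> lmeasurable"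
        using measure_Union_disjoint_intervals[OF C(1,2) iv] unfolding cC_def by auto
    qed
    have cD: "measure lebesgue (\<Union>\<D>) = cD" "\<Union>\<D> \<in> lmeasurable"
    proof -
      have iv: "\<exists>u w. k = {u..w}" if "k \<in> \<D>" for k using D_int[OF that] by metis
      have "measure lborel k = Sup k - Inf k" if k: "k \<in> \<D>" for k
      proof -
        obtain u w where "k = {u..w}" "u < w" using D_int[OF k] by metis
        then show ?thesis by simp
      qed
      then show "measure lebesgue (\<Union>\<D>) = cD" "\<Union>\<D> \<in> lmeasurable"
        using measure_Union_disjoint_intervals[OF D(1,2) iv] unfolding cD_def by auto
    qed
    have upC: "cC \<le> s + \<rho>"
      using measure_mono_fmeasurable[OF CU _ U] cC Um by auto
    have upD: "cD \<le> s + \<rho>"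
      using measure_mono_fmeasurable[OF DU _ U] cD Um by auto
    have loC: "s - \<rho> \<le> cC"
    proof -
      have "s \<le> measure lebesgue ((E - \<Union>\<C>) \<union> \<Union>\<C>)"
        unfolding s_def using E cC(2) by (intro measure_mono_fmeasurable) auto
      also have "\<dots> \<le> measure lebesgue (E - \<Union>\<C>) + cC"
        unfolding cC(1)[symmetric] using E cC(2) by (intro measure_Un_le) auto
      finally show ?thesis using C(4) by simp
    qed
    have loD: "s - 2 * \<rho> \<le> cD"
    proof -
      define Pt where "Pt = (\<Union>k\<in>\<C>. {Inf k, Sup k})"
      have Pt: "finite Pt" using C(1) by (auto simp: Pt_def)
      then have nPt: "negligible Pt" by (rule negligible_finite)
      have lPt: "Pt \<in> lmeasurable" using nPt by (rule negligible_imp_measurable)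
      have sub: "E \<subseteq> (E - \<Union>\<C>) \<union> ((E1 - \<Union>\<D>) \<union> \<Union>\<D>) \<union> Pt"
      proof
        fix x assume x: "x \<in> E"
        show "x \<in> (E - \<Union>\<C>) \<union> ((E1 - \<Union>\<D>) \<union> \<Union>\<D>) \<union> Pt"
        proof (cases "x \<in> \<Union>\<C>")
          case True
          then obtain k where k: "k \<in> \<C>" "x \<in> k" by auto
          obtain u w where uw: "k = {u..w}" "u < w" using C_int[OF k(1)] by metis
          show ?thesis
          proof (cases "x = u \<or> x = w")
            case True
            then have "x \<in> Pt" using k uw by (auto simp: Pt_def intro!: bexI[of _ k])
            then show ?thesis by simp
          next
            case False
            then have "x \<in> E1" using x k uw
              by (auto simp: E1_def interior_atLeastAtMost_real intro!: bexI[of _ k])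
            then show ?thesis by auto
          qed
        qed (use x in auto)
      qed
      have "s \<le> measure lebesgue ((E - \<Union>\<C>) \<union> ((E1 - \<Union>\<D>) \<union> \<Union>\<D>) \<union> Pt)"
        unfolding s_def using E E1 cC(2) cD(2) lPt sub by (intro measure_mono_fmeasurable) auto
      also have "\<dots> \<le> measure lebesgue ((E - \<Union>\<C>) \<union> ((E1 - \<Union>\<D>) \<union> \<Union>\<D>)) + measure lebesgue Pt"
        using E E1 cC(2) cD(2) lPt by (intro measure_Un_le) auto
      also have "\<dots> \<le> measure lebesgue (E - \<Union>\<C>) + measure lebesgue ((E1 - \<Union>\<D>) \<union> \<Union>\<D>) + 0"
        using E E1 cC(2) cD(2) negligible_imp_measure0[OF nPt]
        by (intro add_mono measure_Un_le) auto
      also have "measure lebesgue ((E1 - \<Union>\<D>) \<union> \<Union>\<D>) \<le> measure lebesgue (E1 - \<Union>\<D>) + cD"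
        unfolding cD(1)[symmetric] using E1 cD(2) by (intro measure_Un_le) auto
      finally show ?thesis using C(4) D(4) by simp
    qed
    have "(\<Sum>k\<in>\<R>. measure lborel k) = (\<Sum>k\<in>\<R>. Sup k - Inf k)"
    proof (rule sum.cong)
      fix k assume "k \<in> \<R>"
      then obtain u w where "k = cbox u w" "k \<noteq> {}"
        using division_ofD(3)[OF R(1)] division_ofD(4)[OF R(1)] by blast
      then show "measure lborel k = Sup k - Inf k" by auto
    qed simp
    also have "\<dots> = cC - cD" using R(3)[rule_format, of "\<lambda>x. x"] by (simp add: cC_def cD_def)
    also have "\<dots> < \<delta>" using upC loD \<rho> by simp
    finally have "(\<Sum>k\<in>\<R>. norm (f (Sup k) - f (Inf k))) < \<eta>"
    proof (rule ac[OF R(1), rotated])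
      show "\<Union>\<R> \<subseteq> {a..b}"
      proof -
        have "U \<subseteq> {a..b}" by (auto simp: U_def)
        then show ?thesis using R(2) CU by (meson subset_trans)
      qed
    qed
    moreover have "\<bar>\<Sum>k\<in>\<R>. f (Sup k) - f (Inf k)\<bar> \<le> (\<Sum>k\<in>\<R>. norm (f (Sup k) - f (Inf k)))"
      unfolding real_norm_def by (rule sum_abs)
    \<comment> \<open>By absolute continuity the increments of \<open>\<C>\<close> and \<open>\<D>\<close> differ by less than \<open>\<eta>\<close>.\<close>
    ultimately have rem: "(\<Sum>k\<in>\<D>. f (Sup k) - f (Inf k)) - \<eta> < (\<Sum>k\<in>\<C>. f (Sup k) - f (Inf k))"
      using R(3)[rule_format, of f] by linarith
    have "(\<Sum>k\<in>\<C>. f (Sup k) - f (Inf k)) \<le> (\<Sum>k\<in>\<C>. p * (Sup k - Inf k))"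
    proof (rule sum_mono)
      fix k assume "k \<in> \<C>"
      then obtain u w where "k = {u..w}" "u < w" "- p * (w - u) < - f w - - f u" using C(3) by metis
      then show "f (Sup k) - f (Inf k) \<le> p * (Sup k - Inf k)" by simp
    qed
    then have 1: "(\<Sum>k\<in>\<C>. f (Sup k) - f (Inf k)) \<le> p * cC" by (simp add: cC_def sum_distrib_left)
    have "(\<Sum>k\<in>\<D>. q * (Sup k - Inf k)) \<le> (\<Sum>k\<in>\<D>. f (Sup k) - f (Inf k))"
    proof (rule sum_mono)
      fix k assume "k \<in> \<D>"
      then obtain u w where "k = {u..w}" "u < w" "q * (w - u) < f w - f u" using D(3) by metis
      then show "q * (Sup k - Inf k) \<le> f (Sup k) - f (Inf k)" by simp
    qed
    then have 2: "q * cD \<le> (\<Sum>k\<in>\<D>. f (Sup k) - f (Inf k))" by (simp add: cD_def sum_distrib_left)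
    have aux: "c * x \<le> \<bar>c\<bar> * r" if "\<bar>x\<bar> \<le> r" for c x r :: real
    proof -
      have "c * x \<le> \<bar>c\<bar> * \<bar>x\<bar>" using abs_ge_self[of "c * x"] by (simp add: abs_mult)
      also have "\<dots> \<le> \<bar>c\<bar> * r" using that by (intro mult_left_mono) auto
      finally show ?thesis .
    qed
    have "p * (cC - s) \<le> \<bar>p\<bar> * \<rho>"
      by (rule aux) (use upC loC in linarith)
    moreover have "(- q) * (cD - s) \<le> \<bar>- q\<bar> * (2 * \<rho>)"
      by (rule aux) (use upD loD \<rho>(1) in linarith)
    then have "- (q * (cD - s)) \<le> \<bar>q\<bar> * (2 * \<rho>)" by simp
    ultimately have "q * s - \<bar>q\<bar> * (2 * \<rho>) - \<eta> < p * s + \<bar>p\<bar> * \<rho>"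
      using 1 2 rem by (simp add: algebra_simps)
    moreover have "\<bar>q\<bar> * (2 * \<rho>) \<le> \<bar>q\<bar> * \<eta>" "\<bar>p\<bar> * \<rho> \<le> \<bar>p\<bar> * \<eta>"
      using \<rho> \<eta> by (intro mult_left_mono; simp)+
    ultimately show False using \<eta>2 by (simp add: algebra_simps)
  qed
  then show ?thesis using E by (simp add: E_def s_def negligible_iff_measure)
qed

lemma disjoint_intervals_division:
  fixes \<C> :: "real set set"
  assumes "finite \<C>" "pairwise disjnt \<C>" "\<And>k. k \<in> \<C> \<Longrightarrow> \<exists>u w. k = {u..w} \<and> u < w"
  shows "\<C> division_of \<Union>\<C>"
proof (rule division_ofI)
  fix k assume "k \<in> \<C>"
  then obtain u w where k: "k = {u..w}" "u < w" using assms(3) by metis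
  then show "k \<noteq> {}" "\<exists>a b. k = cbox a b" by auto
next
  fix k1 k2 assume "k1 \<in> \<C>" "k2 \<in> \<C>" "k1 \<noteq> k2"
  then have "k1 \<inter> k2 = {}" using assms(2) by (auto simp: pairwise_def disjnt_def)
  then show "interior k1 \<inter> interior k2 = {}"
    using interior_subset[of k1] interior_subset[of k2] by blast
qed (use assms(1) in auto)

text \<open>
  Inside a window shorter than the \<open>\<delta>\<close> that belongs to \<open>\<epsilon> = 1\<close>, disjoint intervals have total increment
  below 1. A subset of positive measure could be covered by intervals of slope \<open>n\<close>, whose total
  increment is at least \<open>n\<close> times half its measure.
\<close>

lemma infinitely_steep_negligible:
  assumes f: "abs_cont_on_interval a b f"
  shows "negligible (\<Inter>n. steep_points a b f (real n))"
proof -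
  define E where "E = (\<Inter>n. steep_points a b f (real n))"
  obtain \<delta> where \<delta>: "\<delta> > 0" and ac:
      "\<And>\<D>. \<D> division_of \<Union>\<D> \<Longrightarrow> \<Union>\<D> \<subseteq> {a..b} \<Longrightarrow> (\<Sum>k\<in>\<D>. measure lborel k) < \<delta> \<Longrightarrow>
         (\<Sum>k\<in>\<D>. norm (f (Sup k) - f (Inf k))) < 1"
    using abs_cont_division[OF f zero_less_one] by metis
  define h where "h = \<delta> / 4"
  have h: "h > 0" using \<delta> by (simp add: h_def)
  have Eb: "E \<in> sets borel" unfolding E_def
    using steep_points_borel by (intro sets.countable_INT'') auto
  have Esub: "E \<subseteq> {a<..<b}" using steep_points_subset[of a b f "real 0"] unfolding E_def by blast
  have small: "negligible (E \<inter> {c<..<c + 2 * h})" for c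
  proof -
    define E' where "E' = E \<inter> {c<..<c + 2 * h}"
    define s where "s = measure lebesgue E'"
    define U where "U = {a<..<b} \<inter> {c<..<c + 2 * h}"
    have oU: "open U" by (auto simp: U_def)
    have U: "U \<in> lmeasurable" unfolding U_def by (intro fmeasurable.Int) auto
    have Um: "measure lebesgue U \<le> 2 * h"
    proof -
      have "measure lebesgue U \<le> measure lebesgue {c<..<c + 2 * h}"
        using U by (intro measure_mono_fmeasurable) (auto simp: U_def)
      then show ?thesis using h by simp
    qed
    have E'U: "E' \<subseteq> U" using Esub by (auto simp: E'_def U_def)
    have "E' \<in> sets borel" using Eb by (simp add: E'_def)
    then have E': "E' \<in> lmeasurable" by (intro fmeasurableI2[OF U E'U]) auto
    have "s = 0"
    proof (rule ccontr)
      assume "s \<noteq> 0"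
      then have s: "s > 0" by (simp add: s_def zero_less_measure_iff)
      obtain n where n: "real n > 2 / s" using reals_Archimedean2 by blast
      obtain \<C> where C: "finite \<C>" "pairwise disjnt \<C>"
        "\<And>k. k \<in> \<C> \<Longrightarrow> \<exists>u w. k = {u..w} \<and> u < w \<and> {u..w} \<subseteq> U \<and> (real n * (w - u) < f w - f u)"
        "measure lebesgue (E' - \<Union>\<C>) < s / 2"
      proof (rule Vitali_finite_intervals[OF E' U, of "s / 2" "\<lambda>u w. real n * (w - u) < f w - f u"])
        fix x d :: real assume x: "x \<in> E'" and d: "d > 0"
        then have "x \<in> steep_points a b f (real n)" "x \<in> U" using E'U by (auto simp: E'_def E_def)
        then show "\<exists>u w. u < w \<and> u \<le> x \<and> x \<le> w \<and> w - u < d \<and> {u..w} \<subseteq> U \<and>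
          (real n * (w - u) < f w - f u)"
          using steep_pointsD_open[OF _ d oU] by blast
      qed (use s in auto)
      have C_int: "\<exists>u w. k = {u..w} \<and> u < w" if "k \<in> \<C>" for k using C(3)[OF that] by blast
      have iv: "\<exists>u w. k = {u..w}" if "k \<in> \<C>" for k using C_int[OF that] by metis
      have CU: "\<Union>\<C> \<subseteq> U" using C(3) by fast
      note mC = measure_Union_disjoint_intervals[OF C(1,2) iv]
      have "s \<le> measure lebesgue ((E' - \<Union>\<C>) \<union> \<Union>\<C>)"
        unfolding s_def using E' mC(2) by (intro measure_mono_fmeasurable) auto
      also have "\<dots> \<le> measure lebesgue (E' - \<Union>\<C>) + measure lebesgue (\<Union>\<C>)"
        using E' mC(2) by (intro measure_Un_le) auto
      finally have lo: "s / 2 < measure lebesgue (\<Union>\<C>)" using C(4) by simp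
      have up: "measure lebesgue (\<Union>\<C>) \<le> 2 * h"
        using measure_mono_fmeasurable[OF CU _ U] mC(2) Um by auto
      have "(\<Sum>k\<in>\<C>. norm (f (Sup k) - f (Inf k))) < 1"
      proof (rule ac[OF disjoint_intervals_division[OF C(1,2) C_int]])
        have "U \<subseteq> {a..b}" by (auto simp: U_def)
        then show "\<Union>\<C> \<subseteq> {a..b}" using CU by (meson subset_trans)
        show "(\<Sum>k\<in>\<C>. measure lborel k) < \<delta>" using up mC(1) h \<delta> by (simp add: h_def)
      qed
      moreover have "(\<Sum>k\<in>\<C>. real n * measure lborel k) \<le> (\<Sum>k\<in>\<C>. norm (f (Sup k) - f (Inf k)))"
      proof (rule sum_mono)
        fix k assume "k \<in> \<C>"
        then obtain u w where k: "k = {u..w}" "u < w" "real n * (w - u) < f w - f u"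
          using C(3) by metis
        then show "real n * measure lborel k \<le> norm (f (Sup k) - f (Inf k))" by simp
      qed
      ultimately have "real n * measure lebesgue (\<Union>\<C>) < 1"
        using mC(1) by (simp add: sum_distrib_left)
      moreover have "real n * (s / 2) \<le> real n * measure lebesgue (\<Union>\<C>)"
        using lo by (intro mult_left_mono) auto
      moreover have "1 \<le> real n * (s / 2)" using n s by (simp add: field_simps)
      ultimately show False by simp
    qed
    then show ?thesis using E' by (simp add: E'_def s_def negligible_iff_measure)
  qed
  have "E \<subseteq> (\<Union>i::int. E \<inter> {of_int i * h<..<of_int i * h + 2 * h})"
  proof
    fix t assume t: "t \<in> E"
    define i where "i = \<lceil>t / h\<rceil> - 1"
    have "of_int i < t / h" "t / h \<le> of_int i + 1" unfolding i_def by linarith+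
    then have "of_int i * h < t" "t \<le> of_int i * h + h" using h by (simp_all add: field_simps)
    then show "t \<in> (\<Union>i::int. E \<inter> {of_int i * h<..<of_int i * h + 2 * h})"
      using t h by auto
  qed
  moreover have "negligible (\<Union>i::int. E \<inter> {of_int i * h<..<of_int i * h + 2 * h})"
    by (rule negligible_countable_Union) (use small in auto)
  ultimately show ?thesis unfolding E_def[symmetric] by (rule negligible_subset[rotated])
qed

lemma not_steepD:
  assumes "t \<notin> steep_points a b f q"
  shows "\<exists>d>0. \<forall>u w. a \<le> u \<and> u < t \<and> t < w \<and> w \<le> b \<and> w - u < d \<longrightarrow> f w - f u \<le> q * (w - u)"
proof -
  obtain n where n: "t \<notin> \<Union>{{u<..<w} | u w. a \<le> u \<and> u < w \<and> w \<le> b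
      \<and> w - u < inverse (real (Suc n)) \<and> q * (w - u) < f w - f u}"
    using assms unfolding steep_points_def by blast
  show ?thesis
  proof (intro exI[of _ "inverse (real (Suc n))"] conjI allI impI)
    fix u w assume uw: "a \<le> u \<and> u < t \<and> t < w \<and> w \<le> b \<and> w - u < inverse (real (Suc n))"
    show "f w - f u \<le> q * (w - u)"
    proof (rule ccontr)
      assume "\<not> f w - f u \<le> q * (w - u)"
      then have "t \<in> {u<..<w}" "a \<le> u \<and> u < w \<and> w \<le> b
         \<and> w - u < inverse (real (Suc n)) \<and> q * (w - u) < f w - f u" using uw by auto
      then show False using n by blast
    qed
  qed simp
qed

text \<open>
  The mean slopes over short intervals around \<open>t\<close> have a limit: it is the infimum of the
  rational eventual upper bounds, because below a rational that is not an eventual upper bound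
  all rationals are eventual lower bounds. By continuity an endpoint of the interval may be moved to \<open>t\<close>.
\<close>

lemma differentiable_if_not_steep:
  assumes cont: "continuous_on {a..b} f" and t: "t \<in> {a<..<b}"
    and up: "\<exists>n. t \<notin> steep_points a b f (real n)"
    and lo: "\<exists>n. t \<notin> steep_points a b (\<lambda>t. - f t) (real n)"
    and sep: "\<And>p q. p < q \<Longrightarrow> p \<in> \<rat> \<Longrightarrow> q \<in> \<rat> \<Longrightarrow>
        t \<notin> steep_points a b f q \<inter> steep_points a b (\<lambda>t. - f t) (- p)"
  obtains L where "(f has_vector_derivative L) (at t within {a..b})"
proof -
  define up where "up q \<longleftrightarrow> (\<exists>d>0. \<forall>u w. a \<le> u \<and> u < t \<and> t < w \<and> w \<le> b \<and> w - u < d \<longrightarrow>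
    f w - f u \<le> q * (w - u))" for q
  define lo where "lo p \<longleftrightarrow> (\<exists>d>0. \<forall>u w. a \<le> u \<and> u < t \<and> t < w \<and> w \<le> b \<and> w - u < d \<longrightarrow>
    f w - f u \<ge> p * (w - u))" for p
  have upI: "up q" if "t \<notin> steep_points a b f q" for q
    using not_steepD[OF that] unfolding up_def .
  have loI: "lo p" if "t \<notin> steep_points a b (\<lambda>t. - f t) (- p)" for p
  proof -
    from not_steepD[OF that] obtain d where d: "d > 0" "\<forall>u w. a \<le> u \<and> u < t \<and> t < w \<and> w \<le> b \<and> w - u < d \<longrightarrow>
       - f w - - f u \<le> - p * (w - u)" by (elim exE conjE)
    have "f w - f u \<ge> p * (w - u)" if "a \<le> u \<and> u < t \<and> t < w \<and> w \<le> b \<and> w - u < d" for u w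
      using d(2)[rule_format, OF that] by simp
    then show ?thesis unfolding lo_def using d(1) by blast
  qed
  have lo_le_up: "p \<le> q" if lop: "lo p" and upq: "up q" for p q
  proof -
    obtain d1 where d1: "d1 > 0" "\<And>u w. a \<le> u \<and> u < t \<and> t < w \<and> w \<le> b \<and> w - u < d1 \<Longrightarrow>
       f w - f u \<ge> p * (w - u)" using lop unfolding lo_def by blast
    obtain d2 where d2: "d2 > 0" "\<And>u w. a \<le> u \<and> u < t \<and> t < w \<and> w \<le> b \<and> w - u < d2 \<Longrightarrow>
       f w - f u \<le> q * (w - u)" using upq unfolding up_def by blast
    define r where "r = Min {d1, d2, t - a, b - t} / 3"
    have r: "r > 0" "3 * r \<le> d1" "3 * r \<le> d2" "3 * r \<le> t - a" "3 * r \<le> b - t"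
      using t d1 d2 by (auto simp: r_def)
    have "p * (2 * r) \<le> f (t + r) - f (t - r)"
      using d1(2)[of "t - r" "t + r"] r by simp
    also have "\<dots> \<le> q * (2 * r)"
      using d2(2)[of "t - r" "t + r"] r by simp
    finally show ?thesis using r(1) by simp
  qed
  obtain n1 where n1: "up (real n1)" using up upI by blast
  obtain n2 where n2: "lo (- real n2)" using lo loI[of "- real n2" for n2] by force
  define S where "S = {q \<in> \<rat>. up q}"
  define L where "L = Inf S"
  have "real n1 \<in> S" using n1 by (simp add: S_def)
  then have S: "S \<noteq> {}" "bdd_below S"
    using n2 lo_le_up bdd_belowI[of S "- real n2"] by (blast, simp add: S_def)
  have approx: "\<exists>d>0. \<forall>u w. a \<le> u \<and> u < t \<and> t < w \<and> w \<le> b \<and> w - u < d \<longrightarrow>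
    \<bar>f w - f u - L * (w - u)\<bar> \<le> e * (w - u)" if e: "e > 0" for e
  proof -
    obtain q where q: "q \<in> S" "q < L + e" using cInf_lessD[OF S(1), of "L + e"] e by (auto simp: L_def)
    obtain q' where q': "q' \<in> \<rat>" "L - e / 2 < q'" "q' < L" using Rats_dense_in_real[of "L - e / 2" L] e by auto
    obtain p where p: "p \<in> \<rat>" "L - e < p" "p < L - e / 2" using Rats_dense_in_real[of "L - e" "L - e/2"] e by auto
    have "q' \<notin> S" using q' S(2) cInf_lower[of q' S] by (auto simp: L_def)
    then have "t \<in> steep_points a b f q'" using upI q'(1) by (auto simp: S_def)
    then have "lo p" using sep[of p q'] p q' loI by force
    moreover have "up q" using q by (simp add: S_def)
    ultimately obtain d1 d2 where d1: "d1 > 0" "\<And>u w. a \<le> u \<and> u < t \<and> t < w \<and> w \<le> b \<and> w - u < d1 \<Longrightarrow>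
         f w - f u \<ge> p * (w - u)" and d2: "d2 > 0" "\<And>u w. a \<le> u \<and> u < t \<and> t < w \<and> w \<le> b \<and> w - u < d2 \<Longrightarrow>
         f w - f u \<le> q * (w - u)" unfolding lo_def up_def by blast
    show ?thesis
    proof (intro exI[of _ "min d1 d2"] conjI allI impI)
      fix u w assume uw: "a \<le> u \<and> u < t \<and> t < w \<and> w \<le> b \<and> w - u < min d1 d2"
      have "p * (w - u) \<ge> (L - e) * (w - u)" "q * (w - u) \<le> (L + e) * (w - u)"
        using uw p q by (intro mult_right_mono; simp)+
      moreover have "p * (w - u) \<le> f w - f u" "f w - f u \<le> q * (w - u)" using d1(2) d2(2) uw by auto
      ultimately show "\<bar>f w - f u - L * (w - u)\<bar> \<le> e * (w - u)"
        by (simp add: abs_le_iff algebra_simps)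
    qed (use d1 d2 in simp)
  qed
  have ct: "isCont f t" using cont t by (simp add: continuous_on_interior)
  have "(f has_derivative (\<lambda>x. x *\<^sub>R L)) (at t within {a..b})"
    unfolding has_derivative_within_alt
  proof (intro conjI allI impI)
    show "bounded_linear (\<lambda>x. x *\<^sub>R L)" by (rule bounded_linear_scaleR_left)
    fix e :: real assume "e > 0"
    from approx[OF this] obtain d where d: "d > 0" "\<And>u w. a \<le> u \<and> u < t \<and> t < w \<and> w \<le> b \<and> w - u < d \<Longrightarrow>
      \<bar>f w - f u - L * (w - u)\<bar> \<le> e * (w - u)" by blast
    show "\<exists>d>0. \<forall>y\<in>{a..b}. norm (y - t) < d \<longrightarrow>
        norm (f y - f t - (y - t) *\<^sub>R L) \<le> e * norm (y - t)"
    proof (intro exI[of _ d] conjI ballI impI)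
      fix y assume y: "y \<in> {a..b}" "norm (y - t) < d"
      consider "y = t" | "y > t" | "y < t" by linarith
      then show "norm (f y - f t - (y - t) *\<^sub>R L) \<le> e * norm (y - t)"
      proof cases
        case 2
        have lim: "((\<lambda>u. e * (y - u) - \<bar>f y - f u - L * (y - u)\<bar>) \<longlongrightarrow> e * (y - t) - \<bar>f y - f t - L * (y - t)\<bar>) (at_left t)"
          using ct by (intro tendsto_intros) (auto simp: isCont_def filterlim_at_split)
        have "\<forall>\<^sub>F u in at_left t. u > max a (y - d)"
          using t y 2 by (intro eventually_at_leftI[of "max a (y - d)"]) auto
        moreover have "\<forall>\<^sub>F u in at_left t. u < t" by (simp add: eventually_at_filter)
        ultimately have "\<forall>\<^sub>F u in at_left t. 0 \<le> e * (y - u) - \<bar>f y - f u - L * (y - u)\<bar>"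
        proof eventually_elim
          case (elim u)
          then show ?case using d(2)[of u y] 2 y by auto
        qed
        from tendsto_lowerbound[OF lim this] show ?thesis using 2 by (simp add: algebra_simps)
      next
        case 3
        have lim: "((\<lambda>w. e * (w - y) - \<bar>f w - f y - L * (w - y)\<bar>) \<longlongrightarrow> e * (t - y) - \<bar>f t - f y - L * (t - y)\<bar>) (at_right t)"
          using ct by (intro tendsto_intros) (auto simp: isCont_def filterlim_at_split)
        have "\<forall>\<^sub>F u in at_right t. u < min b (y + d)"
          using t y 3 by (intro eventually_at_rightI[of _ "min b (y + d)"]) auto
        moreover have "\<forall>\<^sub>F u in at_right t. t < u" by (simp add: eventually_at_filter)
        ultimately have "\<forall>\<^sub>F w in at_right t. 0 \<le> e * (w - y) - \<bar>f w - f y - L * (w - y)\<bar>"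
        proof eventually_elim
          case (elim u)
          then show ?case using d(2)[of y u] 3 y by auto
        qed
        from tendsto_lowerbound[OF lim this]
        have "\<bar>f t - f y - L * (t - y)\<bar> \<le> e * (t - y)" by simp
        moreover have "f y - f t - (y - t) *\<^sub>R L = - (f t - f y - L * (t - y))" by (simp add: algebra_simps)
        ultimately show ?thesis using 3 by (simp only: real_norm_def abs_minus_cancel) simp
      qed simp
    qed (use d in simp)
  qed
  then show thesis by (intro that[of L]) (simp add: has_vector_derivative_def)
qed

lemma abs_cont_uminus:
  assumes "abs_cont_on_interval a b f" shows "abs_cont_on_interval a b (\<lambda>t. - f t)"
  using assms unfolding abs_cont_on_interval_def by (simp add: norm_minus_commute)

text \<open>
  The exceptional points are those of infinite slope and those at which two rationals separate the
  upper from the lower slope.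
\<close>

theorem abs_cont_differentiable_ae:
  fixes f :: "real \<Rightarrow> real"
  assumes f: "abs_cont_on_interval a b f"
  shows "negligible {t \<in> {a..b}. \<not> (\<exists>L. (f has_vector_derivative L) (at t within {a..b}))}"
proof -
  define N where "N = (\<Inter>n. steep_points a b f (real n)) \<union> (\<Inter>n. steep_points a b (\<lambda>t. - f t) (real n))
     \<union> (\<Union>(p,q)\<in>{(p,q). p \<in> \<rat> \<and> q \<in> \<rat> \<and> p < q}. steep_points a b f q \<inter> steep_points a b (\<lambda>t. - f t) (- p)) \<union> {a,b}"
  have cnt: "countable {(p,q). p \<in> \<rat> \<and> q \<in> \<rat> \<and> p < (q::real)}"
    by (rule countable_subset[OF _ countable_SIGMA[of \<rat> "\<lambda>_. \<rat>"]]) (auto simp: countable_rat)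
  have "negligible (\<Union>(p,q)\<in>{(p,q). p \<in> \<rat> \<and> q \<in> \<rat> \<and> p < q}. steep_points a b f q \<inter> steep_points a b (\<lambda>t. - f t) (- p))"
    using cnt steep_points_separated[OF f] by (intro negligible_countable_Union) auto
  then have "negligible N" unfolding N_def
    using infinitely_steep_negligible[OF f] infinitely_steep_negligible[OF abs_cont_uminus[OF f]]
    by (intro negligible_Un) (auto intro: negligible_finite)
  moreover have "{t \<in> {a..b}. \<not> (\<exists>L. (f has_vector_derivative L) (at t within {a..b}))} \<subseteq> N"
  proof (rule subsetI, rule ccontr)
    fix t assume t: "t \<in> {t \<in> {a..b}. \<not> (\<exists>L. (f has_vector_derivative L) (at t within {a..b}))}" "t \<notin> N"
    obtain L where "(f has_vector_derivative L) (at t within {a..b})"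
    proof (rule differentiable_if_not_steep[OF abs_cont_imp_continuous[OF f], of t])
      show "t \<in> {a<..<b}" using t by (auto simp: N_def)
      show "\<exists>n. t \<notin> steep_points a b f (real n)" "\<exists>n. t \<notin> steep_points a b (\<lambda>t. - f t) (real n)"
        using t(2) by (auto simp: N_def)
      show "t \<notin> steep_points a b f q \<inter> steep_points a b (\<lambda>t. - f t) (- p)"
        if "p < q" "p \<in> \<rat>" "q \<in> \<rat>" for p q
        using t(2) that unfolding N_def by blast
    qed auto
    then show False using t by blast
  qed
  ultimately show ?thesis by (rule negligible_subset)
qed

section \<open>The fundamental theorem of calculus for absolutely continuous functions\<close>

text \<open>
  Absolute continuity passes from \<open>f\<close> to every function whose increments are dominated by those
  of \<open>f\<close>: restrictions, Lipschitz images and components are special cases.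
\<close>

lemma abs_cont_dominated:
  fixes f :: "real \<Rightarrow> 'a::real_normed_vector" and g :: "real \<Rightarrow> 'b::real_normed_vector"
  assumes f: "abs_cont_on_interval a b f" and sub: "a \<le> c" "d \<le> b"
    and dom: "\<And>s t. c \<le> s \<Longrightarrow> s \<le> t \<Longrightarrow> t \<le> d \<Longrightarrow> norm (g t - g s) \<le> L * norm (f t - f s)"
  shows "abs_cont_on_interval c d g"
  unfolding abs_cont_iff
proof (intro allI impI)
  fix \<epsilon> :: real assume e: "\<epsilon> > 0"
  define M where "M = max L 1"
  have M: "M > 0" "L \<le> M" by (auto simp: M_def)
  have "\<epsilon> / M > 0" using e M by simp
  then obtain \<delta> where \<delta>: "\<delta> > 0" and *: "\<forall>n s t. nonoverlapping_intervals a b n s t \<longrightarrow>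
     (\<Sum>i<n. t i - s i) < \<delta> \<longrightarrow> (\<Sum>i<n. norm (f (t i) - f (s i))) < \<epsilon> / M"
    using f unfolding abs_cont_iff by blast
  have "(\<Sum>i<n. norm (g (t i) - g (s i))) < \<epsilon>"
    if st: "nonoverlapping_intervals c d n s t" and len: "(\<Sum>i<n. t i - s i) < \<delta>" for n s t
  proof -
    have "\<forall>i<n. a \<le> s i \<and> s i \<le> t i \<and> t i \<le> b"
      using st sub unfolding nonoverlapping_intervals_def by (meson order_trans)
    then have "nonoverlapping_intervals a b n s t"
      using st unfolding nonoverlapping_intervals_def by blast
    then have "(\<Sum>i<n. norm (f (t i) - f (s i))) < \<epsilon> / M" using * len by blast
    then have "M * (\<Sum>i<n. norm (f (t i) - f (s i))) < \<epsilon>" using M by (simp add: field_simps)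
    moreover have "(\<Sum>i<n. norm (g (t i) - g (s i))) \<le> (\<Sum>i<n. M * norm (f (t i) - f (s i)))"
    proof (rule sum_mono)
      fix i assume "i \<in> {..<n}"
      then have "norm (g (t i) - g (s i)) \<le> L * norm (f (t i) - f (s i))"
        using st by (intro dom) (auto simp: nonoverlapping_intervals_def)
      also have "\<dots> \<le> M * norm (f (t i) - f (s i))" using M by (intro mult_right_mono) auto
      finally show "norm (g (t i) - g (s i)) \<le> M * norm (f (t i) - f (s i))" .
    qed
    ultimately show ?thesis by (simp add: sum_distrib_left)
  qed
  then show "\<exists>\<delta>>0. \<forall>n s t. nonoverlapping_intervals c d n s t \<longrightarrow>
     (\<Sum>i<n. t i - s i) < \<delta> \<longrightarrow> (\<Sum>i<n. norm (g (t i) - g (s i))) < \<epsilon>"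
    using \<delta> by blast
qed

lemma abs_cont_subinterval:
  fixes f :: "real \<Rightarrow> 'a::real_normed_vector"
  assumes "abs_cont_on_interval a b f" "a \<le> c" "d \<le> b"
  shows "abs_cont_on_interval c d f"
  by (rule abs_cont_dominated[OF assms, of f 1]) simp

lemma abs_cont_Lipschitz:
  fixes f :: "real \<Rightarrow> 'a::real_normed_vector"
  assumes "\<And>s t. a \<le> s \<Longrightarrow> s \<le> t \<Longrightarrow> t \<le> b \<Longrightarrow> norm (f t - f s) \<le> L * (t - s)"
  shows "abs_cont_on_interval a b f"
proof (rule abs_cont_dominated[of a b "\<lambda>t::real. t" a b f L])
  have "(\<Sum>i<n. norm (t i - s i)) = (\<Sum>i<n. t i - s i)" if "nonoverlapping_intervals a b n s t" for n s t
    by (rule sum.cong) (use that in \<open>auto simp: nonoverlapping_intervals_def\<close>)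
  then show "abs_cont_on_interval a b (\<lambda>t::real. t)" unfolding abs_cont_iff by auto
qed (use assms in auto)

lemma abs_cont_diff:
  fixes f g :: "real \<Rightarrow> 'a::real_normed_vector"
  assumes f: "abs_cont_on_interval a b f" and g: "abs_cont_on_interval a b g"
  shows "abs_cont_on_interval a b (\<lambda>t. f t - g t)"
  unfolding abs_cont_iff
proof (intro allI impI)
  fix \<epsilon> :: real assume "\<epsilon> > 0"
  then have e2: "\<epsilon> / 2 > 0" by simp
  obtain \<delta> where \<delta>: "\<delta> > 0" and *: "\<forall>n s t. nonoverlapping_intervals a b n s t \<longrightarrow>
     (\<Sum>i<n. t i - s i) < \<delta> \<longrightarrow> (\<Sum>i<n. norm (f (t i) - f (s i))) < \<epsilon> / 2"
    using f e2 unfolding abs_cont_iff by blast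
  obtain \<delta>' where \<delta>': "\<delta>' > 0" and **: "\<forall>n s t. nonoverlapping_intervals a b n s t \<longrightarrow>
     (\<Sum>i<n. t i - s i) < \<delta>' \<longrightarrow> (\<Sum>i<n. norm (g (t i) - g (s i))) < \<epsilon> / 2"
    using g e2 unfolding abs_cont_iff by blast
  have "(\<Sum>i<n. norm (f (t i) - g (t i) - (f (s i) - g (s i)))) < \<epsilon>"
    if st: "nonoverlapping_intervals a b n s t" and len: "(\<Sum>i<n. t i - s i) < min \<delta> \<delta>'" for n s t
  proof -
    have "(\<Sum>i<n. norm (f (t i) - g (t i) - (f (s i) - g (s i))))
       \<le> (\<Sum>i<n. norm (f (t i) - f (s i)) + norm (g (t i) - g (s i)))"
    proof (rule sum_mono)
      fix i
      have "f (t i) - g (t i) - (f (s i) - g (s i)) = (f (t i) - f (s i)) - (g (t i) - g (s i))" by simp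
      then show "norm (f (t i) - g (t i) - (f (s i) - g (s i)))
        \<le> norm (f (t i) - f (s i)) + norm (g (t i) - g (s i))" by (metis norm_triangle_ineq4)
    qed
    moreover have "(\<Sum>i<n. norm (f (t i) - f (s i))) < \<epsilon> / 2" using * st len by auto
    moreover have "(\<Sum>i<n. norm (g (t i) - g (s i))) < \<epsilon> / 2" using ** st len by auto
    ultimately show ?thesis by (simp add: sum.distrib)
  qed
  then show "\<exists>\<delta>>0. \<forall>n s t. nonoverlapping_intervals a b n s t \<longrightarrow>
     (\<Sum>i<n. t i - s i) < \<delta> \<longrightarrow> (\<Sum>i<n. norm (f (t i) - g (t i) - (f (s i) - g (s i)))) < \<epsilon>"
    using \<delta> \<delta>' by (intro exI[of _ "min \<delta> \<delta>'"]) auto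
qed

text \<open>
  Away from the negligible set the gauge is chosen as in the fundamental theorem for everywhere differentiable
  functions. At a tag in \<open>N\<close> it is an open neighbourhood of \<open>N\<close> of small measure: the
  intervals with such tags have small total length, hence by absolute continuity a small
  total increment.
\<close>

lemma abs_cont_FTC_real:
  fixes f g :: "real \<Rightarrow> real"
  assumes f: "abs_cont_on_interval a b f" and ab: "a \<le> b" and N: "negligible N"
    and der: "\<And>t. t \<in> {a..b} - N \<Longrightarrow> (f has_vector_derivative g t) (at t within {a..b})"
  shows "(g has_integral (f b - f a)) {a..b}"
proof (rule has_integral_spike[OF N])
  define h where "h = (\<lambda>t. if t \<in> N then 0 else g t)"
  show "\<And>x. x \<in> {a..b} - N \<Longrightarrow> g x = h x" by (simp add: h_def)
  show "(h has_integral (f b - f a)) {a..b}"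
    unfolding has_integral_real
  proof (intro allI impI)
    fix e :: real assume e: "e > 0"
    define e1 where "e1 = e / (2 * (b - a + 1))"
    have e1: "e1 > 0" using e ab by (simp add: e1_def)
    have e1b: "e1 * (b - a) \<le> e / 2" using e ab by (simp add: e1_def field_simps)
    have "\<forall>t. \<exists>d>0. t \<in> {a..b} - N \<longrightarrow>
         (\<forall>y\<in>{a..b}. norm (y - t) < d \<longrightarrow> norm (f y - f t - (y - t) *\<^sub>R g t) \<le> e1 * norm (y - t))"
      using der e1 unfolding has_vector_derivative_def has_derivative_within_alt
      by (metis (no_types, lifting) gt_ex)
    then obtain d where d: "\<And>t. 0 < d t"
        "\<And>t y. \<lbrakk>t \<in> {a..b} - N; y \<in> {a..b}; norm (y - t) < d t\<rbrakk>
            \<Longrightarrow> norm (f y - f t - (y - t) *\<^sub>R g t) \<le> e1 * norm (y - t)"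
      by metis
    obtain \<delta> where \<delta>: "\<delta> > 0" and ac:
      "\<And>\<D>. \<D> division_of \<Union>\<D> \<Longrightarrow> \<Union>\<D> \<subseteq> {a..b} \<Longrightarrow> (\<Sum>k\<in>\<D>. measure lborel k) < \<delta> \<Longrightarrow>
         (\<Sum>k\<in>\<D>. norm (f (Sup k) - f (Inf k))) < e / 2"
      using abs_cont_division[OF f half_gt_zero[OF e]] by metis
    have Nl: "N \<in> sets lebesgue" using negligible_imp_sets[OF N] .
    obtain U where U: "open U" "N \<subseteq> U" "U - N \<in> lmeasurable" "emeasure lebesgue (U - N) < ennreal \<delta>"
      using sets_lebesgue_outer_open[OF Nl \<delta>] by metis
    have UN: "U = (U - N) \<union> N" using U(2) by auto
    have Um: "U \<in> lmeasurable"
      using fmeasurable.Un[OF U(3) negligible_imp_measurable[OF N]] UN by simp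
    have "measure lebesgue (U - N) < \<delta>"
      using U(3,4) \<delta> by (simp add: emeasure_eq_measure2 ennreal_less_iff)
    moreover have "measure lebesgue U \<le> measure lebesgue (U - N) + measure lebesgue N"
      using measure_Un_le[of "U - N" lebesgue N] U(3) Nl UN by auto
    ultimately have mU: "measure lebesgue U < \<delta>" using negligible_imp_measure0[OF N] by simp
    define \<gamma> where "\<gamma> t = (if t \<in> N then U else ball t (d t))" for t
    have "gauge \<gamma>" using U(1,2) d(1) by (auto simp: gauge_def \<gamma>_def)
    moreover have "norm ((\<Sum>(x, k)\<in>\<D>. measure lborel k *\<^sub>R h x) - (f b - f a)) < e"
      if D: "\<D> tagged_division_of {a..b}" and fine: "\<gamma> fine \<D>" for \<D>
    proof -
      have fin: "finite \<D>" using D by auto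
      define D1 where "D1 = {(x,k)\<in>\<D>. x \<notin> N}"
      define D2 where "D2 = {(x,k)\<in>\<D>. x \<in> N}"
      have D12: "\<D> = D1 \<union> D2" "D1 \<inter> D2 = {}" "finite D1" "finite D2"
        using fin by (auto simp: D1_def D2_def intro: finite_subset)
      let ?g = "\<lambda>(x,k). measure lborel k *\<^sub>R h x - (f (Sup k) - f (Inf k))"
      have kform: "\<exists>u v. k = {u..v} \<and> u \<le> v \<and> x \<in> {u..v} \<and> {u..v} \<subseteq> {a..b} \<and> {u..v} \<subseteq> \<gamma> x"
        if xk: "(x,k) \<in> \<D>" for x k
      proof -
        obtain u v where uv: "k = cbox u v" using tagged_division_ofD(4)[OF D xk] by blast
        show ?thesis
          using uv tagged_division_ofD(2,3)[OF D xk] fine xk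
          by (intro exI[of _ u] exI[of _ v]) (auto simp: fine_def)
      qed
      have "(\<Sum>(x, k)\<in>\<D>. measure lborel k *\<^sub>R h x) - (f b - f a) = sum ?g \<D>"
        by (simp add: additive_tagged_division_1[OF ab D, symmetric] sum_subtractf split_def)
      also have "\<dots> = sum ?g D1 + sum ?g D2" using D12 by (simp add: sum.union_disjoint)
      finally have eq: "(\<Sum>(x, k)\<in>\<D>. measure lborel k *\<^sub>R h x) - (f b - f a) = sum ?g D1 + sum ?g D2" .
      have "norm (sum ?g D1) \<le> (\<Sum>(x,k)\<in>D1. e1 * (Sup k - Inf k))"
      proof (rule sum_norm_le, clarify)
        fix x k assume xk1: "(x,k) \<in> D1"
        then have xk: "(x,k) \<in> \<D>" "x \<notin> N" by (auto simp: D1_def)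
        obtain u v where uv: "k = {u..v}" "u \<le> v" "x \<in> {u..v}" "{u..v} \<subseteq> {a..b}" "{u..v} \<subseteq> \<gamma> x"
          using kform[OF xk(1)] by blast
        have xab: "x \<in> {a..b} - N" using uv xk by auto
        have "u \<in> {u..v}" "v \<in> {u..v}" using uv(2) by auto
        then have "u \<in> {a..b}" "v \<in> {a..b}" "u \<in> ball x (d x)" "v \<in> ball x (d x)"
          using subsetD[OF uv(4)] subsetD[OF uv(5)] xk(2) by (simp_all add: \<gamma>_def)
        then have "norm (f u - f x - (u - x) *\<^sub>R g x) \<le> e1 * norm (u - x)"
          "norm (f v - f x - (v - x) *\<^sub>R g x) \<le> e1 * norm (v - x)"
          using d(2)[OF xab] by (auto simp: dist_norm norm_minus_commute)
        then have "\<bar>f u - f x - (u - x) * g x\<bar> \<le> e1 * (x - u)" "\<bar>f v - f x - (v - x) * g x\<bar> \<le> e1 * (v - x)"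
          using uv by auto
        then have "\<bar>(v - u) * g x - (f v - f u)\<bar> \<le> e1 * (v - u)"
          by (auto simp: abs_le_iff algebra_simps)
        then show "norm (measure lborel k *\<^sub>R h x - (f (Sup k) - f (Inf k))) \<le> e1 * (Sup k - Inf k)"
          using uv xk by (simp add: h_def)
      qed
      also have "\<dots> \<le> (\<Sum>(x,k)\<in>\<D>. e1 * (Sup k - Inf k))"
      proof (rule sum_mono2[OF fin])
        fix z assume "z \<in> \<D> - D1"
        then obtain x k where z: "z = (x,k)" "(x,k) \<in> \<D>" by (cases z) auto
        obtain u v where "k = {u..v}" "u \<le> v" using kform[OF z(2)] by blast
        then show "0 \<le> (case z of (x,k) \<Rightarrow> e1 * (Sup k - Inf k))" using z e1 by simp
      qed (use D12 in auto)
      also have "\<dots> = e1 * (b - a)"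
        using additive_tagged_division_1[OF ab D, of "\<lambda>x. x"]
        by (simp add: sum_distrib_left[symmetric] split_def)
      finally have b1: "norm (sum ?g D1) \<le> e / 2" using e1b by simp
      have D2p: "D2 tagged_partial_division_of {a..b}"
        by (rule tagged_partial_division_subset[of \<D>])
           (use D in \<open>auto simp: tagged_division_of_def D2_def\<close>)
      have div2: "snd ` D2 division_of \<Union>(snd ` D2)"
        by (rule partial_division_of_tagged_division[OF D2p])
      have sub2: "\<Union>(snd ` D2) \<subseteq> {a..b}" "\<Union>(snd ` D2) \<subseteq> U"
        using kform by (fastforce simp: D2_def \<gamma>_def)+
      have "(\<Sum>k\<in>snd ` D2. measure lborel k) = (\<Sum>k\<in>snd ` D2. measure lebesgue k)"
      proof (rule sum.cong)
        fix k assume "k \<in> snd ` D2"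
        then obtain x where "(x,k) \<in> \<D>" by (auto simp: D2_def)
        then obtain u v where "k = {u..v}" using kform by blast
        then show "measure lborel k = measure lebesgue k" by simp
      qed simp
      also have "\<dots> = measure lebesgue (\<Union>(snd ` D2))" by (rule content_division[OF div2])
      also have "\<dots> \<le> measure lebesgue U"
        using lmeasurable_division[OF div2] sub2 Um by (intro measure_mono_fmeasurable) auto
      also have "\<dots> < \<delta>" by (rule mU)
      finally have ac2: "(\<Sum>k\<in>snd ` D2. norm (f (Sup k) - f (Inf k))) < e / 2"
        by (rule ac[OF div2 sub2(1)])
      \<comment> \<open>The empty interval needs a value of its own, as the supremum of the empty set is unspecified.\<close>
      define \<psi> where "\<psi> k = (if k = {} then 0 else norm (f (Sup k) - f (Inf k)))" for k
      have "norm (sum ?g D2) \<le> (\<Sum>(x,k)\<in>D2. \<psi> k)"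
      proof (rule sum_norm_le, clarify)
        fix x k assume "(x,k) \<in> D2"
        then have xk: "(x,k) \<in> \<D>" "x \<in> N" by (auto simp: D2_def)
        then obtain u v where "k = {u..v}" "u \<le> v" using kform by blast
        then show "norm (measure lborel k *\<^sub>R h x - (f (Sup k) - f (Inf k))) \<le> \<psi> k"
          using xk(2) by (simp add: h_def \<psi>_def abs_minus_commute)
      qed
      also have "\<dots> = (\<Sum>k\<in>snd ` D2. \<psi> k)"
      proof (rule sum.over_tagged_division_lemma[OF tagged_partial_division_of_Union_self[OF D2p]])
        fix u v :: real assume "box u v = {}"
        then have "v \<le> u" by (simp add: box_real)
        then show "\<psi> (cbox u v) = 0" by (cases "u = v") (auto simp: \<psi>_def)
      qed
      also have "\<dots> \<le> (\<Sum>k\<in>snd ` D2. norm (f (Sup k) - f (Inf k)))"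
        by (rule sum_mono) (simp add: \<psi>_def)
      finally have b2: "norm (sum ?g D2) < e / 2" using ac2 by simp
      show ?thesis unfolding eq using norm_triangle_ineq[of "sum ?g D1" "sum ?g D2"] b1 b2 by simp
    qed
    ultimately show "\<exists>\<gamma>. gauge \<gamma> \<and> (\<forall>\<D>. \<D> tagged_division_of {a..b} \<and> \<gamma> fine \<D> \<longrightarrow>
        norm ((\<Sum>(x, k)\<in>\<D>. measure lborel k *\<^sub>R h x) - (f b - f a)) < e)"
      by (intro exI[of _ \<gamma>]) simp
  qed
qed

lemma abs_cont_inner:
  fixes f :: "real \<Rightarrow> 'a::euclidean_space"
  assumes "abs_cont_on_interval a b f"
  shows "abs_cont_on_interval a b (\<lambda>t. f t \<bullet> i)"
proof (rule abs_cont_dominated[OF assms order_refl order_refl])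
  fix s t :: real
  have "norm (f t \<bullet> i - f s \<bullet> i) = \<bar>(f t - f s) \<bullet> i\<bar>" by (simp add: inner_diff_left)
  also have "\<dots> \<le> norm i * norm (f t - f s)"
    using Cauchy_Schwarz_ineq2[of "f t - f s" i] by (simp add: mult.commute)
  finally show "norm (f t \<bullet> i - f s \<bullet> i) \<le> norm i * norm (f t - f s)" .
qed

lemma abs_cont_FTC:
  fixes f g :: "real \<Rightarrow> 'a::euclidean_space"
  assumes f: "abs_cont_on_interval a b f" and ab: "a \<le> b" and N: "negligible N"
    and der: "\<And>t. t \<in> {a..b} - N \<Longrightarrow> (f has_vector_derivative g t) (at t within {a..b})"
  shows "(g has_integral (f b - f a)) {a..b}"
proof (subst has_integral_componentwise_iff, intro ballI)
  fix i :: 'a assume "i \<in> Basis"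
  have "((\<lambda>t. g t \<bullet> i) has_integral (f b \<bullet> i - f a \<bullet> i)) {a..b}"
  proof (rule abs_cont_FTC_real[OF abs_cont_inner[OF f] ab N])
    fix t assume "t \<in> {a..b} - N"
    from der[OF this] show "((\<lambda>t. f t \<bullet> i) has_vector_derivative g t \<bullet> i) (at t within {a..b})"
      by (rule bounded_linear.has_vector_derivative[OF bounded_linear_inner_left])
  qed
  then show "((\<lambda>x. g x \<bullet> i) has_integral (f b - f a) \<bullet> i) {a..b}" by (simp add: inner_diff_left)
qed

lemma abs_cont_vector_derivative_ae:
  fixes f :: "real \<Rightarrow> 'a::euclidean_space"
  assumes f: "abs_cont_on_interval a b f"
  shows "\<exists>N. negligible N \<and> (\<forall>t\<in>{a..b} - N.
    (f has_vector_derivative vector_derivative f (at t within {a..b})) (at t within {a..b}))"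
proof -
  define N where "N = (\<Union>i\<in>(Basis::'a set). {t \<in> {a..b}. \<not> (\<exists>L. ((\<lambda>t. f t \<bullet> i) has_vector_derivative L) (at t within {a..b}))})"
  have "negligible N" unfolding N_def
    using abs_cont_differentiable_ae[OF abs_cont_inner[OF f]]
    by (intro negligible_Union) auto
  moreover have "(f has_vector_derivative vector_derivative f (at t within {a..b})) (at t within {a..b})"
    if t: "t \<in> {a..b} - N" for t
  proof -
    from t have "\<forall>i\<in>Basis. \<exists>L. ((\<lambda>t. f t \<bullet> i) has_vector_derivative L) (at t within {a..b})"
      by (auto simp: N_def)
    then obtain L where L: "\<And>i. i \<in> Basis \<Longrightarrow> ((\<lambda>t. f t \<bullet> i) has_vector_derivative L i) (at t within {a..b})"
      by metis
    have "((\<lambda>t. \<Sum>i\<in>Basis. (f t \<bullet> i) *\<^sub>R i) has_vector_derivative (\<Sum>i\<in>Basis. L i *\<^sub>R i)) (at t within {a..b})"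
      by (intro has_vector_derivative_sum bounded_linear.has_vector_derivative[OF bounded_linear_scaleR_left] L)
    then have "(f has_vector_derivative (\<Sum>i\<in>Basis. L i *\<^sub>R i)) (at t within {a..b})"
      by (simp add: euclidean_representation)
    then show "(f has_vector_derivative vector_derivative f (at t within {a..b})) (at t within {a..b})"
      by (meson differentiableI_vector vector_derivative_works)
  qed
  ultimately show ?thesis by blast
qed

lemma abs_cont_vector_derivative_measurable:
  fixes f :: "real \<Rightarrow> 'a::euclidean_space"
  assumes f: "abs_cont_on_interval a b f" and ab: "a \<le> b"
  shows "(\<lambda>t. vector_derivative f (at t within {a..b})) \<in> borel_measurable (lebesgue_on {a..b})"
proof -
  obtain N where N: "negligible N" "\<And>t. t \<in> {a..b} - N \<Longrightarrow>
    (f has_vector_derivative vector_derivative f (at t within {a..b})) (at t within {a..b})"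
    using abs_cont_vector_derivative_ae[OF f] by blast
  have "((\<lambda>t. vector_derivative f (at t within {a..b})) has_integral f b - f a) {a..b}"
    by (rule abs_cont_FTC[OF f ab N])
  from has_integral_implies_lebesgue_measurable[OF this] show ?thesis
    by (simp add: borel_measurable_restrict_space_iff)
qed

text \<open>
  On the compact range of \<open>u\<close> the function \<open>\<phi>\<close> is Lipschitz, so \<open>\<phi> \<circ> u\<close> is absolutely continuous
  and the fundamental theorem applies to it.
\<close>

lemma abs_cont_chain_rule:
  fixes u u' D :: "_ \<Rightarrow> 'a::euclidean_space" and \<phi> :: "'a \<Rightarrow> real"
  assumes u: "abs_cont_on_interval a b u" and ab: "a \<le> b" and N: "negligible N"
    and der: "\<And>t. t \<in> {a..b} - N \<Longrightarrow> (u has_vector_derivative u' t) (at t within {a..b})"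
    and \<phi>: "\<And>y. (\<phi> has_derivative (\<lambda>h. D y \<bullet> h)) (at y)" and D: "continuous_on UNIV D"
  shows "((\<lambda>t. D (u t) \<bullet> u' t) has_integral (\<phi> (u b) - \<phi> (u a))) {a..b}"
proof -
  obtain R where R: "\<And>t. t \<in> {a..b} \<Longrightarrow> norm (u t) \<le> R"
    using compact_continuous_bound[OF compact_Icc abs_cont_imp_continuous[OF u]] by blast
  obtain L where L: "\<And>y. y \<in> cball 0 R \<Longrightarrow> norm (D y) \<le> L"
    using compact_continuous_bound[OF compact_cball continuous_on_subset[OF D subset_UNIV], of 0 R] by blast
  have lip: "norm (\<phi> y - \<phi> z) \<le> L * norm (y - z)" if "y \<in> cball 0 R" "z \<in> cball 0 R" for y z
    using bounded_gradient_Lipschitz[OF \<phi> L that] .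
  have "abs_cont_on_interval a b (\<phi> \<circ> u)"
    by (rule abs_cont_dominated[OF u, of _ _ _ L]) (use lip R in auto)
  then have "((\<lambda>t. D (u t) \<bullet> u' t) has_integral ((\<phi> \<circ> u) b - (\<phi> \<circ> u) a)) {a..b}"
  proof (rule abs_cont_FTC_real[OF _ ab N])
    fix t assume "t \<in> {a..b} - N"
    from vector_derivative_diff_chain_within[OF der[OF this] has_derivative_at_withinI[OF \<phi>]]
    show "((\<phi> \<circ> u) has_vector_derivative D (u t) \<bullet> u' t) (at t within {a..b})" .
  qed
  then show ?thesis by simp
qed

section \<open>Gradients and confinement\<close>

lemma gradient_works:
  fixes f :: "'a::euclidean_space \<Rightarrow> real"
  assumes "f differentiable (at y)"
  shows "(f has_derivative (\<lambda>h. gradient f y \<bullet> h)) (at y)"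
proof -
  obtain f' where f': "(f has_derivative f') (at y)" using assms by (auto simp: differentiable_def)
  define D where "D = (\<Sum>i\<in>Basis. f' i *\<^sub>R i)"
  interpret bounded_linear f' using f' by (rule has_derivative_bounded_linear)
  have "f' h = h \<bullet> D" for h
  proof -
    have "f' h = f' (\<Sum>i\<in>Basis. (h \<bullet> i) *\<^sub>R i)" by (simp add: euclidean_representation)
    also have "\<dots> = h \<bullet> D" by (simp add: sum scaleR D_def inner_sum_right mult.commute)
    finally show ?thesis .
  qed
  then have "f' = (\<lambda>h. h \<bullet> D)" by auto
  then have G: "GDERIV f y :> D" using f' by (simp add: gderiv_def)
  have "gradient f y = D" unfolding gradient_def
  proof (rule the_equality)
    show "GDERIV f y :> D" by (rule G)
    fix D' assume "GDERIV f y :> D'"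
    then have "(\<lambda>h. h \<bullet> D') = (\<lambda>h. h \<bullet> D)"
      using G unfolding gderiv_def by (rule has_derivative_unique)
    then have "(D' - D) \<bullet> D' = (D' - D) \<bullet> D" by metis
    then have "(D' - D) \<bullet> (D' - D) = 0" by (simp add: inner_diff_right)
    then show "D' = D" by simp
  qed
  then show ?thesis using G by (simp add: gderiv_def inner_commute)
qed

lemma gradient_eqI:
  fixes f :: "'a::euclidean_space \<Rightarrow> real"
  assumes "(f has_derivative (\<lambda>h. D \<bullet> h)) (at y)"
  shows "gradient f y = D"
proof -
  have "(\<lambda>h. gradient f y \<bullet> h) = (\<lambda>h. D \<bullet> h)"
    using gradient_works[of f y] assms by (metis differentiable_def has_derivative_unique)
  then have "gradient f y \<bullet> (gradient f y - D) = D \<bullet> (gradient f y - D)" by metis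
  then have "(gradient f y - D) \<bullet> (gradient f y - D) = 0" by (simp add: inner_diff_left)
  then show ?thesis by simp
qed

lemma gradient_has_derivative_hessian:
  assumes "class_C2 V"
  shows "(gradient V has_derivative (\<lambda>h. hessian V y *v h)) (at y)"
  using assms unfolding class_C2_def hessian_def by (simp flip: jacobian_works)

lemma gradient_Lipschitz_cball:
  fixes V :: "real ^ 'n \<Rightarrow> real"
  assumes V: "class_C2 V"
  shows "\<exists>L\<ge>0. \<forall>y\<in>cball 0 R. \<forall>z\<in>cball 0 R. norm (gradient V y - gradient V z) \<le> L * norm (y - z)"
proof -
  have "continuous_on (cball 0 R) (hessian V)"
    using V unfolding class_C2_def by (blast intro: continuous_on_subset)
  then obtain B where B: "\<And>y. y \<in> cball 0 R \<Longrightarrow> norm (hessian V y) \<le> B"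
    using compact_continuous_bound[OF compact_cball] by blast
  define L where "L = max 0 (real CARD('n) * real CARD('n) * B)"
  have "norm (gradient V y - gradient V z) \<le> L * norm (y - z)"
    if "y \<in> cball 0 R" "z \<in> cball 0 R" for y z
  proof (rule differentiable_bound[OF convex_cball, of 0 R "gradient V" "\<lambda>y h. hessian V y *v h"])
    fix w :: "real ^ 'n" assume w: "w \<in> cball 0 R"
    show "(gradient V has_derivative (\<lambda>h. hessian V w *v h)) (at w within cball 0 R)"
      using gradient_has_derivative_hessian[OF V] has_derivative_at_withinI by blast
    have "onorm ((*v) (hessian V w)) \<le> real CARD('n) * real CARD('n) * B"
    proof (rule onorm_le_matrix_component)
      fix i j
      have "\<bar>hessian V w $ i $ j\<bar> \<le> norm (hessian V w)"
        using component_le_norm_cart[of "hessian V w $ i" j] Finite_Cartesian_Product.norm_nth_le[of "hessian V w" i] by linarith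
      then show "\<bar>hessian V w $ i $ j\<bar> \<le> B" using B[OF w] by linarith
    qed
    then show "onorm (\<lambda>h. hessian V w *v h) \<le> L" by (simp add: L_def)
  qed (use that in auto)
  moreover have "L \<ge> 0" by (simp add: L_def)
  ultimately show ?thesis by blast
qed

text \<open>
  Confinement: from the point where the segment from \<open>a\<close> to \<open>a + w\<close> leaves a large ball for the last time,
  \<open>V\<close> is convex along it, so the slope in direction \<open>w\<close> at the end is at least the slope at the exit
  point, where the gradient is bounded.
\<close>

lemma convex_at_infinity_gradient_bound:
  fixes V :: "real ^ 'n \<Rightarrow> real"
  assumes V: "class_C2 V" and K: "compact K" "\<And>y. y \<notin> K \<Longrightarrow> pos_semidef (hessian V y)"
  shows "\<exists>M\<ge>0. \<forall>a\<in>cball 0 R. \<forall>w. - M * norm w \<le> w \<bullet> gradient V (a + w)"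
proof -
  obtain R1 where R1: "\<And>y. y \<in> K \<Longrightarrow> norm y \<le> R1"
    using compact_imp_bounded[OF K(1)] by (auto simp: bounded_iff)
  define R' where "R' = max R R1"
  have cg: "continuous_on UNIV (gradient V)"
    using V unfolding class_C2_def
    by (meson continuous_at_imp_continuous_on differentiable_imp_continuous_within)
  obtain B where B: "\<And>y. y \<in> cball 0 R' \<Longrightarrow> norm (gradient V y) \<le> B"
    using compact_continuous_bound[OF compact_cball continuous_on_subset[OF cg subset_UNIV], of 0 R'] by blast
  define M where "M = max 0 B"
  have inside: "- M * norm w \<le> w \<bullet> gradient V y" if "y \<in> cball 0 R'" for y w
  proof -
    have "\<bar>w \<bullet> gradient V y\<bar> \<le> norm w * norm (gradient V y)" by (rule Cauchy_Schwarz_ineq2)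
    also have "\<dots> \<le> norm w * M" using B[OF that] by (intro mult_left_mono) (auto simp: M_def)
    finally show ?thesis by (simp add: mult.commute abs_le_iff)
  qed
  have "- M * norm w \<le> w \<bullet> gradient V (a + w)" if a: "a \<in> cball 0 R" for a w
  proof (cases "a + w \<in> cball 0 R'")
    case True
    then show ?thesis by (rule inside)
  next
    case False
    \<comment> \<open>The largest element of \<open>S\<close> is the parameter of the exit point.\<close>
    define S where "S = {s\<in>{0..1::real}. norm (a + s *\<^sub>R w) \<le> R'}"
    have "compact S"
    proof -
      have "closed {s::real. norm (a + s *\<^sub>R w) \<le> R'}"
        by (intro closed_Collect_le continuous_intros)
      moreover have "S = {0..1} \<inter> {s. norm (a + s *\<^sub>R w) \<le> R'}" by (auto simp: S_def)
      ultimately have "closed S" by (simp add: closed_Int)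
      moreover have "bounded S" by (rule bounded_subset[of "{0..1}"]) (auto simp: S_def)
      ultimately show ?thesis by (simp add: compact_eq_bounded_closed)
    qed
    moreover have "0 \<in> S" using a by (auto simp: S_def R'_def)
    ultimately obtain s0 where s0: "s0 \<in> S" "\<And>s. s \<in> S \<Longrightarrow> s \<le> s0"
      using compact_attains_sup[of S] by blast
    have s01: "0 \<le> s0" "s0 \<le> 1" "norm (a + s0 *\<^sub>R w) \<le> R'" using s0(1) by (auto simp: S_def)
    define \<phi> where "\<phi> = (\<lambda>s. w \<bullet> gradient V (a + s *\<^sub>R w))"
    have der: "DERIV \<phi> s :> w \<bullet> (hessian V (a + s *\<^sub>R w) *v w)" for s
    proof -
      have "((\<lambda>s. a + s *\<^sub>R w) has_derivative (\<lambda>h. h *\<^sub>R w)) (at s)"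
        by (auto intro!: derivative_eq_intros)
      from has_derivative_compose[OF this gradient_has_derivative_hessian[OF V]]
      have "((\<lambda>s. gradient V (a + s *\<^sub>R w)) has_derivative (\<lambda>h. hessian V (a + s *\<^sub>R w) *v (h *\<^sub>R w))) (at s)" .
      from has_derivative_inner_right[OF this, of w]
      show ?thesis unfolding \<phi>_def has_field_derivative_def
        by (simp add: matrix_vector_mult_scaleR mult.commute[of _ "w \<bullet> _"])
    qed
    have "\<phi> s0 \<le> \<phi> 1"
    proof (rule DERIV_nonneg_imp_increasing_open[OF s01(2)])
      fix s assume s: "s0 < s" "s < 1"
      then have "s \<notin> S" using s0(2)[of s] by auto
      then have "norm (a + s *\<^sub>R w) > R'" using s s01 by (auto simp: S_def)
      then have "a + s *\<^sub>R w \<notin> K" using R1 by (force simp: R'_def)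
      then have "0 \<le> w \<bullet> (hessian V (a + s *\<^sub>R w) *v w)" using K(2) by (auto simp: pos_semidef_def)
      then show "\<exists>y. DERIV \<phi> s :> y \<and> y \<ge> 0" using der by blast
    next
      show "continuous_on {s0..1} \<phi>"
        using der by (meson DERIV_isCont continuous_at_imp_continuous_on)
    qed
    moreover have "- M * norm w \<le> \<phi> s0" unfolding \<phi>_def using s01 by (intro inside) simp
    ultimately show ?thesis by (simp add: \<phi>_def)
  qed
  moreover have "M \<ge> 0" by (simp add: M_def)
  ultimately show ?thesis by blast
qed

section \<open>Radial polynomial interactions\<close>

lemma even_poly_square:
  fixes p :: "real poly"
  assumes "\<And>r. poly p (- r) = poly p r"
  obtains q where "\<And>r. poly p r = poly q (r ^ 2)"
proof -
  define n where "n = degree p"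
  define q where "q = (\<Sum>i\<le>n. monom (coeff p (2 * i)) i)"
  have "poly p r = poly q (r ^ 2)" for r
  proof -
    have "poly p r = (poly p r + poly p (- r)) / 2" using assms by simp
    also have "\<dots> = (\<Sum>i\<le>n. coeff p i * (r ^ i + (- r) ^ i) / 2)"
      by (simp add: poly_altdef n_def sum.distrib[symmetric] sum_divide_distrib algebra_simps add_divide_distrib)
    also have "\<dots> = (\<Sum>i\<in>{i\<in>{..n}. even i}. coeff p i * r ^ i)"
      by (rule sum.mono_neutral_cong_right) auto
    also have "{i\<in>{..n}. even i} = (\<lambda>i. 2 * i) ` {i. 2 * i \<le> n}"
      by (auto elim!: evenE)
    also have "(\<Sum>i\<in>(\<lambda>i. 2 * i) ` {i. 2 * i \<le> n}. coeff p i * r ^ i)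
        = (\<Sum>i\<in>{i. 2 * i \<le> n}. coeff p (2 * i) * r ^ (2 * i))"
      by (subst sum.reindex) (auto simp: inj_on_def)
    also have "\<dots> = (\<Sum>i\<le>n. coeff p (2 * i) * r ^ (2 * i))"
      by (rule sum.mono_neutral_left) (auto simp: coeff_eq_0 n_def)
    also have "\<dots> = poly q (r ^ 2)"
      by (simp add: q_def poly_sum poly_monom power_mult)
    finally show ?thesis .
  qed
  then show thesis by (rule that)
qed

text \<open>
  The scalar core of the pairwise inequality for \<open>y \<mapsto> |y|\<^sup>2\<^sup>k y\<close>: here \<open>a\<close> and \<open>b\<close> stand for the squared
  lengths of two vectors, \<open>p\<close> for their inner product and \<open>W\<close> for the squared length of their difference. If
  \<open>p \<le> 0\<close> then \<open>W \<ge> a\<close>; otherwise either \<open>W\<close> is comparable to \<open>a\<close>, or the vectors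
  nearly coincide and \<open>b\<close> and \<open>p\<close> are comparable to \<open>a\<close>.
\<close>

lemma pair_power_scalar:
  fixes a b p W :: real
  assumes ab: "b \<le> a" "0 \<le> b" and p: "p\<^sup>2 \<le> a * b" and W: "W = a + b - 2 * p"
  shows "a ^ Suc k / (64 * 8 ^ k) \<le> W ^ Suc k / 4 + b ^ k * p / 8"
proof -
  have a: "a \<ge> 0" using ab by simp
  have "p\<^sup>2 \<le> a\<^sup>2" using p mult_left_mono[OF ab(1) a] by (simp add: power2_eq_square)
  then have pa: "\<bar>p\<bar> \<le> a" using a by (metis abs_le_square_iff abs_of_nonneg)
  have k8: "(1::real) \<le> 8 ^ k" by simp
  have W0: "W \<ge> 0"
  proof -
    have "(2 * p)\<^sup>2 \<le> (a + b)\<^sup>2" using p zero_le_power2[of "a - b"] by (simp add: power2_eq_square algebra_simps)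
    then have "2 * p \<le> a + b" using a ab(2) by (meson add_nonneg_nonneg power2_le_imp_le)
    then show ?thesis using W by simp
  qed
  consider "p \<le> 0" | "p > 0" "W \<ge> a / 4" | "p > 0" "W < a / 4" by linarith
  then show ?thesis
  proof cases
    case 1
    have "a ^ Suc k \<le> W ^ Suc k" using W 1 a ab by (intro power_mono) auto
    moreover have "- (b ^ k * p) \<le> a ^ Suc k"
    proof -
      have "b ^ k * (- p) \<le> a ^ k * a" using ab a pa 1 by (intro mult_mono power_mono) auto
      then show ?thesis by (simp add: mult.commute)
    qed
    moreover have "a ^ Suc k / (64 * 8 ^ k) \<le> a ^ Suc k / 8"
    proof -
      have "(8::real) \<le> 64 * 8 ^ k" using k8 by linarith
      then show ?thesis using a by (intro divide_left_mono) auto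
    qed
    ultimately show ?thesis by simp
  next
    case 2
    have "(a / 4) ^ Suc k \<le> W ^ Suc k" using 2 a by (intro power_mono) auto
    moreover have "a ^ Suc k / (64 * 8 ^ k) \<le> (a / 4) ^ Suc k / 4"
    proof -
      have "(4::real) ^ k \<le> 8 ^ k" by (intro power_mono) auto
      then have "16 * (4::real) ^ k \<le> 64 * 8 ^ k" using k8 by linarith
      then have "a ^ Suc k / (64 * 8 ^ k) \<le> a ^ Suc k / (16 * 4 ^ k)"
        using a by (intro divide_left_mono) auto
      also have "\<dots> = (a / 4) ^ Suc k / 4" by (simp add: power_divide)
      finally show ?thesis .
    qed
    moreover have "0 \<le> b ^ k * p" using 2 ab by simp
    ultimately show ?thesis by simp
  next
    case 3
    then have p3: "p \<ge> 3 * a / 8" using W ab by simp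
    have "(3 * a / 8)\<^sup>2 \<le> p\<^sup>2" using p3 a by (intro power_mono) auto
    then have "(3 * a / 8)\<^sup>2 \<le> a * b" using p by linarith
    then have "a * (9 * a / 64) \<le> a * b" by (simp add: power2_eq_square)
    moreover have "a > 0" using 3 pa by simp
    ultimately have "9 * a / 64 \<le> b" using mult_le_cancel_left_pos by blast
    then have b8: "a / 8 \<le> b" using a by simp
    have "(a / 8) ^ k * (3 * a / 8) \<le> b ^ k * p"
      using b8 p3 a 3 ab by (intro mult_mono power_mono) auto
    moreover have "(a / 8) ^ k * (3 * a / 8) = 24 * (a ^ Suc k / (64 * 8 ^ k))"
      by (simp add: power_divide field_simps)
    moreover have "0 \<le> W ^ Suc k" "0 \<le> a ^ Suc k / (64 * 8 ^ k)" using W0 a by auto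
    ultimately show ?thesis by linarith
  qed
qed

text \<open>
  The coercivity of \<open>pair_coercive\<close> for a pure power. Monotonicity of \<open>P\<close> is quantitative,
  because \<open>(P u - P v) \<bullet> (u - v)\<close> equals
  \<open>(|u|\<^sup>2\<^sup>k + |v|\<^sup>2\<^sup>k) |u - v|\<^sup>2 / 2\<close> plus a nonnegative term.
\<close>

lemma pair_power:
  fixes u v :: "'a::real_inner" and k :: nat
  defines "P \<equiv> \<lambda>y::'a. (norm y ^ (2 * k)) *\<^sub>R y"
  shows "(max (norm u) (norm v)) ^ (4 * k + 2) / (64 * 8 ^ k)
     \<le> (P u - P v) \<bullet> P (u - v) / 2 + P u \<bullet> P v / 8"
proof -
  have main: "(norm u) ^ (4 * k + 2) / (64 * 8 ^ k)
     \<le> (P u - P v) \<bullet> P (u - v) / 2 + P u \<bullet> P v / 8" if uv: "norm v \<le> norm u" for u v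
  proof -
    define a where "a = (norm u)\<^sup>2"
    define b where "b = (norm v)\<^sup>2"
    define p where "p = u \<bullet> v"
    define W where "W = (norm (u - v))\<^sup>2"
    have ab: "b \<le> a" "0 \<le> b" "0 \<le> a" using uv by (auto simp: a_def b_def intro: power_mono)
    have W: "W = a + b - 2 * p"
      by (simp add: W_def a_def b_def p_def power2_norm_eq_inner inner_diff_left inner_diff_right inner_commute)
    have W0: "W \<ge> 0" by (simp add: W_def)
    have pp: "p\<^sup>2 \<le> a * b" unfolding p_def a_def b_def power2_norm_eq_inner by (rule Cauchy_Schwarz_ineq)
    have Pu: "P u = a ^ k *\<^sub>R u" "P v = b ^ k *\<^sub>R v" "P (u - v) = W ^ k *\<^sub>R (u - v)"
      by (simp_all add: P_def a_def b_def W_def power_mult)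
    have i: "u \<bullet> u = a" "v \<bullet> v = b" "u \<bullet> v = p" "v \<bullet> u = p"
      by (simp_all add: a_def b_def p_def power2_norm_eq_inner inner_commute)
    have "(P u - P v) \<bullet> P (u - v) = W ^ k * (a ^ k * a - a ^ k * p - b ^ k * p + b ^ k * b)"
      unfolding Pu by (simp add: inner_diff_left inner_diff_right i algebra_simps)
    also have "a ^ k * a - a ^ k * p - b ^ k * p + b ^ k * b
       = (a ^ k + b ^ k) * W / 2 + (a ^ k - b ^ k) * (a - b) / 2"
      unfolding W by (simp add: field_simps)
    finally have e1: "(P u - P v) \<bullet> P (u - v) = W ^ k * ((a ^ k + b ^ k) * W / 2 + (a ^ k - b ^ k) * (a - b) / 2)" .
    have "a ^ k * W / 2 \<le> (a ^ k + b ^ k) * W / 2 + (a ^ k - b ^ k) * (a - b) / 2"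
    proof -
      have "0 \<le> b ^ k * W" "0 \<le> (a ^ k - b ^ k) * (a - b)"
        using ab W0 power_mono[OF ab(1,2), of k] by auto
      then show ?thesis using distrib_right[of "a ^ k" "b ^ k" W] by linarith
    qed
    then have "W ^ k * (a ^ k * W / 2) \<le> (P u - P v) \<bullet> P (u - v)"
      unfolding e1 using W0 by (intro mult_left_mono) auto
    moreover have "P u \<bullet> P v = a ^ k * (b ^ k * p)" unfolding Pu by (simp add: i)
    moreover have "a ^ k * (a ^ Suc k / (64 * 8 ^ k)) \<le> a ^ k * (W ^ Suc k / 4 + b ^ k * p / 8)"
      using pair_power_scalar[OF ab(1,2) pp W] ab by (intro mult_left_mono) auto
    moreover have "(norm u) ^ (4 * k + 2) / (64 * 8 ^ k) = a ^ k * (a ^ Suc k / (64 * 8 ^ k))"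
    proof -
      have "(norm u) ^ (4 * k + 2) = a ^ k * a ^ Suc k"
        by (simp add: a_def power_mult[symmetric] power_add[symmetric])
      then show ?thesis by simp
    qed
    moreover have "a ^ k * (W ^ Suc k / 4 + b ^ k * p / 8) = W ^ k * (a ^ k * W / 2) / 2 + a ^ k * (b ^ k * p) / 8"
      by (simp add: algebra_simps)
    ultimately show ?thesis by linarith
  qed
  show ?thesis
  proof (cases "norm v \<le> norm u")
    case True
    then show ?thesis using main[OF True] by (simp add: max_def)
  next
    case False
    have neg: "P (v - u) = - P (u - v)"
      by (simp add: P_def norm_minus_commute scaleR_right_diff_distrib)
    have "(P v - P u) \<bullet> P (v - u) = (P u - P v) \<bullet> P (u - v)"
      unfolding neg by (simp add: inner_diff_left)
    then show ?thesis using main[of u v] False by (simp add: max_def inner_commute)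
  qed
qed

text \<open>
  Completing the square; this is how terms of first order are absorbed below.
\<close>

lemma linear_le_quadratic:
  fixes P Q A :: real
  assumes "P > 0"
  shows "Q * A \<le> P * A\<^sup>2 + Q\<^sup>2 / (4 * P)"
proof -
  have "0 \<le> P * (A - Q / (2 * P))\<^sup>2" using assms by simp
  also have "\<dots> = P * A\<^sup>2 - Q * A + Q\<^sup>2 / (4 * P)"
    using assms by (simp add: power2_eq_square field_simps)
  finally show ?thesis by simp
qed

text \<open>
  The terms of lower degree are a small multiple of the leading one, up to a constant. The
  additional factor \<open>r\<close> makes this a statement about the field \<open>y \<mapsto> g (|y|\<^sup>2) y\<close>.
\<close>

lemma poly_minus_lead_term_small:
  fixes g :: "real poly"
  assumes "\<delta> > 0"
  shows "\<exists>C\<ge>0. \<forall>r\<ge>0. \<bar>poly g (r\<^sup>2) - lead_coeff g * r ^ (2 * degree g)\<bar> * r \<le> \<delta> * r ^ (2 * degree g + 1) + C"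
proof -
  define k where "k = degree g"
  define h where "h = g - monom (lead_coeff g) k"
  define B where "B = (\<Sum>i<k. \<bar>coeff h i\<bar>)"
  have ch: "coeff h i = 0" if "i \<ge> k" for i
    using that by (cases "i = k") (auto simp: h_def k_def coeff_eq_0)
  have ph: "poly h s = (\<Sum>i<k. coeff h i * s ^ i)" for s
  proof -
    have "poly h s = (\<Sum>i\<le>degree h. coeff h i * s ^ i)" by (rule poly_altdef)
    also have "\<dots> = (\<Sum>i<k. coeff h i * s ^ i)"
      using ch by (intro sum.mono_neutral_cong) (auto simp: coeff_eq_0 not_less not_le)
    finally show ?thesis .
  qed
  have hg: "poly h s = poly g s - lead_coeff g * s ^ k" for s by (simp add: h_def poly_monom)
  define S where "S = max 1 (B / \<delta>)"
  have "continuous_on {0..S} (\<lambda>r. \<bar>poly h (r\<^sup>2)\<bar> * r)" by (intro continuous_intros)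
  then obtain C where C: "\<And>r. r \<in> {0..S} \<Longrightarrow> norm (\<bar>poly h (r\<^sup>2)\<bar> * r) \<le> C"
    using compact_continuous_bound[OF compact_Icc] by blast
  have "\<bar>poly h (r\<^sup>2)\<bar> * r \<le> \<delta> * r ^ (2 * k + 1) + max 0 C" if r: "r \<ge> 0" for r
  proof (cases "r \<le> S")
    case True
    then have "\<bar>poly h (r\<^sup>2)\<bar> * r \<le> C" using C[of r] r by simp
    moreover have "0 \<le> \<delta> * r ^ (2 * k + 1)" using r assms by simp
    ultimately show ?thesis by simp
  next
    case False
    then have r1: "r \<ge> 1" "B / \<delta> \<le> r" by (auto simp: S_def)
    have "r * 1 \<le> r * r" using r1 by (intro mult_left_mono) auto
    then have s1: "1 \<le> r\<^sup>2" "B / \<delta> \<le> r\<^sup>2" using r1 unfolding power2_eq_square by linarith+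
    have "\<bar>poly h (r\<^sup>2)\<bar> \<le> \<delta> * (r\<^sup>2) ^ k"
    proof (cases k)
      case 0
      then show ?thesis using assms by (simp add: ph)
    next
      case (Suc k')
      have "\<bar>poly h (r\<^sup>2)\<bar> \<le> (\<Sum>i<k. \<bar>coeff h i\<bar> * (r\<^sup>2) ^ k')"
        unfolding ph
      proof (rule order_trans[OF sum_abs], rule sum_mono)
        fix i assume "i \<in> {..<k}"
        then have "(r\<^sup>2) ^ i \<le> (r\<^sup>2) ^ k'" using Suc s1 by (intro power_increasing) auto
        then show "\<bar>coeff h i * (r\<^sup>2) ^ i\<bar> \<le> \<bar>coeff h i\<bar> * (r\<^sup>2) ^ k'"
          by (simp add: abs_mult mult_left_mono)
      qed
      also have "\<dots> = B * (r\<^sup>2) ^ k'" by (simp add: B_def sum_distrib_right)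
      also have "\<dots> \<le> (\<delta> * r\<^sup>2) * (r\<^sup>2) ^ k'"
        using s1(2) assms by (intro mult_right_mono) (auto simp: field_simps)
      finally show ?thesis by (simp add: Suc)
    qed
    then have "\<bar>poly h (r\<^sup>2)\<bar> * r \<le> \<delta> * (r\<^sup>2) ^ k * r" using r by (intro mult_right_mono)
    also have "\<dots> = \<delta> * r ^ (2 * k + 1)" by (simp add: power_mult)
    finally show ?thesis by simp
  qed
  then show ?thesis by (intro exI[of _ "max 0 C"]) (simp add: hg k_def power_mult)
qed

text \<open>
  The key inequality for the interaction. The first term on the right is what the interaction
  between two particles at \<open>u\<close> and \<open>v\<close> contributes to the defect. It vanishes for \<open>u = v\<close>, however
  far away they are, and then the second term, which comes from the squared net force, is large; when the
  second is negative the first outweighs it. The interaction may fail to be convex: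
  its leading term decides by \<open>pair_power\<close>, and lower order terms cost a constant.
\<close>

lemma pair_coercive:
  fixes g :: "real poly" and D :: "'a::real_inner \<Rightarrow> 'a"
  assumes g: "lead_coeff g > 0" and D: "\<And>y. D y = poly g (y \<bullet> y) *\<^sub>R y"
  shows "\<exists>c>0. \<exists>C. \<forall>u v. c * ((norm (D u))\<^sup>2 + (norm (D v))\<^sup>2) - C
      \<le> (D u - D v) \<bullet> D (u - v) / 2 + D u \<bullet> D v / 8"
proof -
  define k where "k = degree g"
  define b where "b = lead_coeff g"
  define P where "P = (\<lambda>y::'a. (norm y ^ (2 * k)) *\<^sub>R y)"
  define h :: real where "h = 2 ^ (2 * k + 1)"
  define c0 :: real where "c0 = 1 / (64 * 8 ^ k)"
  \<comment> \<open>The factor \<open>h\<close> accounts for \<open>|u - v| \<le> 2 M\<close>; \<open>\<delta>\<close> makes the lower order terms at most a quarter of the leading one.\<close>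
  define \<delta> where "\<delta> = min 1 (b\<^sup>2 * c0 / (16 * h\<^sup>2 * (b + 1)))"
  have b: "b > 0" using g by (simp add: b_def)
  have h: "h \<ge> 1" unfolding h_def by (rule one_le_power) simp
  have c0: "c0 > 0" by (simp add: c0_def)
  have \<delta>: "\<delta> > 0" "\<delta> \<le> 1" using b h c0 by (auto simp: \<delta>_def)
  have \<delta>2: "4 * h\<^sup>2 * (b + 1) * \<delta> \<le> b\<^sup>2 * c0 / 4"
  proof -
    have "4 * h\<^sup>2 * (b + 1) * \<delta> \<le> 4 * h\<^sup>2 * (b + 1) * (b\<^sup>2 * c0 / (16 * h\<^sup>2 * (b + 1)))"
      using b h by (intro mult_left_mono) (auto simp: \<delta>_def)
    also have "\<dots> = b\<^sup>2 * c0 / 4"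
    proof -
      have "4 * X * (X' / (16 * X)) = X' / 4" if "X \<noteq> 0" for X X' :: real using that by simp
      from this[of "h\<^sup>2 * (b + 1)" "b\<^sup>2 * c0"] show ?thesis using b h by (simp add: mult.assoc)
    qed
    finally show ?thesis .
  qed
  obtain C where C: "C \<ge> 0" "\<And>r. r \<ge> 0 \<Longrightarrow> \<bar>poly g (r\<^sup>2) - b * r ^ (2 * k)\<bar> * r \<le> \<delta> * r ^ (2 * k + 1) + C"
    using poly_minus_lead_term_small[OF \<delta>(1), of g] unfolding b_def k_def by blast
  have err: "norm (D y - b *\<^sub>R P y) \<le> \<delta> * norm y ^ (2 * k + 1) + C" for y
  proof -
    have "D y - b *\<^sub>R P y = (poly g ((norm y)\<^sup>2) - b * norm y ^ (2 * k)) *\<^sub>R y"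
      by (simp add: D P_def power2_norm_eq_inner scaleR_diff_left)
    then show ?thesis using C(2)[of "norm y"] by simp
  qed
  have nP: "norm (P y) = norm y ^ (2 * k + 1)" for y by (simp add: P_def)
  define Pc where "Pc = b\<^sup>2 * c0 / 4"
  have Pc: "Pc > 0" using b c0 by (simp add: Pc_def)
  define Q where "Q = 4 * b * h * C"
  define K where "K = Q\<^sup>2 / (4 * Pc) + 4 * C\<^sup>2"
  define c where "c = Pc / (2 * (b + h)\<^sup>2)"
  have bh: "b + h > 0" using b h by simp
  have c: "c > 0" using Pc bh by (simp add: c_def)
  have "c * ((norm (D u))\<^sup>2 + (norm (D v))\<^sup>2) - (4 * c * C\<^sup>2 + K)
      \<le> (D u - D v) \<bullet> D (u - v) / 2 + D u \<bullet> D v / 8" for u v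
  proof -
    define M where "M = max (norm u) (norm v)"
    define A where "A = M ^ (2 * k + 1)"
    define \<eta> where "\<eta> = \<delta> * h * A + C"
    have M: "M \<ge> 0" "norm u \<le> M" "norm v \<le> M" by (simp_all add: M_def le_max_iff_disj)
    have A: "A \<ge> 0" using M by (simp add: A_def)
    have \<eta>: "\<eta> \<ge> 0" using A C \<delta> h by (simp add: \<eta>_def)
    have yA: "norm y ^ (2 * k + 1) \<le> A" if "norm y \<le> M" for y :: 'a
      unfolding A_def using that by (intro power_mono) auto
    have wA: "norm (u - v) ^ (2 * k + 1) \<le> h * A"
    proof -
      have "norm (u - v) \<le> 2 * M" using norm_triangle_ineq4[of u v] M by simp
      then have "norm (u - v) ^ (2 * k + 1) \<le> (2 * M) ^ (2 * k + 1)" by (intro power_mono) auto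
      then show ?thesis unfolding A_def h_def by (simp only: power_mult_distrib)
    qed
    have hA: "A \<le> h * A" using h A by (simp add: mult_le_cancel_right1)
    have err': "norm (D y - b *\<^sub>R P y) \<le> \<eta>" if "norm y ^ (2 * k + 1) \<le> h * A" for y
    proof -
      have "\<delta> * norm y ^ (2 * k + 1) \<le> \<delta> * (h * A)" using that \<delta> by (intro mult_left_mono) auto
      then show ?thesis using err[of y] by (simp add: \<eta>_def)
    qed
    define eu where "eu = D u - b *\<^sub>R P u"
    define ev where "ev = D v - b *\<^sub>R P v"
    define ew where "ew = D (u - v) - b *\<^sub>R P (u - v)"
    have e: "norm eu \<le> \<eta>" "norm ev \<le> \<eta>" "norm ew \<le> \<eta>"
      unfolding eu_def ev_def ew_def using err' yA[OF M(2)] yA[OF M(3)] wA hA by auto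
    have nPs: "norm (P u) \<le> A" "norm (P v) \<le> A" "norm (P (u - v)) \<le> h * A"
      using yA[OF M(2)] yA[OF M(3)] wA by (auto simp: nP)
    have Deq: "D u = b *\<^sub>R P u + eu" "D v = b *\<^sub>R P v + ev" "D (u - v) = b *\<^sub>R P (u - v) + ew"
      by (auto simp: eu_def ev_def ew_def)
    have ip: "- (s * t) \<le> y \<bullet> z" if "norm y \<le> s" "norm z \<le> t" for y z :: 'a and s t
    proof -
      have "0 \<le> s" using that(1) norm_ge_zero order_trans by blast
      then have "norm y * norm z \<le> s * t" using that by (intro mult_mono) auto
      then show ?thesis using Cauchy_Schwarz_ineq2[of y z] by (simp add: abs_le_iff)
    qed
    have nX: "norm (P u - P v) \<le> 2 * A" using norm_triangle_ineq4[of "P u" "P v"] nPs by simp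
    have nx: "norm (eu - ev) \<le> 2 * \<eta>" using norm_triangle_ineq4[of eu ev] e by simp
    have "(D u - D v) \<bullet> D (u - v) = b\<^sup>2 * ((P u - P v) \<bullet> P (u - v)) + b * ((P u - P v) \<bullet> ew)
        + b * ((eu - ev) \<bullet> P (u - v)) + (eu - ev) \<bullet> ew"
      unfolding Deq by (simp add: inner_diff_left inner_diff_right inner_add_left inner_add_right power2_eq_square algebra_simps)
    moreover have "b * - (2 * A * \<eta>) \<le> b * ((P u - P v) \<bullet> ew)"
      using ip[OF nX e(3)] b by (intro mult_left_mono) auto
    moreover have "b * - (2 * \<eta> * (h * A)) \<le> b * ((eu - ev) \<bullet> P (u - v))"
      using ip[OF nx nPs(3)] b by (intro mult_left_mono) auto
    moreover have "- (2 * \<eta> * \<eta>) \<le> (eu - ev) \<bullet> ew" by (rule ip[OF nx e(3)])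
    ultimately have 1: "b\<^sup>2 * ((P u - P v) \<bullet> P (u - v)) - 2 * (b * A * \<eta>) - 2 * (b * h * A * \<eta>) - 2 * \<eta>\<^sup>2
        \<le> (D u - D v) \<bullet> D (u - v)" by (simp add: power2_eq_square algebra_simps)
    have "D u \<bullet> D v = b\<^sup>2 * (P u \<bullet> P v) + b * (P u \<bullet> ev) + b * (eu \<bullet> P v) + eu \<bullet> ev"
      unfolding Deq by (simp add: inner_add_left inner_add_right power2_eq_square algebra_simps)
    moreover have "b * - (A * \<eta>) \<le> b * (P u \<bullet> ev)"
      using ip[OF nPs(1) e(2)] b by (intro mult_left_mono) auto
    moreover have "b * - (\<eta> * A) \<le> b * (eu \<bullet> P v)"
      using ip[OF e(1) nPs(2)] b by (intro mult_left_mono) auto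
    moreover have "- (\<eta> * \<eta>) \<le> eu \<bullet> ev" by (rule ip[OF e(1) e(2)])
    ultimately have 2: "b\<^sup>2 * (P u \<bullet> P v) - 2 * (b * A * \<eta>) - \<eta>\<^sup>2 \<le> D u \<bullet> D v"
      by (simp add: power2_eq_square algebra_simps)
    have "M ^ (4 * k + 2) = A\<^sup>2"
      unfolding A_def power_mult[symmetric] by (rule arg_cong[of _ _ "\<lambda>n. M ^ n"]) simp
    then have "c0 * A\<^sup>2 \<le> (P u - P v) \<bullet> P (u - v) / 2 + P u \<bullet> P v / 8"
      using pair_power[of u v k] by (simp add: P_def c0_def M_def)
    then have "b\<^sup>2 * (c0 * A\<^sup>2) \<le> b\<^sup>2 * ((P u - P v) \<bullet> P (u - v) / 2 + P u \<bullet> P v / 8)"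
      by (intro mult_left_mono) auto
    then have 3: "4 * (Pc * A\<^sup>2) \<le> b\<^sup>2 * ((P u - P v) \<bullet> P (u - v)) / 2 + b\<^sup>2 * (P u \<bullet> P v) / 8"
      by (simp add: Pc_def algebra_simps)
    have bA: "0 \<le> b * A * \<eta>" "b * A * \<eta> \<le> b * h * A * \<eta>"
    proof -
      show "0 \<le> b * A * \<eta>" using b A \<eta> by simp
      have "b * (A * \<eta>) \<le> b * (h * A * \<eta>)"
        by (intro mult_left_mono mult_right_mono hA \<eta>) (use b in simp)
      then show "b * A * \<eta> \<le> b * h * A * \<eta>" by (simp add: mult.assoc)
    qed
    have \<eta>2: "\<eta>\<^sup>2 \<le> 2 * (\<delta> * h * A)\<^sup>2 + 2 * C\<^sup>2"
      using zero_le_power2[of "\<delta> * h * A - C"] by (simp add: \<eta>_def power2_eq_square algebra_simps)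
    have "\<delta>\<^sup>2 \<le> \<delta>" using \<delta> by (simp add: power2_eq_square mult_le_cancel_left1)
    then have "\<delta>\<^sup>2 * (h\<^sup>2 * A\<^sup>2) \<le> \<delta> * (h\<^sup>2 * A\<^sup>2)" by (intro mult_right_mono) auto
    then have \<eta>3: "2 * \<eta>\<^sup>2 \<le> 4 * (\<delta> * (h\<^sup>2 * A\<^sup>2)) + 4 * C\<^sup>2"
      using \<eta>2 by (simp add: power_mult_distrib)
    have \<eta>4: "4 * (b * h * A * \<eta>) = 4 * (b * \<delta> * h\<^sup>2 * A\<^sup>2) + Q * A"
      by (simp add: \<eta>_def Q_def power2_eq_square algebra_simps)
    have "4 * h\<^sup>2 * (b + 1) * \<delta> * A\<^sup>2 \<le> Pc * A\<^sup>2"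
      using \<delta>2 by (intro mult_right_mono) (auto simp: Pc_def)
    then have \<eta>5: "4 * (b * \<delta> * h\<^sup>2 * A\<^sup>2) + 4 * (\<delta> * (h\<^sup>2 * A\<^sup>2)) \<le> Pc * A\<^sup>2"
      by (simp add: algebra_simps)
    have q: "Q * A \<le> Pc * A\<^sup>2 + Q\<^sup>2 / (4 * Pc)" by (rule linear_le_quadratic[OF Pc])
    have 4: "2 * (Pc * A\<^sup>2) - K \<le> (D u - D v) \<bullet> D (u - v) / 2 + D u \<bullet> D v / 8"
      using 1 2 3 bA \<eta>3 \<eta>4 \<eta>5 q zero_le_power2[of \<eta>] unfolding K_def by linarith
    have sq: "(norm (D y))\<^sup>2 \<le> 2 * ((b + h)\<^sup>2 * A\<^sup>2) + 2 * C\<^sup>2" if "norm (P y) \<le> A" "norm (D y - b *\<^sub>R P y) \<le> \<eta>" for y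
    proof -
      have "norm (D y) \<le> norm (b *\<^sub>R P y) + norm (D y - b *\<^sub>R P y)"
        using norm_triangle_ineq[of "b *\<^sub>R P y" "D y - b *\<^sub>R P y"] by simp
      also have "\<dots> \<le> b * A + \<eta>" using that b by (intro add_mono) (auto intro: mult_left_mono)
      also have "\<delta> * (h * A) \<le> 1 * (h * A)" using \<delta> h A by (intro mult_right_mono) auto
      then have "b * A + \<eta> \<le> (b + h) * A + C" by (simp add: \<eta>_def algebra_simps)
      finally have "(norm (D y))\<^sup>2 \<le> ((b + h) * A + C)\<^sup>2" by (intro power_mono) auto
      also have "\<dots> \<le> 2 * ((b + h) * A)\<^sup>2 + 2 * C\<^sup>2"
        using zero_le_power2[of "(b + h) * A - C"] by (simp add: power2_eq_square algebra_simps)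
      finally show ?thesis by (simp add: power_mult_distrib)
    qed
    have "(norm (D u))\<^sup>2 + (norm (D v))\<^sup>2 \<le> 4 * ((b + h)\<^sup>2 * A\<^sup>2) + 4 * C\<^sup>2"
      using sq[OF nPs(1)] sq[OF nPs(2)] e unfolding eu_def ev_def by linarith
    then have "c * ((norm (D u))\<^sup>2 + (norm (D v))\<^sup>2) \<le> c * (4 * ((b + h)\<^sup>2 * A\<^sup>2) + 4 * C\<^sup>2)"
      using c by (intro mult_left_mono) auto
    also have "\<dots> = 2 * (Pc * A\<^sup>2) + 4 * c * C\<^sup>2"
      using bh by (simp add: c_def field_simps)
    finally show ?thesis using 4 by linarith
  qed
  then show ?thesis using c by blast
qed

lemma even_polynomial_potential:
  fixes F :: "'a::real_inner \<Rightarrow> real" and G :: "real \<Rightarrow> real"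
  assumes G: "\<And>r. 0 \<le> r \<Longrightarrow> 0 \<le> G r" "\<And>y. F y = G (norm y)"
    and p: "\<And>r. 0 \<le> r \<Longrightarrow> G r = poly p r" "\<And>r. poly p (- r) = poly p r"
    and lim: "filterlim G at_top at_top"
  obtains q where "\<And>y. F y = poly q (y \<bullet> y)" "lead_coeff (smult 2 (pderiv q)) > 0"
proof -
  obtain q where q: "\<And>r. poly p r = poly q (r ^ 2)" using even_poly_square[OF p(2)] by blast
  have Gq: "G r = poly q (r\<^sup>2)" if "r \<ge> 0" for r using p(1)[OF that] q by simp
  have deg: "degree q \<noteq> 0"
  proof
    assume "degree q = 0"
    then obtain c where c: "q = [:c:]" by (meson degree_eq_zeroE)
    have "eventually (\<lambda>r. G r > c) at_top" using lim by (simp add: filterlim_at_top_dense)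
    then have "eventually (\<lambda>r. G r > c \<and> r \<ge> 0) at_top"
      using eventually_ge_at_top by (rule eventually_conj)
    then obtain r where "G r > c" "r \<ge> 0" using eventually_happens'[of "at_top :: real filter"] by auto
    then show False using Gq[of r] c by simp
  qed
  have lc: "lead_coeff q > 0"
  proof (rule ccontr)
    assume "\<not> lead_coeff q > 0"
    moreover have "lead_coeff q \<noteq> 0" using deg by auto
    ultimately have "lead_coeff q < 0" by linarith
    then have lm: "lead_coeff (- q) > 0" by simp
    then obtain n where n: "\<And>s. s \<ge> n \<Longrightarrow> poly (- q) s \<ge> lead_coeff (- q)"
      using poly_pinfty_gt_lc by metis
    define r where "r = max 1 n"
    have "r * 1 \<le> r * r" by (intro mult_left_mono) (auto simp: r_def)
    moreover have "n \<le> r" by (simp add: r_def)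
    ultimately have "n \<le> r\<^sup>2" unfolding power2_eq_square by linarith
    then have "poly q (r\<^sup>2) < 0" using n[of "r\<^sup>2"] lm by simp
    moreover have "r \<ge> 0" by (simp add: r_def)
    ultimately show False using G(1)[of r] Gq[of r] by simp
  qed
  have "lead_coeff (pderiv q) = real (degree q) * lead_coeff q"
    using deg by (simp add: degree_pderiv coeff_pderiv)
  then have "lead_coeff (smult 2 (pderiv q)) > 0" using lc deg by simp
  moreover have "F y = poly q (y \<bullet> y)" for y
    using G(2) Gq[of "norm y"] by (simp add: power2_norm_eq_inner)
  ultimately show thesis using that by blast
qed

lemma radial_poly_has_derivative:
  fixes q :: "real poly" and y :: "'a::real_inner"
  shows "((\<lambda>y. poly q (y \<bullet> y)) has_derivative
     (\<lambda>h. (poly (smult 2 (pderiv q)) (y \<bullet> y) *\<^sub>R y) \<bullet> h)) (at y)"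
proof -
  have "((\<lambda>y. y \<bullet> y) has_derivative (\<lambda>h. 2 * (y \<bullet> h))) (at y)"
    by (auto intro!: derivative_eq_intros simp: inner_commute)
  moreover have "(poly q has_derivative (\<lambda>h. poly (pderiv q) (y \<bullet> y) * h)) (at (y \<bullet> y))"
    using poly_DERIV[of q "y \<bullet> y"] by (simp add: has_field_derivative_def)
  ultimately have "((\<lambda>y. poly q (y \<bullet> y)) has_derivative (\<lambda>h. poly (pderiv q) (y \<bullet> y) * (2 * (y \<bullet> h)))) (at y)"
    by (rule has_derivative_compose)
  then show ?thesis by (simp add: mult.assoc mult.left_commute)
qed

lemma radial_poly_Lipschitz:
  fixes g :: "real poly" and D :: "'a::real_inner \<Rightarrow> 'a"
  assumes D: "\<And>y. D y = poly g (y \<bullet> y) *\<^sub>R y"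
  shows "\<exists>L\<ge>0. \<forall>y\<in>cball 0 R. \<forall>z\<in>cball 0 R. norm (D y - D z) \<le> L * norm (y - z)"
proof (cases "R \<ge> 0")
  case True
  have pc: "continuous_on A (poly p)" for A and p :: "real poly" by (intro continuous_intros)
  obtain B1 where B1: "B1 \<ge> 0" "\<And>s. s \<in> {0..R\<^sup>2} \<Longrightarrow> norm (poly g s) \<le> B1"
    using compact_continuous_bound[OF compact_Icc pc] by blast
  obtain B2 where B2: "B2 \<ge> 0" "\<And>s. s \<in> {0..R\<^sup>2} \<Longrightarrow> norm (poly (pderiv g) s) \<le> B2"
    using compact_continuous_bound[OF compact_Icc pc] by blast
  note B = B1(1) B2(1)
  have yy: "y \<bullet> y \<in> {0..R\<^sup>2}" if "y \<in> cball 0 R" for y :: 'a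
    using that by (auto simp: power2_norm_eq_inner[symmetric] intro: power_mono)
  have "norm (D y - D z) \<le> (B1 + B2 * (2 * R) * R) * norm (y - z)"
    if y: "y \<in> cball 0 R" and z: "z \<in> cball 0 R" for y z
  proof -
    have "norm (poly g (y \<bullet> y) - poly g (z \<bullet> z)) \<le> B2 * norm (y \<bullet> y - z \<bullet> z)"
      by (rule field_differentiable_bound[of "{0..R\<^sup>2}" _ "poly (pderiv g)"])
         (use B2(2) yy y z in \<open>auto intro: has_field_derivative_at_within poly_DERIV\<close>)
    also have "y \<bullet> y - z \<bullet> z = (y + z) \<bullet> (y - z)"
      by (simp add: inner_diff_right inner_add_left inner_commute[of z y])
    also have "norm ((y + z) \<bullet> (y - z)) \<le> norm (y + z) * norm (y - z)"
      by (simp add: Cauchy_Schwarz_ineq2)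
    also have "norm (y + z) \<le> 2 * R" using norm_triangle_ineq[of y z] y z by simp
    finally have g: "norm (poly g (y \<bullet> y) - poly g (z \<bullet> z)) \<le> B2 * (2 * R * norm (y - z))"
      using B by (simp add: mult_left_mono mult_right_mono)
    have "D y - D z = poly g (y \<bullet> y) *\<^sub>R (y - z) + (poly g (y \<bullet> y) - poly g (z \<bullet> z)) *\<^sub>R z"
      by (simp add: D scaleR_diff_left scaleR_diff_right)
    then have "norm (D y - D z) \<le> norm (poly g (y \<bullet> y)) * norm (y - z)
        + norm (poly g (y \<bullet> y) - poly g (z \<bullet> z)) * norm z"
      by (metis norm_scaleR norm_triangle_ineq real_norm_def)
    also have "\<dots> \<le> B1 * norm (y - z) + B2 * (2 * R * norm (y - z)) * R"
      using B1(2)[OF yy[OF y]] g z B True by (intro add_mono mult_mono) auto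
    finally show ?thesis by (simp add: algebra_simps)
  qed
  moreover have "B1 + B2 * (2 * R) * R \<ge> 0" using B True by simp
  ultimately show ?thesis by blast
next
  case False
  then have "cball (0::'a) R = {}" by simp
  then show ?thesis by auto
qed

section \<open>The noiseless path\<close>

lemma locally_Lipschitz_bounded:
  fixes b :: "'a::real_normed_vector \<Rightarrow> 'b::real_normed_vector"
  assumes "\<exists>L\<ge>0. \<forall>y\<in>cball 0 R. \<forall>z\<in>cball 0 R. norm (b y - b z) \<le> L * norm (y - z)"
  shows "\<exists>M\<ge>0. \<forall>y\<in>cball 0 R. norm (b y) \<le> M"
proof (cases "R \<ge> 0")
  case True
  obtain L where L: "L \<ge> 0" "\<And>y z. y \<in> cball 0 R \<Longrightarrow> z \<in> cball 0 R \<Longrightarrow> norm (b y - b z) \<le> L * norm (y - z)"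
    using assms by blast
  have "norm (b y) \<le> norm (b 0) + L * R" if "y \<in> cball 0 R" for y
  proof -
    have "norm (b y - b 0) \<le> L * norm (y - 0)" using that True by (intro L(2)) auto
    moreover have "L * norm (y - 0) \<le> L * R" using that L(1) by (intro mult_left_mono) auto
    ultimately show ?thesis using norm_triangle_sub[of "b y" "b 0"] by simp
  qed
  moreover have "norm (b 0) + L * R \<ge> 0" using L(1) True by simp
  ultimately show ?thesis by blast
next
  case False
  then have "cball (0::'a) R = {}" by simp
  then show ?thesis by auto
qed

lemma locally_Lipschitz_continuous:
  fixes b :: "'a::real_normed_vector \<Rightarrow> 'b::real_normed_vector"
  assumes "\<And>R. \<exists>L\<ge>0. \<forall>y\<in>cball 0 R. \<forall>z\<in>cball 0 R. norm (b y - b z) \<le> L * norm (y - z)"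
  shows "continuous_on UNIV b"
proof -
  have "isCont b y" for y
  proof -
    obtain L where L: "L \<ge> 0" "\<And>z w. z \<in> cball 0 (norm y + 1) \<Longrightarrow> w \<in> cball 0 (norm y + 1) \<Longrightarrow>
        norm (b z - b w) \<le> L * norm (z - w)"
      using assms[of "norm y + 1"] by blast
    have "continuous_on (ball y 1) b"
    proof (rule lipschitz_on_continuous_on[of L])
      show "lipschitz_on L (ball y 1) b"
      proof (rule lipschitz_onI[OF _ L(1)])
        fix z w assume "z \<in> ball y 1" "w \<in> ball y 1"
        then have "z \<in> cball 0 (norm y + 1)" "w \<in> cball 0 (norm y + 1)"
          using norm_triangle_sub[of z y] norm_triangle_sub[of w y] by (auto simp: dist_norm norm_minus_commute)
        from L(2)[OF this] show "dist (b z) (b w) \<le> L * dist z w" by (simp add: dist_norm)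
      qed
    qed
    then show ?thesis using continuous_on_eq_continuous_at[of "ball y 1" b] by auto
  qed
  then show ?thesis by (simp add: continuous_at_imp_continuous_on)
qed

lemma closest_point_cball_0:
  fixes z :: "'a::euclidean_space"
  assumes "R > 0"
  shows "closest_point (cball 0 R) z = (if norm z \<le> R then z else (R / norm z) *\<^sub>R z)"
proof (cases "norm z \<le> R")
  case True
  then show ?thesis by (simp add: closest_point_self)
next
  case False
  have "(R / norm z) *\<^sub>R z = closest_point (cball 0 R) z"
  proof (rule closest_point_unique)
    show "(R / norm z) *\<^sub>R z \<in> cball 0 R" using assms False by auto
    show "\<forall>y\<in>cball 0 R. dist z ((R / norm z) *\<^sub>R z) \<le> dist z y"
    proof
      fix y :: 'a assume y: "y \<in> cball 0 R"
      have "norm z > 0" using False assms by linarith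
      have "z - (R / norm z) *\<^sub>R z = (1 - R / norm z) *\<^sub>R z" by (simp add: scaleR_diff_left)
      then have "dist z ((R / norm z) *\<^sub>R z) = \<bar>1 - R / norm z\<bar> * norm z"
        by (simp add: dist_norm)
      also have "\<dots> = norm z - R"
        using False assms \<open>norm z > 0\<close> by (simp add: abs_if field_simps)
      also have "\<dots> \<le> norm z - norm y" using y by simp
      also have "\<dots> \<le> dist z y" by (simp add: dist_norm norm_triangle_ineq2)
      finally show "dist z ((R / norm z) *\<^sub>R z) \<le> dist z y" .
    qed
  qed auto
  then show ?thesis using False by simp
qed

text \<open>
  Picard's theorem on the whole of \<open>{0..T}\<close>. The fixed point is sought for the rescaled function
  \<open>exp (- \<mu> * t) *\<^sub>R z t\<close>: with \<open>\<mu> > 2 * L\<close> the integral operator contracts by the factor one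
  half for every \<open>T\<close>. Time is clamped to \<open>{0..T}\<close> in order to work with bounded continuous functions on the
  real line.
\<close>

lemma Lipschitz_ode_exists:
  fixes w :: "'a::euclidean_space \<Rightarrow> 'a"
  assumes lip: "\<And>y z. norm (w y - w z) \<le> L * norm (y - z)" and L: "L \<ge> 0" and T: "(T::real) \<ge> 0"
  shows "\<exists>z. continuous_on {0..T} z \<and> (\<forall>t\<in>{0..T}. z t = integral {0..t} (\<lambda>s. w (z s)))"
proof -
  define \<mu> where "\<mu> = 2 * L + 1"
  have \<mu>: "\<mu> > 0" "L \<le> \<mu> / 2" using L by (auto simp: \<mu>_def)
  have cw: "continuous_on UNIV w"
    by (rule lipschitz_on_continuous_on[of L]) (use lip L in \<open>auto intro!: lipschitz_onI simp: dist_norm\<close>)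
  define I where "I u s = w (exp (\<mu> * s) *\<^sub>R apply_bcontfun u s)" for u :: "real \<Rightarrow>\<^sub>C 'a" and s
  have cI: "continuous_on S (I u)" for u S
    unfolding I_def
    by (rule continuous_on_compose2[OF cw]) (auto intro!: continuous_intros)
  define J where "J u t = exp (- \<mu> * t) *\<^sub>R integral {0..t} (I u)" for u t
  have cJ: "continuous_on {0..T} (J u)" for u
    unfolding J_def by (intro continuous_intros indefinite_integral_continuous_1 integrable_continuous_real cI)
  define cl where "cl t = max 0 (min T t)" for t :: real
  have cl: "cl t \<in> {0..T}" "cl t \<le> T" "0 \<le> cl t" for t using T by (auto simp: cl_def)
  have ccl: "continuous_on UNIV cl" unfolding cl_def by (intro continuous_intros)
  have bc: "(\<lambda>t. J u (cl t)) \<in> bcontfun" for u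
  proof -
    obtain b where "\<And>t. t \<in> {0..T} \<Longrightarrow> norm (J u t) \<le> b"
      using compact_continuous_bound[OF compact_Icc cJ] by blast
    then show ?thesis
      using cl by (intro bcontfun_normI[of _ b] continuous_on_compose2[OF cJ ccl]) auto
  qed
  define \<Phi> where "\<Phi> u = Bcontfun (\<lambda>t. J u (cl t))" for u
  have \<Phi>: "apply_bcontfun (\<Phi> u) t = J u (cl t)" for u t
    unfolding \<Phi>_def using Bcontfun_inverse[OF bc] by simp
  have "dist (\<Phi> u) (\<Phi> u') \<le> 1 / 2 * dist u u'" for u u'
  proof (rule dist_bound)
    fix t
    define c where "c = cl t"
    have c: "0 \<le> c" by (simp add: c_def cl_def)
    have "norm (integral {0..c} (I u) - integral {0..c} (I u')) = norm (integral {0..c} (\<lambda>s. I u s - I u' s))"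
      by (subst integral_diff) (auto intro!: integrable_continuous_real cI)
    also have "\<dots> \<le> integral {0..c} (\<lambda>s. L * dist u u' * exp (\<mu> * s))"
    proof (rule integral_norm_bound_integral)
      fix s
      have "norm (I u s - I u' s) \<le> L * norm (exp (\<mu> * s) *\<^sub>R u s - exp (\<mu> * s) *\<^sub>R u' s)"
        unfolding I_def by (rule lip)
      also have "\<dots> = L * (exp (\<mu> * s) * dist (u s) (u' s))"
        by (simp add: scaleR_diff_right[symmetric] dist_norm)
      also have "\<dots> \<le> L * (exp (\<mu> * s) * dist u u')"
        using L dist_bounded by (intro mult_left_mono) auto
      finally show "norm (I u s - I u' s) \<le> L * dist u u' * exp (\<mu> * s)" by (simp add: mult_ac)
    qed (auto intro!: integrable_continuous_real continuous_intros cI)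
    also have "\<dots> = L * dist u u' * ((exp (\<mu> * c) - 1) / \<mu>)"
    proof -
      have "((\<lambda>s. exp (\<mu> * s)) has_integral (exp (\<mu> * c) / \<mu> - exp (\<mu> * 0) / \<mu>)) {0..c}"
        by (rule fundamental_theorem_of_calculus[OF c])
           (use \<mu> in \<open>auto intro!: derivative_eq_intros simp: has_real_derivative_iff_has_vector_derivative[symmetric]\<close>)
      then show ?thesis by (simp add: integral_unique diff_divide_distrib)
    qed
    finally have 1: "norm (integral {0..c} (I u) - integral {0..c} (I u')) \<le> L * dist u u' * ((exp (\<mu> * c) - 1) / \<mu>)" .
    have "dist (\<Phi> u t) (\<Phi> u' t) = exp (- \<mu> * c) * norm (integral {0..c} (I u) - integral {0..c} (I u'))"
      by (simp add: \<Phi> J_def c_def dist_norm scaleR_diff_right[symmetric])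
    also have "\<dots> \<le> exp (- \<mu> * c) * (L * dist u u' * ((exp (\<mu> * c) - 1) / \<mu>))"
      using 1 by (intro mult_left_mono) auto
    also have "\<dots> = (L * dist u u') * ((1 - exp (- \<mu> * c)) / \<mu>)"
      by (simp add: exp_minus field_simps)
    also have "\<dots> \<le> (L * dist u u') * (1 / \<mu>)"
      using L \<mu> by (intro mult_left_mono divide_right_mono) auto
    also have "\<dots> = dist u u' * (L / \<mu>)" by simp
    also have "\<dots> \<le> dist u u' * (1 / 2)"
      using \<mu> by (intro mult_left_mono) (auto simp: field_simps)
    finally show "dist (\<Phi> u t) (\<Phi> u' t) \<le> 1 / 2 * dist u u'" by simp
  qed
  then obtain u where u: "\<Phi> u = u" using banach_fix_type[of "1/2" \<Phi>] by auto
  define z where "z t = exp (\<mu> * t) *\<^sub>R apply_bcontfun u t" for t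
  have "z t = integral {0..t} (\<lambda>s. w (z s))" if t: "t \<in> {0..T}" for t
  proof -
    have "cl t = t" using t by (auto simp: cl_def)
    then have "apply_bcontfun u t = exp (- \<mu> * t) *\<^sub>R integral {0..t} (I u)"
      using \<Phi>[of u t] u by (simp add: J_def)
    then have "z t = integral {0..t} (I u)" by (simp add: z_def exp_minus)
    then show ?thesis by (simp add: I_def[abs_def] z_def)
  qed
  moreover have "continuous_on {0..T} z" unfolding z_def by (intro continuous_intros) auto
  ultimately show ?thesis by blast
qed

text \<open>
  Truncate the field outside the ball of radius \<open>R\<close> around \<open>x\<close>, solve, and show that the solution never leaves
  the ball. The truncation is radial, so the growth condition survives it with the same
  constant \<open>M\<close>, and the bound \<open>1 + M * T\<close> on the displacement does not depend on \<open>R\<close>.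
\<close>

lemma dissipative_ode_exists:
  fixes v :: "'a::euclidean_space \<Rightarrow> 'a"
  assumes lip: "\<And>R. \<exists>L\<ge>0. \<forall>y\<in>cball 0 R. \<forall>z\<in>cball 0 R. norm (v y - v z) \<le> L * norm (y - z)"
    and M: "M \<ge> 0" "\<And>h. - M * norm h \<le> h \<bullet> v (x + h)" and T: "(T::real) \<ge> 0"
  shows "\<exists>\<Psi>. continuous_on {0..T} \<Psi> \<and> (\<forall>t\<in>{0..T}. \<Psi> t = x - integral {0..t} (\<lambda>s. v (\<Psi> s)))"
proof -
  define R where "R = 1 + M * T"
  have R: "R > 0" using M T by (simp add: R_def add_pos_nonneg)
  define pr where "pr = closest_point (cball (0::'a) R)"
  have pr_in: "pr y \<in> cball 0 R" for y
    unfolding pr_def by (rule closest_point_in_set) (use R in auto)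
  have pr_lip: "norm (pr y - pr z) \<le> norm (y - z)" for y z
    using closest_point_lipschitz[of "cball 0 R" y z] R by (simp add: pr_def dist_norm)
  define w where "w y = - v (x + pr y)" for y
  obtain L where L: "L \<ge> 0" "\<And>y z. y \<in> cball 0 (norm x + R) \<Longrightarrow> z \<in> cball 0 (norm x + R) \<Longrightarrow>
      norm (v y - v z) \<le> L * norm (y - z)"
    using lip[of "norm x + R"] by blast
  have wlip: "norm (w y - w z) \<le> L * norm (y - z)" for y z
  proof -
    have "x + pr y \<in> cball 0 (norm x + R)" for y
      using pr_in[of y] norm_triangle_ineq[of x "pr y"] by simp
    then have "norm (v (x + pr z) - v (x + pr y)) \<le> L * norm (x + pr z - (x + pr y))" by (intro L(2))
    also have "\<dots> \<le> L * norm (y - z)"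
      using pr_lip[of z y] L(1) by (intro mult_left_mono) (auto simp: norm_minus_commute)
    finally show ?thesis by (simp add: w_def)
  qed
  obtain z where z: "continuous_on {0..T} z" "\<And>t. t \<in> {0..T} \<Longrightarrow> z t = integral {0..t} (\<lambda>s. w (z s))"
    using Lipschitz_ode_exists[OF wlip L(1) T] by blast
  have cw: "continuous_on UNIV w"
    by (rule lipschitz_on_continuous_on[of L]) (use wlip L in \<open>auto intro!: lipschitz_onI simp: dist_norm\<close>)
  have wbound: "y \<bullet> w y \<le> M * norm y" for y
  proof (cases "norm y \<le> R")
    case True
    then have "pr y = y" using closest_point_cball_0[OF R, of y] by (simp add: pr_def)
    then show ?thesis using M(2)[of y] by (simp add: w_def)
  next
    case False
    define \<theta> where "\<theta> = R / norm y"
    have \<theta>: "\<theta> > 0" "pr y = \<theta> *\<^sub>R y"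
      using False R closest_point_cball_0[OF R, of y] by (auto simp: \<theta>_def pr_def intro!: divide_pos_pos)
    have "\<theta> * (- M * norm y) \<le> \<theta> * (y \<bullet> v (x + pr y))"
      using M(2)[of "pr y"] \<theta> by (simp add: mult_ac)
    then have "- M * norm y \<le> y \<bullet> v (x + pr y)"
      using mult_le_cancel_left_pos[OF \<theta>(1)] by blast
    then show ?thesis by (simp add: w_def)
  qed
  have zder: "(z has_vector_derivative w (z t)) (at t within {0..T})" if t: "t \<in> {0..T}" for t
  proof -
    have "((\<lambda>u. integral {0..u} (\<lambda>s. w (z s))) has_vector_derivative w (z t)) (at t within {0..T})"
      by (rule integral_has_vector_derivative[OF _ t]) (rule continuous_on_compose2[OF cw z(1)], simp)
    then show ?thesis
      by (rule has_vector_derivative_transform[OF t, rotated]) (use z(2) in auto)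
  qed
  have zb: "norm (z t) \<le> R" if t: "t \<in> {0..T}" for t
  proof -
    define \<phi> where "\<phi> s = M * s - sqrt (1 + z s \<bullet> z s)" for s
    have pos: "1 + y \<bullet> y > 0" for y :: 'a using inner_ge_zero[of y] by linarith
    have "\<phi> 0 \<le> \<phi> t"
    proof (rule DERIV_nonneg_imp_increasing_open[of 0 t \<phi>])
      show "0 \<le> t" using t by simp
      fix s assume s: "0 < s" "s < t"
      have "at s within {0..T} = at s" using s t by (intro at_within_interior) (auto simp: interior_atLeastAtMost_real)
      then have dz: "(z has_derivative (\<lambda>h. h *\<^sub>R w (z s))) (at s)"
        using zder[of s] s t by (simp add: has_vector_derivative_def)
      have "((\<lambda>s. z s \<bullet> z s) has_derivative (\<lambda>h. z s \<bullet> (h *\<^sub>R w (z s)) + (h *\<^sub>R w (z s)) \<bullet> z s)) (at s)"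
        by (rule has_derivative_inner[OF dz dz])
      then have "DERIV (\<lambda>s. z s \<bullet> z s) s :> 2 * (z s \<bullet> w (z s))"
        unfolding has_field_derivative_def
        by (rule has_derivative_eq_rhs) (auto simp: inner_commute algebra_simps)
      then have d: "DERIV \<phi> s :> M - (2 * (z s \<bullet> w (z s))) / (2 * sqrt (1 + z s \<bullet> z s))"
        unfolding \<phi>_def using pos[of "z s"]
        by (auto intro!: derivative_eq_intros simp: field_simps)
      have "norm (z s) \<le> sqrt (1 + z s \<bullet> z s)" by (simp add: norm_eq_sqrt_inner)
      then have "M * norm (z s) \<le> M * sqrt (1 + z s \<bullet> z s)" using M(1) by (rule mult_left_mono)
      then have "z s \<bullet> w (z s) \<le> M * sqrt (1 + z s \<bullet> z s)" using wbound[of "z s"] by linarith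
      then have "(2 * (z s \<bullet> w (z s))) / (2 * sqrt (1 + z s \<bullet> z s)) \<le> M"
        using pos[of "z s"] by (simp add: pos_divide_le_eq)
      then show "\<exists>y. DERIV \<phi> s :> y \<and> 0 \<le> y" using d by (intro exI conjI) auto
    next
      have "continuous_on {0..t} z" using z(1) by (rule continuous_on_subset) (use t in auto)
      then show "continuous_on {0..t} \<phi>" unfolding \<phi>_def by (intro continuous_intros)
    qed
    moreover have "z 0 = 0" using z(2)[of 0] T by simp
    ultimately have "sqrt (1 + z t \<bullet> z t) \<le> 1 + M * t" by (simp add: \<phi>_def)
    moreover have "norm (z t) \<le> sqrt (1 + z t \<bullet> z t)" by (simp add: norm_eq_sqrt_inner)
    moreover have "M * t \<le> M * T" using t M by (intro mult_left_mono) auto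
    ultimately show ?thesis by (simp add: R_def)
  qed
  have wz: "w (z s) = - v (x + z s)" if "s \<in> {0..T}" for s
    using zb[OF that] closest_point_cball_0[OF R, of "z s"] by (simp add: w_def pr_def)
  have "x + z t = x - integral {0..t} (\<lambda>s. v (x + z s))" if t: "t \<in> {0..T}" for t
  proof -
    have "integral {0..t} (\<lambda>s. w (z s)) = integral {0..t} (\<lambda>s. - v (x + z s))"
      by (rule integral_cong) (use wz t in auto)
    then show ?thesis using z(2)[OF t] by simp
  qed
  moreover have "continuous_on {0..T} (\<lambda>t. x + z t)" using z(1) by (intro continuous_intros)
  ultimately show ?thesis by (intro exI[of _ "\<lambda>t. x + z t"]) auto
qed

section \<open>Comparison of the costs at a fixed time\<close>

lemma sum_from_1: "N \<ge> 1 \<Longrightarrow> (\<Sum>k=1..N. g k) = g 1 + (\<Sum>k=2..N. g k)" for g :: "nat \<Rightarrow> 'b::comm_monoid_add"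
  by (simp add: sum.atLeast_Suc_atMost numeral_2_eq_2)

lemma inner_le_squares: "x \<bullet> y \<le> s * (norm x)\<^sup>2 + (norm y)\<^sup>2 / (4 * s)" if "s > 0" for x y :: "'a::real_inner"
proof -
  have "x \<bullet> y \<le> norm y * norm x" using norm_cauchy_schwarz[of x y] by (simp add: mult.commute)
  also have "\<dots> \<le> s * (norm x)\<^sup>2 + (norm y)\<^sup>2 / (4 * s)" by (rule linear_le_quadratic[OF that])
  finally show ?thesis .
qed

text \<open>
  A bounded sum of squares makes the average of order \<open>N\<^sup>-\<^sup>1\<^sup>/\<^sup>2\<close>. The weight is chosen such that both terms are
  balanced.
\<close>

lemma average_le_squares:
  fixes x :: "nat \<Rightarrow> real"
  assumes N: "N \<ge> 1"
  shows "(\<Sum>k=2..N. x k) / real N \<le> ((\<Sum>k=2..N. (x k)\<^sup>2) + 1) / (2 * sqrt (real N))"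
proof -
  define q where "q = sqrt (real N)"
  have q: "q > 0" "real N = q * q" using N by (simp_all add: q_def)
  have "(\<Sum>k=2..N. x k) / real N = (\<Sum>k=2..N. 1 / real N * x k)" by (simp add: sum_divide_distrib)
  also have "\<dots> \<le> (\<Sum>k=2..N. 1 / (2 * q) * (x k)\<^sup>2 + (1 / real N)\<^sup>2 / (4 * (1 / (2 * q))))"
    using q by (intro sum_mono linear_le_quadratic) simp
  also have "\<dots> = (\<Sum>k=2..N. (x k)\<^sup>2) / (2 * q) + real (N - 1) * ((1 / real N)\<^sup>2 / (4 * (1 / (2 * q))))"
    unfolding sum.distrib sum_distrib_left[symmetric] by simp
  also have "real (N - 1) * ((1 / real N)\<^sup>2 / (4 * (1 / (2 * q)))) \<le> real N * ((1 / real N)\<^sup>2 / (4 * (1 / (2 * q))))"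
    using q by (intro mult_right_mono) auto
  also have "real N * ((1 / real N)\<^sup>2 / (4 * (1 / (2 * q)))) = 1 / (2 * q)"
    using q by (simp add: power2_eq_square field_simps)
  finally show ?thesis by (simp add: q_def add_divide_distrib)
qed

text \<open>
  All that the comparison of the functionals uses about the gradients \<open>v\<close> of \<open>V\<close> and \<open>D\<close> of \<open>F\<close>; \<open>\<gamma>\<close> is
  the radial factor of \<open>D\<close>.
\<close>

locale mean_field_potentials =
  fixes v D :: "'a::euclidean_space \<Rightarrow> 'a" and F \<gamma> :: "'a \<Rightarrow> real"
  assumes v_Lipschitz: "\<exists>L\<ge>0. \<forall>y\<in>cball 0 R. \<forall>z\<in>cball 0 R. norm (v y - v z) \<le> L * norm (y - z)"
    and v_growth: "\<exists>M\<ge>0. \<forall>a\<in>cball 0 R. \<forall>w. - M * norm w \<le> w \<bullet> v (a + w)"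
    and D_Lipschitz: "\<exists>L\<ge>0. \<forall>y\<in>cball 0 R. \<forall>z\<in>cball 0 R. norm (D y - D z) \<le> L * norm (y - z)"
    and D_radial: "D y = \<gamma> y *\<^sub>R y"
    and \<gamma>_even: "\<gamma> (- y) = \<gamma> y"
    and \<gamma>_lower: "\<exists>C\<ge>0. \<forall>y. - C \<le> \<gamma> y"
    and \<gamma>_nonneg: "\<exists>S. \<forall>y. S \<le> norm y \<longrightarrow> 0 \<le> \<gamma> y"
    and D_pair: "\<exists>c>0. \<exists>C. \<forall>u v. c * ((norm (D u))\<^sup>2 + (norm (D v))\<^sup>2) - C
        \<le> (D u - D v) \<bullet> D (u - v) / 2 + D u \<bullet> D v / 8"
    and F_deriv: "(F has_derivative (\<lambda>h. D y \<bullet> h)) (at y)"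
    and F_0: "F 0 = 0" and F_nonneg: "0 \<le> F y"
begin

lemma D_minus: "D (- y) = - D y"
  using D_radial \<gamma>_even by simp

lemma D_0: "D 0 = 0"
  using D_radial by simp

lemma v_bounded: "\<exists>M\<ge>0. \<forall>y\<in>cball 0 R. norm (v y) \<le> M"
  by (rule locally_Lipschitz_bounded[OF v_Lipschitz])

lemma D_bounded: "\<exists>M\<ge>0. \<forall>y\<in>cball 0 R. norm (D y) \<le> M"
  by (rule locally_Lipschitz_bounded[OF D_Lipschitz])

definition drift :: "nat \<Rightarrow> (nat \<Rightarrow> 'a) \<Rightarrow> nat \<Rightarrow> 'a" where
  "drift N X i = v (X i) + (1 / real N) *\<^sub>R (\<Sum>k=1..N. D (X i - X k))"

text \<open>
  Throughout, \<open>X k\<close> and \<open>U k\<close> are position and velocity of the \<open>k\<close>-th particle at a fixed time, \<open>p\<close> is the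
  position of the noiseless path and \<open>- v p\<close> its velocity.
\<close>

definition others_cost :: "nat \<Rightarrow> (nat \<Rightarrow> 'a) \<Rightarrow> (nat \<Rightarrow> 'a) \<Rightarrow> real" where
  "others_cost N X U = (\<Sum>k=2..N. (norm (U k + drift N X k))\<^sup>2)"

definition others_spread :: "nat \<Rightarrow> (nat \<Rightarrow> 'a) \<Rightarrow> 'a \<Rightarrow> real" where
  "others_spread N X p = (\<Sum>k=2..N. (norm (X k - p))\<^sup>2)"

text \<open>
  The difference \<open>e\<close> between the limiting force on the first particle and the force exerted by the particles. As \<open>D\<close> is odd,
  all differences are taken relative to the first particle.
\<close>

definition force_gap :: "nat \<Rightarrow> (nat \<Rightarrow> 'a) \<Rightarrow> 'a \<Rightarrow> 'a" where
  "force_gap N X p = (1 / real N) *\<^sub>R (\<Sum>k=1..N. D (X k - X 1)) - D (p - X 1)"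

text \<open>
  The integrand of \<open>4 (I\<^sup>N - J\<^sub>\<infinity>)\<close> after the integration by parts: in the last sum the
  term \<open>k = 1\<close> vanishes, so \<open>U 1\<close> does not occur.
\<close>

definition defect :: "nat \<Rightarrow> (nat \<Rightarrow> 'a) \<Rightarrow> 'a \<Rightarrow> (nat \<Rightarrow> 'a) \<Rightarrow> real" where
  "defect N X p U = others_cost N X U + (norm (force_gap N X p))\<^sup>2
      - 2 * ((v (X 1) + D (X 1 - p)) \<bullet> force_gap N X p)
      - 2 * (D (p - X 1) \<bullet> v p) - 2 / real N * (\<Sum>k=1..N. D (X k - X 1) \<bullet> U k)"

text \<open>
  The time derivative of \<open>boundary_value\<close> below.
\<close>

definition boundary_rate :: "nat \<Rightarrow> (nat \<Rightarrow> 'a) \<Rightarrow> 'a \<Rightarrow> (nat \<Rightarrow> 'a) \<Rightarrow> real" where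
  "boundary_rate N X p U = D (p - X 1) \<bullet> (- v p - U 1)
      - 1 / real N * (\<Sum>k=1..N. D (X k - X 1) \<bullet> (U k - U 1))"

text \<open>
  Expand the square of \<open>U 1 + drift N X 1 = a - e\<close>, where \<open>a\<close> is the residual in the limit functional.
  The term \<open>U 1 \<bullet> e\<close>, which cannot be bounded uniformly, is collected in the
  boundary rate.
\<close>

lemma cost_difference:
  assumes N: "N \<ge> 1"
  shows "(\<Sum>k=1..N. (norm (U k + drift N X k))\<^sup>2) - (norm (U 1 + v (X 1) + D (X 1 - p)))\<^sup>2
     = defect N X p U - 2 * boundary_rate N X p U"
proof -
  define e where "e = force_gap N X p"
  define b where "b = v (X 1) + D (X 1 - p)"
  define E where "E = (1 / real N) *\<^sub>R (\<Sum>k=1..N. D (X k - X 1))"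
  have rev: "D (x - y) = - D (y - x)" for x y using D_minus[of "y - x"] by simp
  have "(\<Sum>k=1..N. D (X 1 - X k)) = - (\<Sum>k=1..N. D (X k - X 1))"
    by (subst rev) (simp add: sum_negf)
  then have "drift N X 1 = v (X 1) - E" by (simp add: drift_def E_def)
  moreover have eE: "e = E - D (p - X 1)" by (simp add: e_def force_gap_def E_def)
  ultimately have "U 1 + drift N X 1 = (U 1 + b) - e"
    using rev[of "X 1" p] by (simp add: b_def)
  moreover have "(norm (x - e))\<^sup>2 = (norm x)\<^sup>2 - 2 * (x \<bullet> e) + (norm e)\<^sup>2" for x
    by (simp add: power2_norm_eq_inner inner_diff_left inner_diff_right inner_commute)
  ultimately have "(norm (U 1 + drift N X 1))\<^sup>2 = (norm (U 1 + b))\<^sup>2 - 2 * ((U 1 + b) \<bullet> e) + (norm e)\<^sup>2"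
    by metis
  moreover have sumeq: "(\<Sum>k=1..N. D (X k - X 1) \<bullet> (U k - U 1))
      = (\<Sum>k=1..N. D (X k - X 1) \<bullet> U k) - (\<Sum>k=1..N. D (X k - X 1)) \<bullet> U 1"
    by (simp add: inner_diff_right sum_subtractf inner_sum_left)
  have "boundary_rate N X p U = - (D (p - X 1) \<bullet> v p) - D (p - X 1) \<bullet> U 1
      - (1 / real N) * (\<Sum>k=1..N. D (X k - X 1) \<bullet> U k) + E \<bullet> U 1"
    unfolding boundary_rate_def sumeq by (simp add: E_def inner_diff_right diff_divide_distrib)
  then have "boundary_rate N X p U = U 1 \<bullet> e - (D (p - X 1) \<bullet> v p)
      - (1 / real N) * (\<Sum>k=1..N. D (X k - X 1) \<bullet> U k)"
    by (simp add: eE inner_diff_right inner_commute)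
  moreover have "(\<Sum>k=1..N. (norm (U k + drift N X k))\<^sup>2)
     = (norm (U 1 + drift N X 1))\<^sup>2 + others_cost N X U"
    unfolding others_cost_def using N by (rule sum_from_1)
  moreover have "U 1 + v (X 1) + D (X 1 - p) = U 1 + b" by (simp add: b_def)
  ultimately show ?thesis
    unfolding defect_def e_def[symmetric] b_def[symmetric]
    by (simp add: inner_add_left add.assoc)
qed

text \<open>
  Sum \<open>pair_coercive\<close> over all pairs; as \<open>D\<close> is odd, the double sum of
  \<open>D (y k) \<bullet> D (y k - y j)\<close> equals half of its antisymmetrisation.
\<close>

lemma pair_sum_coercive:
  assumes c: "\<And>u v. c * ((norm (D u))\<^sup>2 + (norm (D v))\<^sup>2) - C
        \<le> (D u - D v) \<bullet> D (u - v) / 2 + D u \<bullet> D v / 8"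
  shows "2 * c * real N * (\<Sum>k=1..N. (norm (D (y k)))\<^sup>2) - (real N)\<^sup>2 * C
     \<le> (\<Sum>k=1..N. \<Sum>j=1..N. D (y k) \<bullet> D (y k - y j)) + (norm (\<Sum>k=1..N. D (y k)))\<^sup>2 / 8"
proof -
  let ?S = "\<Sum>k=1..N. \<Sum>j=1..N. D (y k) \<bullet> D (y k - y j)"
  have rev: "D (a - b) = - D (b - a)" for a b using D_minus[of "b - a"] by simp
  have "(\<Sum>k=1..N. \<Sum>j=1..N. D (y j) \<bullet> D (y k - y j)) = (\<Sum>j=1..N. \<Sum>k=1..N. D (y j) \<bullet> D (y k - y j))"
    by (rule sum.swap)
  also have "\<dots> = - ?S"
    by (subst rev) (simp add: sum_negf)
  finally have sw: "(\<Sum>k=1..N. \<Sum>j=1..N. D (y j) \<bullet> D (y k - y j)) = - ?S" .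
  have sq: "(\<Sum>k=1..N. \<Sum>j=1..N. D (y k) \<bullet> D (y j)) = (norm (\<Sum>k=1..N. D (y k)))\<^sup>2"
    by (subst sum.swap) (simp add: power2_norm_eq_inner inner_sum_left inner_sum_right)
  have "(\<Sum>k=1..N. \<Sum>j=1..N. c * ((norm (D (y k)))\<^sup>2 + (norm (D (y j)))\<^sup>2) - C)
     \<le> (\<Sum>k=1..N. \<Sum>j=1..N. (D (y k) - D (y j)) \<bullet> D (y k - y j) / 2 + D (y k) \<bullet> D (y j) / 8)"
    by (intro sum_mono c)
  also have "\<dots> = ?S / 2 - (\<Sum>k=1..N. \<Sum>j=1..N. D (y j) \<bullet> D (y k - y j)) / 2
       + (\<Sum>k=1..N. \<Sum>j=1..N. D (y k) \<bullet> D (y j)) / 8"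
    by (simp add: sum.distrib inner_diff_left diff_divide_distrib sum_subtractf sum_divide_distrib)
  also have "\<dots> = ?S + (norm (\<Sum>k=1..N. D (y k)))\<^sup>2 / 8" unfolding sw sq by simp
  also have "(\<Sum>k=1..N. \<Sum>j=1..N. c * ((norm (D (y k)))\<^sup>2 + (norm (D (y j)))\<^sup>2) - C)
     = 2 * c * real N * (\<Sum>k=1..N. (norm (D (y k)))\<^sup>2) - (real N)\<^sup>2 * C"
    by (simp add: sum.distrib sum_subtractf sum_distrib_left distrib_left power2_eq_square mult_ac)
  finally show ?thesis .
qed

text \<open>
  Where \<open>\<gamma>\<close> is nonnegative, \<open>D y\<close> is a nonnegative multiple of \<open>y\<close> and the confinement bounds its product
  with \<open>v\<close>; the remaining \<open>y\<close> form a bounded set.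
\<close>

lemma confinement_pairing:
  assumes "c > 0"
  shows "\<exists>C. \<forall>a\<in>cball 0 R. \<forall>y. - (D y \<bullet> v (a + y)) \<le> c * (norm (D y))\<^sup>2 + C"
proof -
  obtain M where M: "M \<ge> 0" "\<And>a w. a \<in> cball 0 R \<Longrightarrow> - M * norm w \<le> w \<bullet> v (a + w)"
    using v_growth[of R] by blast
  obtain S where S: "\<And>y. S \<le> norm y \<Longrightarrow> 0 \<le> \<gamma> y" using \<gamma>_nonneg by blast
  obtain B where B: "B \<ge> 0" "\<And>y. y \<in> cball 0 (R + S) \<Longrightarrow> norm (v y) \<le> B" using v_bounded[of "R + S"] by blast
  obtain B' where B': "B' \<ge> 0" "\<And>y. y \<in> cball 0 S \<Longrightarrow> norm (D y) \<le> B'" using D_bounded[of S] by blast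
  have "- (D y \<bullet> v (a + y)) \<le> c * (norm (D y))\<^sup>2 + (M\<^sup>2 / (4 * c) + B' * B)" if a: "a \<in> cball 0 R" for a y
  proof (cases "S \<le> norm y")
    case True
    have "\<gamma> y * (- M * norm y) \<le> \<gamma> y * (y \<bullet> v (a + y))"
      using M(2)[OF a] S[OF True] by (intro mult_left_mono)
    then have "- (D y \<bullet> v (a + y)) \<le> M * norm (D y)"
      using S[OF True] by (simp add: D_radial mult_ac)
    also have "\<dots> \<le> c * (norm (D y))\<^sup>2 + M\<^sup>2 / (4 * c)" by (rule linear_le_quadratic[OF assms])
    finally show ?thesis using B B' mult_nonneg_nonneg[of B' B] by linarith
  next
    case False
    then have "a + y \<in> cball 0 (R + S)" "y \<in> cball 0 S" using a norm_triangle_ineq[of a y] by auto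
    then have "norm (D y) * norm (v (a + y)) \<le> B' * B" using B B' by (intro mult_mono) auto
    then have "- (D y \<bullet> v (a + y)) \<le> B' * B"
      using Cauchy_Schwarz_ineq2[of "D y" "v (a + y)"] by (simp add: abs_le_iff)
    moreover have "0 \<le> c * (norm (D y))\<^sup>2" "0 \<le> M\<^sup>2 / (4 * c)" using assms by auto
    ultimately show ?thesis by linarith
  qed
  then show ?thesis by blast
qed

text \<open>
  In \<open>defect\<close>, substitute the residuals for the velocities in \<open>\<Sum>\<^sub>k D (X k - X 1) \<bullet> U k\<close>. The
  interaction part then controls the mean \<open>P\<close> of \<open>|D (X k - X 1)|\<^sup>2\<close> by \<open>pair_sum_coercive\<close>, at the price of
  a fraction of the squared net force, which \<open>|e|\<^sup>2\<close> pays for. With \<open>P\<close> at hand the terms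
  containing residuals cost only half of \<open>others_cost\<close> when \<open>N\<close> is large, and the confinement terms a
  fraction of \<open>P\<close>. The estimate holds wherever the other particles are.
\<close>

lemma defect_coercive:
  "\<exists>C N1. \<forall>N\<ge>N1. \<forall>X p U. X 1 \<in> cball 0 R \<longrightarrow> p \<in> cball 0 R \<longrightarrow>
      others_cost N X U / 2 - C \<le> defect N X p U"
proof -
  obtain c C0 where c: "c > 0" and pair: "\<And>u v. c * ((norm (D u))\<^sup>2 + (norm (D v))\<^sup>2) - C0
        \<le> (D u - D v) \<bullet> D (u - v) / 2 + D u \<bullet> D v / 8"
    using D_pair by blast
  have c2: "c / 2 > 0" using c by simp
  obtain C2 where C2: "\<And>a y. a \<in> cball 0 R \<Longrightarrow> - (D y \<bullet> v (a + y)) \<le> c / 2 * (norm (D y))\<^sup>2 + C2"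
    using confinement_pairing[OF c2, of R] by blast
  obtain m1 where m1: "m1 \<ge> 0" "\<And>y. y \<in> cball 0 R \<Longrightarrow> norm (v y) \<le> m1" using v_bounded[of R] by blast
  obtain m2 where m2: "m2 \<ge> 0" "\<And>y. y \<in> cball 0 (2 * R) \<Longrightarrow> norm (D y) \<le> m2" using D_bounded[of "2 * R"] by blast
  define m where "m = m1 + m2"
  have m: "m \<ge> 0" "m1 \<le> m" "m2 \<le> m" using m1 m2 by (auto simp: m_def)
  \<comment> \<open>For \<open>N \<ge> N1\<close> the term \<open>2 P / N\<close> is absorbed by the interaction.\<close>
  obtain N1 where N1: "real N1 > 2 / c" using reals_Archimedean2 by blast
  define C where "C = 19 * m\<^sup>2 + 2 * C2 + 2 * C0"
  have "others_cost N X U / 2 - C \<le> defect N X p U"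
    if NN: "N \<ge> max N1 1" and X1: "X 1 \<in> cball 0 R" and p: "p \<in> cball 0 R" for N X p U
  proof -
    define n where "n = real N"
    have n: "n > 0" "2 / n \<le> 3 * c"
    proof -
      show "n > 0" using NN by (simp add: n_def)
      have "n > 2 / c" using NN N1 by (simp add: n_def)
      then have "2 / n \<le> c" using c \<open>n > 0\<close> by (simp add: field_simps)
      then show "2 / n \<le> 3 * c" using c by simp
    qed
    define y where "y k = X k - X 1" for k
    define r where "r k = U k + drift N X k" for k
    define P where "P = (\<Sum>k=1..N. (norm (D (y k)))\<^sup>2) / n"
    define E where "E = (1 / n) *\<^sub>R (\<Sum>k=1..N. D (y k))"
    define e where "e = force_gap N X p"
    define T where "T = (\<Sum>k=1..N. \<Sum>j=1..N. D (y k) \<bullet> D (y k - y j)) / n\<^sup>2"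
    define Rc where "Rc = others_cost N X U"
    define V where "V = (\<Sum>k=1..N. - (D (y k) \<bullet> v (X 1 + y k)))"
    have P0: "P \<ge> 0" using n by (simp add: P_def sum_nonneg)
    have "2 * c * n * (\<Sum>k=1..N. (norm (D (y k)))\<^sup>2) - n\<^sup>2 * C0 \<le> n\<^sup>2 * T + n\<^sup>2 * (norm E)\<^sup>2 / 8"
      using pair_sum_coercive[OF pair, of N y] n by (simp add: T_def E_def n_def power_divide)
    moreover have "2 * c * n * (\<Sum>k=1..N. (norm (D (y k)))\<^sup>2) = n\<^sup>2 * (2 * c * P)"
      using n by (simp add: P_def power2_eq_square)
    ultimately have "n\<^sup>2 * (2 * c * P - C0) \<le> n\<^sup>2 * (T + (norm E)\<^sup>2 / 8)"
      unfolding right_diff_distrib distrib_left times_divide_eq_right by linarith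
    then have T: "2 * c * P - C0 \<le> T + (norm E)\<^sup>2 / 8" using n by simp
    have U: "U k = r k - v (X 1 + y k) - (1 / n) *\<^sub>R (\<Sum>j=1..N. D (y k - y j))" for k
      by (simp add: r_def drift_def y_def n_def)
    have "(\<Sum>k=1..N. D (y k) \<bullet> U k) = (\<Sum>k=1..N. D (y k) \<bullet> r k) + V
        - (\<Sum>k=1..N. (1 / n) * (\<Sum>j=1..N. D (y k) \<bullet> D (y k - y j)))"
      unfolding V_def by (subst U) (simp add: inner_diff_right inner_sum_right sum_subtractf sum_negf)
    also have "(\<Sum>k=1..N. (1 / n) * (\<Sum>j=1..N. D (y k) \<bullet> D (y k - y j))) = n * T"
      using n by (simp add: T_def sum_divide_distrib[symmetric] power2_eq_square)
    finally have q: "2 / n * (\<Sum>k=1..N. D (y k) \<bullet> U k)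
        = 2 / n * (\<Sum>k=1..N. D (y k) \<bullet> r k) + 2 / n * V - 2 * T"
      using n by (simp add: field_simps)
    have "2 / n * (\<Sum>k=1..N. D (y k) \<bullet> r k) = (\<Sum>k=2..N. 2 / n * (D (y k) \<bullet> r k))"
    proof -
      have "N \<ge> 1" "D (y 1) = 0" using NN by (simp_all add: y_def D_0)
      then show ?thesis using sum_from_1[of N "\<lambda>k. D (y k) \<bullet> r k"] by (simp add: sum_distrib_left)
    qed
    also have "\<dots> \<le> (\<Sum>k=2..N. (norm (r k))\<^sup>2 / 2 + 2 / n\<^sup>2 * (norm (D (y k)))\<^sup>2)"
    proof (rule sum_mono)
      fix k
      have "r k \<bullet> ((2 / n) *\<^sub>R D (y k)) \<le> 1 / 2 * (norm (r k))\<^sup>2 + (norm ((2 / n) *\<^sub>R D (y k)))\<^sup>2 / (4 * (1 / 2))"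
        by (rule inner_le_squares) simp
      then show "2 / n * (D (y k) \<bullet> r k) \<le> (norm (r k))\<^sup>2 / 2 + 2 / n\<^sup>2 * (norm (D (y k)))\<^sup>2"
        by (simp add: inner_commute power_mult_distrib power_divide)
    qed
    also have "\<dots> = Rc / 2 + 2 / n\<^sup>2 * (\<Sum>k=2..N. (norm (D (y k)))\<^sup>2)"
      by (simp add: sum.distrib Rc_def others_cost_def r_def sum_divide_distrib sum_distrib_left)
    also have "\<dots> \<le> Rc / 2 + 2 / n\<^sup>2 * (\<Sum>k=1..N. (norm (D (y k)))\<^sup>2)"
      by (intro add_left_mono mult_left_mono sum_mono2) auto
    also have "\<dots> = Rc / 2 + 2 / n * P" using n by (simp add: P_def power2_eq_square)
    also have "\<dots> \<le> Rc / 2 + 3 * c * P" using n P0 by (intro add_left_mono mult_right_mono) auto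
    finally have q1: "2 / n * (\<Sum>k=1..N. D (y k) \<bullet> r k) \<le> Rc / 2 + 3 * c * P" .
    have "V \<le> (\<Sum>k=1..N. c / 2 * (norm (D (y k)))\<^sup>2 + C2)"
      unfolding V_def by (intro sum_mono C2 X1)
    also have "\<dots> = c / 2 * (\<Sum>k=1..N. (norm (D (y k)))\<^sup>2) + n * C2"
      unfolding sum.distrib sum_distrib_left[symmetric] by (simp add: n_def)
    also have "\<dots> = n * (c / 2 * P + C2)"
      using n by (simp add: P_def distrib_left)
    finally have "2 / n * V \<le> 2 / n * (n * (c / 2 * P + C2))" using n by (intro mult_left_mono) auto
    then have q2: "2 / n * V \<le> c * P + 2 * C2" using n by (simp add: algebra_simps)
    have qq: "2 / n * (\<Sum>k=1..N. D (y k) \<bullet> U k) \<le> Rc / 2 + 2 * C2 + 2 * C0 + (norm E)\<^sup>2 / 4"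
      using q q1 q2 T by linarith
    have pX: "p - X 1 \<in> cball 0 (2 * R)" "X 1 - p \<in> cball 0 (2 * R)"
      using X1 p norm_triangle_ineq4[of p "X 1"] by (auto simp: norm_minus_commute)
    have Dp: "norm (D (p - X 1)) \<le> m" using m2(2)[OF pX(1)] m by simp
    have EE: "E = e + D (p - X 1)" by (simp add: e_def force_gap_def E_def y_def n_def)
    have "norm E \<le> norm e + m" unfolding EE using norm_triangle_ineq[of e "D (p - X 1)"] Dp by linarith
    then have "(norm E)\<^sup>2 \<le> (norm e + m)\<^sup>2" by (intro power_mono) auto
    also have "\<dots> \<le> 2 * (norm e)\<^sup>2 + 2 * m\<^sup>2"
      using zero_le_power2[of "norm e - m"] by (simp add: power2_eq_square algebra_simps)
    finally have EE2: "(norm E)\<^sup>2 \<le> 2 * (norm e)\<^sup>2 + 2 * m\<^sup>2" .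
    define b where "b = v (X 1) + D (X 1 - p)"
    have "norm b \<le> 2 * m"
      unfolding b_def using norm_triangle_ineq[of "v (X 1)" "D (X 1 - p)"] m1(2)[OF X1] m2(2)[OF pX(2)] m by linarith
    then have "(norm (2 *\<^sub>R b))\<^sup>2 \<le> (4 * m)\<^sup>2" by (intro power_mono) auto
    moreover have "e \<bullet> (2 *\<^sub>R b) \<le> 1 / 4 * (norm e)\<^sup>2 + (norm (2 *\<^sub>R b))\<^sup>2 / (4 * (1 / 4))"
      by (rule inner_le_squares) simp
    ultimately have be: "2 * (b \<bullet> e) \<le> (norm e)\<^sup>2 / 4 + 16 * m\<^sup>2"
      by (simp add: inner_commute power_mult_distrib)
    have "norm (D (p - X 1)) * norm (v p) \<le> m * m"
      using Dp m1(2)[OF p] m by (intro mult_mono) auto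
    then have Dv: "D (p - X 1) \<bullet> v p \<le> m\<^sup>2"
      using norm_cauchy_schwarz[of "D (p - X 1)" "v p"] by (simp add: power2_eq_square)
    have "defect N X p U = Rc + (norm e)\<^sup>2 - 2 * (b \<bullet> e) - 2 * (D (p - X 1) \<bullet> v p)
        - 2 / n * (\<Sum>k=1..N. D (y k) \<bullet> U k)"
      by (simp add: defect_def Rc_def e_def b_def n_def y_def)
    then show ?thesis
      using qq EE2 be Dv zero_le_power2[of "norm e"] zero_le_power2[of m] unfolding C_def Rc_def[symmetric]
      by linarith
  qed
  then show ?thesis by blast
qed

text \<open>
  The drift is one-sided Lipschitz at points \<open>p\<close> of a ball: for short \<open>h\<close> by the local Lipschitz property,
  for long \<open>h\<close> by confinement.
\<close>

lemma v_one_sided: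
  "\<exists>C\<ge>0. \<forall>p\<in>cball 0 R. \<forall>h. - C * (norm h)\<^sup>2 \<le> h \<bullet> (v (p + h) - v p)"
proof -
  obtain M where M: "M \<ge> 0" "\<And>a w. a \<in> cball 0 R \<Longrightarrow> - M * norm w \<le> w \<bullet> v (a + w)"
    using v_growth[of R] by blast
  obtain m where m: "m \<ge> 0" "\<And>y. y \<in> cball 0 R \<Longrightarrow> norm (v y) \<le> m" using v_bounded[of R] by blast
  obtain L where L: "L \<ge> 0" "\<And>y z. y \<in> cball 0 (R + 1) \<Longrightarrow> z \<in> cball 0 (R + 1) \<Longrightarrow> norm (v y - v z) \<le> L * norm (y - z)"
    using v_Lipschitz[of "R + 1"] by blast
  have "- (M + m + L) * (norm h)\<^sup>2 \<le> h \<bullet> (v (p + h) - v p)" if p: "p \<in> cball 0 R" for p h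
  proof (cases "norm h \<le> 1")
    case True
    then have "p + h \<in> cball 0 (R + 1)" "p \<in> cball 0 (R + 1)" using p norm_triangle_ineq[of p h] by auto
    from L(2)[OF this] have "norm (v (p + h) - v p) \<le> L * norm h" by simp
    then have "norm h * norm (v (p + h) - v p) \<le> norm h * (L * norm h)" by (intro mult_left_mono) auto
    then have "- (L * (norm h)\<^sup>2) \<le> h \<bullet> (v (p + h) - v p)"
      using Cauchy_Schwarz_ineq2[of h "v (p + h) - v p"] by (simp add: abs_le_iff power2_eq_square mult_ac)
    moreover have "0 \<le> (M + m) * (norm h)\<^sup>2" using M m by simp
    ultimately show ?thesis by (simp add: algebra_simps)
  next
    case False
    have "norm h * norm (v p) \<le> norm h * m" using m(2)[OF p] by (intro mult_left_mono) auto
    then have "h \<bullet> v p \<le> m * norm h" using norm_cauchy_schwarz[of h "v p"] by (simp add: mult.commute)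
    then have "- ((M + m) * norm h) \<le> h \<bullet> (v (p + h) - v p)"
      using M(2)[OF p, of h] by (simp add: inner_diff_right algebra_simps)
    moreover have "(M + m) * norm h \<le> (M + m) * (norm h)\<^sup>2"
    proof (rule mult_left_mono)
      have "norm h * 1 \<le> norm h * norm h" using False by (intro mult_left_mono) auto
      then show "norm h \<le> (norm h)\<^sup>2" by (simp add: power2_eq_square)
    qed (use M m in simp)
    moreover have "0 \<le> L * (norm h)\<^sup>2" using L by simp
    ultimately show ?thesis by (simp add: algebra_simps)
  qed
  moreover have "M + m + L \<ge> 0" using M m L by simp
  ultimately show ?thesis by blast
qed

text \<open>
  Far out, \<open>h\<close> and \<open>h + z\<close> form an acute angle and \<open>D\<close> points outwards, so the interaction with a particle
  in a bounded region pulls back up to a constant.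
\<close>

lemma D_shifted_lower: "\<exists>C\<ge>0. \<forall>z\<in>cball 0 R. \<forall>h. - C \<le> h \<bullet> D (h + z)"
proof -
  obtain S where S: "\<And>y. S \<le> norm y \<Longrightarrow> 0 \<le> \<gamma> y" using \<gamma>_nonneg by blast
  define K where "K = max 0 S + max 0 R"
  obtain B where B: "B \<ge> 0" "\<And>y. y \<in> cball 0 (K + max 0 R) \<Longrightarrow> norm (D y) \<le> B"
    using D_bounded[of "K + max 0 R"] by blast
  have K: "K \<ge> 0" by (simp add: K_def)
  have "- (K * B) \<le> h \<bullet> D (h + z)" if z: "z \<in> cball 0 R" for z h
  proof (cases "norm h \<le> K")
    case True
    then have "h + z \<in> cball 0 (K + max 0 R)" using z norm_triangle_ineq[of h z] by auto
    then have "norm h * norm (D (h + z)) \<le> K * B" using True B K by (intro mult_mono) auto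
    then show ?thesis using Cauchy_Schwarz_ineq2[of h "D (h + z)"] by (simp add: abs_le_iff)
  next
    case False
    have "norm h \<le> norm (h + z) + norm z" using norm_triangle_ineq4[of "h + z" z] by simp
    then have "S \<le> norm (h + z)" using False z by (simp add: K_def)
    then have g: "0 \<le> \<gamma> (h + z)" by (rule S)
    have "norm z \<le> norm h" using False z by (simp add: K_def)
    then have "norm h * norm z \<le> norm h * norm h" by (intro mult_left_mono) auto
    then have "- (h \<bullet> z) \<le> h \<bullet> h"
      using Cauchy_Schwarz_ineq2[of h z] by (simp add: abs_le_iff power2_eq_square[symmetric] power2_norm_eq_inner)
    then have "0 \<le> h \<bullet> (h + z)" by (simp add: inner_add_right)
    then have "0 \<le> h \<bullet> D (h + z)" using g by (simp add: D_radial)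
    then show ?thesis using K B mult_nonneg_nonneg[of K B] by linarith
  qed
  moreover have "K * B \<ge> 0" using K B by simp
  ultimately show ?thesis by blast
qed

text \<open>
  Symmetrising over the pairs turns the summand into \<open>\<gamma> (h k - h j) * |h k - h j|\<^sup>2 / 2\<close>.
\<close>

lemma interaction_sum_lower:
  fixes I :: "nat set"
  assumes C: "C \<ge> 0" "\<And>y. - C \<le> \<gamma> y" and I: "finite I"
  shows "- (2 * C * real (card I) * (\<Sum>k\<in>I. (norm (h k))\<^sup>2)) \<le> (\<Sum>k\<in>I. \<Sum>j\<in>I. h k \<bullet> D (h k - h j))"
proof -
  let ?S = "\<Sum>k\<in>I. \<Sum>j\<in>I. h k \<bullet> D (h k - h j)"
  have rev: "D (a - b) = - D (b - a)" for a b using D_minus[of "b - a"] by simp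
  have "(\<Sum>k\<in>I. \<Sum>j\<in>I. h j \<bullet> D (h k - h j)) = (\<Sum>j\<in>I. \<Sum>k\<in>I. h j \<bullet> D (h k - h j))"
    by (rule sum.swap)
  also have "\<dots> = - ?S" by (subst rev) (simp add: sum_negf)
  finally have sw: "(\<Sum>k\<in>I. \<Sum>j\<in>I. h j \<bullet> D (h k - h j)) = - ?S" .
  have "(\<Sum>k\<in>I. \<Sum>j\<in>I. - (2 * C) * ((norm (h k))\<^sup>2 + (norm (h j))\<^sup>2)) \<le> (\<Sum>k\<in>I. \<Sum>j\<in>I. (h k - h j) \<bullet> D (h k - h j))"
  proof (intro sum_mono)
    fix k j
    have "(norm (h k - h j))\<^sup>2 \<le> 2 * ((norm (h k))\<^sup>2 + (norm (h j))\<^sup>2)"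
      using zero_le_power2[of "norm (h k + h j)"] unfolding power2_norm_eq_inner
      by (simp add: inner_diff_left inner_diff_right inner_add_left inner_add_right inner_commute)
    then have "C * (norm (h k - h j))\<^sup>2 \<le> C * (2 * ((norm (h k))\<^sup>2 + (norm (h j))\<^sup>2))"
      using C by (intro mult_left_mono)
    moreover have "- C * (norm (h k - h j))\<^sup>2 \<le> \<gamma> (h k - h j) * (norm (h k - h j))\<^sup>2"
      by (intro mult_right_mono C) auto
    ultimately show "- (2 * C) * ((norm (h k))\<^sup>2 + (norm (h j))\<^sup>2) \<le> (h k - h j) \<bullet> D (h k - h j)"
      unfolding D_radial[of "h k - h j"] inner_scaleR_right power2_norm_eq_inner
      by (simp add: algebra_simps)
  qed
  also have "\<dots> = ?S - (\<Sum>k\<in>I. \<Sum>j\<in>I. h j \<bullet> D (h k - h j))"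
    by (simp add: inner_diff_left sum_subtractf)
  also have "\<dots> = 2 * ?S" unfolding sw by simp
  also have "(\<Sum>k\<in>I. \<Sum>j\<in>I. - (2 * C) * ((norm (h k))\<^sup>2 + (norm (h j))\<^sup>2))
      = - (2 * C) * (2 * (real (card I) * (\<Sum>k\<in>I. (norm (h k))\<^sup>2)))"
    unfolding sum_distrib_left[symmetric] sum.distrib by (simp add: sum_distrib_left[symmetric])
  finally show ?thesis by simp
qed

text \<open>
  The differential inequality behind the Gronwall argument for \<open>others_spread\<close>. The interaction among the
  other particles is nearly dissipative after symmetrisation, and the interaction with the first one carries a factor \<open>1/N\<close>, so
  that its total contribution is a constant: this is why the sum over the particles, not only the mean, stays bounded.
\<close>

lemma spread_rate:
  "\<exists>C\<ge>0. \<forall>N\<ge>1. \<forall>X p U. X 1 \<in> cball 0 R \<longrightarrow> p \<in> cball 0 R \<longrightarrow>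
     (\<Sum>k=2..N. 2 * ((X k - p) \<bullet> (U k + v p))) \<le> C * others_spread N X p + others_cost N X U + C"
proof -
  obtain l where l: "l \<ge> 0" "\<And>p h. p \<in> cball 0 R \<Longrightarrow> - l * (norm h)\<^sup>2 \<le> h \<bullet> (v (p + h) - v p)"
    using v_one_sided[of R] by blast
  obtain s where s: "s \<ge> 0" "\<And>z h. z \<in> cball 0 (2 * R) \<Longrightarrow> - s \<le> h \<bullet> D (h + z)"
    using D_shifted_lower[of "2 * R"] by blast
  obtain g where g: "g \<ge> 0" "\<And>y. - g \<le> \<gamma> y" using \<gamma>_lower by blast
  define C where "C = 1 + 2 * l + 4 * g + 2 * s"
  have "(\<Sum>k=2..N. 2 * ((X k - p) \<bullet> (U k + v p))) \<le> C * others_spread N X p + others_cost N X U + C"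
    if N: "N \<ge> 1" and X1: "X 1 \<in> cball 0 R" and p: "p \<in> cball 0 R" for N X p U
  proof -
    define n where "n = real N"
    have n: "n \<ge> 1" using N by (simp add: n_def)
    define h where "h k = X k - p" for k
    define r where "r k = U k + drift N X k" for k
    define Z where "Z = others_spread N X p"
    have Z: "Z = (\<Sum>k=2..N. (norm (h k))\<^sup>2)" "Z \<ge> 0" by (simp_all add: Z_def others_spread_def h_def sum_nonneg)
    have zz: "p - X 1 \<in> cball 0 (2 * R)" using X1 p norm_triangle_ineq4[of p "X 1"] by simp
    have Up: "U k + v p = r k - (v (p + h k) - v p) - (1 / n) *\<^sub>R D (h k + (p - X 1))
        - (1 / n) *\<^sub>R (\<Sum>j=2..N. D (h k - h j))" for k
      using sum_from_1[OF N, of "\<lambda>j. D (X k - X j)"]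
      by (simp add: r_def drift_def h_def n_def scaleR_add_right)
    have single: "2 * (h k \<bullet> (U k + v p)) \<le> (1 + 2 * l) * (norm (h k))\<^sup>2 + (norm (r k))\<^sup>2 + 2 / n * s
        - 2 / n * (\<Sum>j=2..N. h k \<bullet> D (h k - h j))" for k
    proof -
      have "2 * (h k \<bullet> (U k + v p)) = 2 * (h k \<bullet> r k) - 2 * (h k \<bullet> (v (p + h k) - v p))
         - 2 / n * (h k \<bullet> D (h k + (p - X 1))) - 2 / n * (\<Sum>j=2..N. h k \<bullet> D (h k - h j))"
        unfolding Up by (simp add: inner_diff_right inner_sum_right)
      moreover have "2 * (h k \<bullet> r k) \<le> (norm (h k))\<^sup>2 + (norm (r k))\<^sup>2"
        using zero_le_power2[of "norm (h k - r k)"] unfolding power2_norm_eq_inner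
        by (simp add: inner_diff_left inner_diff_right inner_commute)
      moreover have "- l * (norm (h k))\<^sup>2 \<le> h k \<bullet> (v (p + h k) - v p)" by (rule l(2)[OF p])
      moreover have "2 / n * - s \<le> 2 / n * (h k \<bullet> D (h k + (p - X 1)))"
        using n by (intro mult_left_mono s(2)[OF zz]) auto
      ultimately show ?thesis by (simp add: algebra_simps)
    qed
    have "(\<Sum>k=2..N. 2 * (h k \<bullet> (U k + v p))) \<le> (\<Sum>k=2..N. (1 + 2 * l) * (norm (h k))\<^sup>2 + (norm (r k))\<^sup>2 + 2 / n * s
        - 2 / n * (\<Sum>j=2..N. h k \<bullet> D (h k - h j)))"
      by (rule sum_mono) (rule single)
    also have "\<dots> = (1 + 2 * l) * Z + others_cost N X U + real (N - 1) * (2 / n * s)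
        - 2 / n * (\<Sum>k=2..N. \<Sum>j=2..N. h k \<bullet> D (h k - h j))"
      unfolding sum.distrib sum_subtractf sum_distrib_left[symmetric] Z(1) others_cost_def r_def by simp
    finally have f1: "(\<Sum>k=2..N. 2 * (h k \<bullet> (U k + v p))) \<le> (1 + 2 * l) * Z + others_cost N X U
        + real (N - 1) * (2 / n * s) - 2 / n * (\<Sum>k=2..N. \<Sum>j=2..N. h k \<bullet> D (h k - h j))" .
    have "real (N - 1) * (2 / n * s) \<le> n * (2 / n * s)"
      using n s by (intro mult_right_mono) (auto simp: n_def)
    also have "n * (2 / n * s) = 2 * s" using n by simp
    finally have f2: "real (N - 1) * (2 / n * s) \<le> 2 * s" .
    have f3: "- (2 / n * (\<Sum>k=2..N. \<Sum>j=2..N. h k \<bullet> D (h k - h j))) \<le> 4 * g * Z"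
    proof -
      have "real (card {2..N}) \<le> n" by (simp add: n_def)
      then have "real (card {2..N}) * (2 * g * Z) \<le> n * (2 * g * Z)"
        using g Z by (intro mult_right_mono) auto
      then have "- (n * (2 * g * Z)) \<le> (\<Sum>k=2..N. \<Sum>j=2..N. h k \<bullet> D (h k - h j))"
        using interaction_sum_lower[OF g, of "{2..N}" h] unfolding Z(1) by (simp add: mult_ac)
      then have "2 / n * - (n * (2 * g * Z)) \<le> 2 / n * (\<Sum>k=2..N. \<Sum>j=2..N. h k \<bullet> D (h k - h j))"
        using n by (intro mult_left_mono) auto
      moreover have "2 / n * - (n * (2 * g * Z)) = - (4 * g * Z)" using n by simp
      ultimately show ?thesis by linarith
    qed
    have "(\<Sum>k=2..N. 2 * (h k \<bullet> (U k + v p))) \<le> (1 + 2 * l + 4 * g) * Z + others_cost N X U + 2 * s"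
      using f1 f2 f3 unfolding distrib_right by linarith
    moreover have "(1 + 2 * l + 4 * g) * Z \<le> C * Z" using s Z by (intro mult_right_mono) (auto simp: C_def)
    moreover have "2 * s \<le> C" using l g by (simp add: C_def)
    ultimately show ?thesis by (simp add: h_def Z_def)
  qed
  moreover have "C \<ge> 0" using l g s by (simp add: C_def)
  ultimately show ?thesis by blast
qed

text \<open>
  In a fixed ball all forces are Lipschitz, so each term of the defect that is not nonnegative is controlled by the
  mean distance \<open>A\<close> to \<open>p\<close>, the mean residual \<open>B\<close> and a contribution of order \<open>1/N\<close> of the first particle;
  \<open>average_le_squares\<close> turns these into the stated rate.
\<close>

lemma defect_small:
  "\<exists>C\<ge>0. \<forall>N\<ge>1. \<forall>X p U. (\<forall>k\<in>{1..N}. X k \<in> cball 0 R) \<longrightarrow> p \<in> cball 0 R \<longrightarrow>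
     - C * (1 + others_spread N X p + others_cost N X U) / sqrt (real N) \<le> defect N X p U"
proof -
  obtain m1 where m1: "m1 \<ge> 0" "\<And>y. y \<in> cball 0 R \<Longrightarrow> norm (v y) \<le> m1" using v_bounded[of R] by blast
  obtain m2 where m2: "m2 \<ge> 0" "\<And>y. y \<in> cball 0 (2 * R) \<Longrightarrow> norm (D y) \<le> m2" using D_bounded[of "2 * R"] by blast
  obtain L1 where L1: "L1 \<ge> 0" "\<And>y z. y \<in> cball 0 R \<Longrightarrow> z \<in> cball 0 R \<Longrightarrow> norm (v y - v z) \<le> L1 * norm (y - z)"
    using v_Lipschitz[of R] by blast
  obtain L2 where L2: "L2 \<ge> 0" "\<And>y z. y \<in> cball 0 (2 * R) \<Longrightarrow> z \<in> cball 0 (2 * R) \<Longrightarrow> norm (D y - D z) \<le> L2 * norm (y - z)"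
    using D_Lipschitz[of "2 * R"] by blast
  define M where "M = m1 + m2"
  define L where "L = L1 + L2"
  have M: "M \<ge> 0" "\<And>y. y \<in> cball 0 R \<Longrightarrow> norm (v y) \<le> M" "\<And>y. y \<in> cball 0 (2 * R) \<Longrightarrow> norm (D y) \<le> M"
    using m1 m2 by (force simp: M_def)+
  have L: "L \<ge> 0" using L1 L2 by (simp add: L_def)
  have Lv: "norm (v y - v z) \<le> L * norm (y - z)" if "y \<in> cball 0 R" "z \<in> cball 0 R" for y z
    using L1(2)[OF that] mult_nonneg_nonneg[OF L2(1) norm_ge_zero[of "y - z"]] unfolding L_def distrib_right by linarith
  have LD: "norm (D y - D z) \<le> L * norm (y - z)" if "y \<in> cball 0 (2 * R)" "z \<in> cball 0 (2 * R)" for y z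
    using L2(2)[OF that] mult_nonneg_nonneg[OF L1(1) norm_ge_zero[of "y - z"]] unfolding L_def distrib_right by linarith
  define C where "C = 8 * M\<^sup>2 + 6 * (L * M) + M"
  have "- C * (1 + others_spread N X p + others_cost N X U) / sqrt (real N) \<le> defect N X p U"
    if N: "N \<ge> 1" and X: "\<And>k. k \<in> {1..N} \<Longrightarrow> X k \<in> cball 0 R" and p: "p \<in> cball 0 R" for N X p U
  proof -
    define n where "n = real N"
    have n: "n \<ge> 1" using N by (simp add: n_def)
    define h where "h k = X k - p" for k
    define r where "r k = U k + drift N X k" for k
    define e where "e = force_gap N X p"
    define A where "A = (\<Sum>k=2..N. norm (h k)) / n"
    define B where "B = (\<Sum>k=2..N. norm (r k)) / n"
    have dd: "y - z \<in> cball 0 (2 * R)" if "y \<in> cball 0 R" "z \<in> cball 0 R" for y z :: 'a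
      using that norm_triangle_ineq4[of y z] by simp
    have X1: "X 1 \<in> cball 0 R" using X N by simp
    have R0: "(0::'a) \<in> cball 0 (2 * R)" using dd[OF X1 X1] by simp
    have Dinf: "norm (D (p - X 1)) \<le> M" by (intro M dd p X1)
    have DX: "norm (D (X k - X 1) - D (p - X 1)) \<le> L * norm (h k)" if "k \<in> {1..N}" for k
      using LD[OF dd[OF X[OF that] X1] dd[OF p X1]] by (simp add: h_def)
    have A0: "A \<ge> 0" using n by (simp add: A_def sum_nonneg)
    have mean2: "(\<Sum>k=2..N. c * norm (h k)) / n = c * A" for c
      by (simp add: A_def sum_distrib_left)
    have e_le: "norm e \<le> M / n + L * A"
    proof -
      have "(\<Sum>k=1..N. D (X k - X 1) - D (p - X 1)) = (\<Sum>k=1..N. D (X k - X 1)) - n *\<^sub>R D (p - X 1)"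
        by (simp add: sum_subtractf n_def sum_constant_scaleR)
      then have "e = (1 / n) *\<^sub>R (\<Sum>k=1..N. D (X k - X 1) - D (p - X 1))"
        using n by (simp add: e_def force_gap_def n_def scaleR_diff_right)
      then have "norm e \<le> (\<Sum>k=1..N. norm (D (X k - X 1) - D (p - X 1))) / n"
        using n by (simp add: divide_right_mono norm_sum)
      also have "(\<Sum>k=1..N. norm (D (X k - X 1) - D (p - X 1)))
          = norm (D (p - X 1)) + (\<Sum>k=2..N. norm (D (X k - X 1) - D (p - X 1)))"
        using sum_from_1[OF N, of "\<lambda>k. norm (D (X k - X 1) - D (p - X 1))"] by (simp add: D_0)
      also have "\<dots> / n \<le> (M + (\<Sum>k=2..N. L * norm (h k))) / n"
        using n by (intro divide_right_mono add_mono Dinf sum_mono DX) auto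
      also have "\<dots> = M / n + L * A" by (simp add: add_divide_distrib mean2)
      finally show ?thesis .
    qed
    have Uk: "norm (U k + v p) \<le> norm (r k) + 2 * L * norm (h k) + M / n + L * A" if k: "k \<in> {2..N}" for k
    proof -
      have kk: "X k \<in> cball 0 R" using X k by simp
      have "norm ((1 / n) *\<^sub>R (\<Sum>j=1..N. D (X k - X j))) \<le> (\<Sum>j=1..N. norm (D (X k - X j))) / n"
        using n by (simp add: divide_right_mono norm_sum)
      also have "(\<Sum>j=1..N. norm (D (X k - X j))) = norm (D (X k - X 1)) + (\<Sum>j=2..N. norm (D (X k - X j)))"
        by (rule sum_from_1[OF N])
      also have "\<dots> / n \<le> (M + (\<Sum>j=2..N. L * norm (h k) + L * norm (h j))) / n"
      proof (intro divide_right_mono add_mono sum_mono)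
        show "norm (D (X k - X 1)) \<le> M" by (intro M dd kk X1)
        fix j assume j: "j \<in> {2..N}"
        have "norm (D (X k - X j) - D 0) \<le> L * norm (X k - X j - 0)"
          using j X by (intro LD dd kk R0) auto
        also have "\<dots> \<le> L * (norm (h k) + norm (h j))"
        proof -
          have "X k - X j = h k - h j" by (simp add: h_def)
          then show ?thesis using L norm_triangle_ineq4[of "h k" "h j"] by (simp add: mult_left_mono)
        qed
        finally show "norm (D (X k - X j)) \<le> L * norm (h k) + L * norm (h j)"
          by (simp add: D_0 distrib_left)
      qed (use n in auto)
      also have "\<dots> = M / n + real (N - 1) / n * (L * norm (h k)) + L * A"
        by (simp add: add_divide_distrib sum.distrib mean2)
      also have "\<dots> \<le> M / n + 1 * (L * norm (h k)) + L * A"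
        using n L by (intro add_right_mono add_left_mono mult_right_mono) (auto simp: n_def)
      finally have 1: "norm ((1 / n) *\<^sub>R (\<Sum>j=1..N. D (X k - X j))) \<le> M / n + L * norm (h k) + L * A" by simp
      have eq: "U k + v p = r k - (v (X k) - v p) - (1 / n) *\<^sub>R (\<Sum>j=1..N. D (X k - X j))"
        by (simp add: r_def drift_def n_def)
      have "norm (U k + v p) \<le> norm (r k) + norm (v (X k) - v p) + norm ((1 / n) *\<^sub>R (\<Sum>j=1..N. D (X k - X j)))"
        unfolding eq
        using norm_triangle_ineq4[of "r k - (v (X k) - v p)" "(1 / n) *\<^sub>R (\<Sum>j=1..N. D (X k - X j))"]
          norm_triangle_ineq4[of "r k" "v (X k) - v p"] by linarith
      moreover have "norm (v (X k) - v p) \<le> L * norm (h k)" using Lv[OF kk p] by (simp add: h_def)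
      ultimately show ?thesis using 1 by simp
    qed
    have ip: "x \<bullet> y \<le> a * b" if "norm x \<le> a" "norm y \<le> b" for x y :: 'a and a b
    proof -
      have "a \<ge> 0" using that(1) norm_ge_zero order_trans by blast
      then have "norm x * norm y \<le> a * b" using that by (intro mult_mono) auto
      then show ?thesis using norm_cauchy_schwarz[of x y] by linarith
    qed
    have qk: "D (X k - X 1) \<bullet> U k + D (p - X 1) \<bullet> v p
        \<le> M * (norm (r k) + 2 * L * norm (h k) + M / n + L * A) + L * norm (h k) * M" if k: "k \<in> {2..N}" for k
    proof -
      have k1: "k \<in> {1..N}" using k by simp
      have eq: "D (X k - X 1) \<bullet> U k + D (p - X 1) \<bullet> v p
          = D (X k - X 1) \<bullet> (U k + v p) + (- (D (X k - X 1) - D (p - X 1))) \<bullet> v p"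
        by (simp add: inner_add_right inner_diff_left)
      have "D (X k - X 1) \<bullet> (U k + v p) \<le> M * (norm (r k) + 2 * L * norm (h k) + M / n + L * A)"
        by (rule ip[OF _ Uk[OF k]]) (intro M dd X[OF k1] X1)
      moreover have "(- (D (X k - X 1) - D (p - X 1))) \<bullet> v p \<le> L * norm (h k) * M"
        by (rule ip) (use DX[OF k1] M(2)[OF p] in \<open>auto simp: norm_minus_commute\<close>)
      ultimately show ?thesis unfolding eq by linarith
    qed
    have "(\<Sum>k=1..N. D (X k - X 1) \<bullet> U k + D (p - X 1) \<bullet> v p)
       = D (p - X 1) \<bullet> v p + (\<Sum>k=2..N. D (X k - X 1) \<bullet> U k + D (p - X 1) \<bullet> v p)"
      using sum_from_1[OF N, of "\<lambda>k. D (X k - X 1) \<bullet> U k + D (p - X 1) \<bullet> v p"] by (simp add: D_0)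
    also have "\<dots> \<le> M * M + (\<Sum>k=2..N. M * (norm (r k) + 2 * L * norm (h k) + M / n + L * A) + L * norm (h k) * M)"
      by (intro add_mono sum_mono qk ip Dinf M p)
    also have "(\<Sum>k=2..N. M * (norm (r k) + 2 * L * norm (h k) + M / n + L * A) + L * norm (h k) * M)
       = M * (\<Sum>k=2..N. norm (r k)) + 3 * L * M * (\<Sum>k=2..N. norm (h k)) + real (N - 1) * (M * (M / n + L * A))"
      by (simp add: sum.distrib sum_distrib_left distrib_left mult_ac)
    also have "(\<Sum>k=2..N. norm (r k)) = n * B" using n by (simp add: B_def)
    also have "(\<Sum>k=2..N. norm (h k)) = n * A" using n by (simp add: A_def)
    also have "real (N - 1) * (M * (M / n + L * A)) \<le> n * (M * (M / n + L * A))"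
      using n M(1) L A0 by (intro mult_right_mono) (auto simp: n_def)
    also have "n * (M * (M / n + L * A)) = M * M + n * (L * M * A)" using n by (simp add: field_simps)
    finally have "(\<Sum>k=1..N. D (X k - X 1) \<bullet> U k) + n * (D (p - X 1) \<bullet> v p)
        \<le> 2 * (M * M) + n * (M * B + 4 * (L * M * A))"
      by (simp add: sum.distrib n_def algebra_simps)
    then have "2 / n * ((\<Sum>k=1..N. D (X k - X 1) \<bullet> U k) + n * (D (p - X 1) \<bullet> v p))
        \<le> 2 / n * (2 * (M * M) + n * (M * B + 4 * (L * M * A)))" using n by (intro mult_left_mono) auto
    then have q: "2 / n * (\<Sum>k=1..N. D (X k - X 1) \<bullet> U k) + 2 * (D (p - X 1) \<bullet> v p)
        \<le> 4 * (M * M) / n + 2 * (M * B) + 8 * (L * M * A)" using n by (simp add: distrib_left)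
    define b where "b = v (X 1) + D (X 1 - p)"
    have "norm b \<le> M + M"
      unfolding b_def by (intro norm_triangle_mono M X1 dd p)
    then have be: "b \<bullet> e \<le> (M + M) * (M / n + L * A)" by (rule ip[OF _ e_le])
    have R': "0 \<le> others_cost N X U" by (simp add: others_cost_def sum_nonneg)
    have Z': "0 \<le> others_spread N X p" by (simp add: others_spread_def sum_nonneg)
    have "defect N X p U = others_cost N X U + (norm e)\<^sup>2 - 2 * (b \<bullet> e) - 2 * (D (p - X 1) \<bullet> v p)
        - 2 / n * (\<Sum>k=1..N. D (X k - X 1) \<bullet> U k)"
      by (simp add: defect_def e_def b_def n_def)
    moreover have "(M + M) * (M / n + L * A) = 2 * (M * M / n) + 2 * (L * M * A)"
      by (simp add: algebra_simps)
    moreover have "4 * (M * M) / n = 4 * (M * M / n)" "8 * (M * M) / n = 8 * (M * M / n)"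
      "12 * (L * M) * A = 12 * (L * M * A)" "2 * M * B = 2 * (M * B)" by simp_all
    ultimately have lo: "- (8 * (M * M) / n + 12 * (L * M) * A + 2 * M * B) \<le> defect N X p U"
      using R' q be zero_le_power2[of "norm e"] by linarith
    define s where "s = sqrt n"
    have s: "s \<ge> 1" "n = s * s" using n by (simp_all add: s_def)
    have "1 / n \<le> 1 / s" using s by (intro divide_left_mono) auto
    then have "8 * (M * M) * (1 / n) \<le> 8 * (M * M) * (1 / s)" using M by (intro mult_left_mono) auto
    moreover have "A \<le> (others_spread N X p + 1) / (2 * s)"
      using average_le_squares[OF N, of "\<lambda>k. norm (h k)"] by (simp add: A_def others_spread_def h_def n_def s_def)
    then have "12 * (L * M) * A \<le> 12 * (L * M) * ((others_spread N X p + 1) / (2 * s))"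
      using L M by (intro mult_left_mono) auto
    moreover have "B \<le> (others_cost N X U + 1) / (2 * s)"
      using average_le_squares[OF N, of "\<lambda>k. norm (r k)"] by (simp add: B_def others_cost_def r_def n_def s_def)
    then have "2 * M * B \<le> 2 * M * ((others_cost N X U + 1) / (2 * s))"
      using M by (intro mult_left_mono) auto
    moreover have "12 * (L * M) * ((others_spread N X p + 1) / (2 * s)) = 6 * (L * M) * (others_spread N X p + 1) / s"
      "2 * M * ((others_cost N X U + 1) / (2 * s)) = M * (others_cost N X U + 1) / s"
      "8 * (M * M) * (1 / n) = 8 * (M * M) / n" "8 * (M * M) * (1 / s) = 8 * (M * M) / s" by simp_all
    ultimately have up: "8 * (M * M) / n + 12 * (L * M) * A + 2 * M * B
      \<le> (8 * (M * M) + 6 * (L * M) * (others_spread N X p + 1) + M * (others_cost N X U + 1)) / s"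
      unfolding add_divide_distrib by linarith
    also have "\<dots> \<le> C * (1 + others_spread N X p + others_cost N X U) / s"
    proof (rule divide_right_mono)
      have "0 \<le> 8 * M\<^sup>2 * (others_spread N X p + others_cost N X U) + 6 * (L * M) * others_cost N X U
          + M * others_spread N X p" using M L R' Z' by (intro add_nonneg_nonneg mult_nonneg_nonneg) auto
      then show "8 * (M * M) + 6 * (L * M) * (others_spread N X p + 1) + M * (others_cost N X U + 1)
         \<le> C * (1 + others_spread N X p + others_cost N X U)"
        by (simp add: C_def power2_eq_square algebra_simps)
    qed (use s in simp)
    finally show ?thesis using lo by (simp add: s_def n_def)
  qed
  moreover have "C \<ge> 0" using M L by (simp add: C_def)
  ultimately show ?thesis by blast
qed

definition boundary_value :: "nat \<Rightarrow> (nat \<Rightarrow> 'a) \<Rightarrow> 'a \<Rightarrow> real" where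
  "boundary_value N X p = F (p - X 1) - 1 / real N * (\<Sum>k=1..N. F (X k - X 1))"

lemma F_Lipschitz: "\<exists>L\<ge>0. \<forall>y\<in>cball 0 R. \<forall>z\<in>cball 0 R. norm (F y - F z) \<le> L * norm (y - z)"
proof -
  obtain M where M: "M \<ge> 0" "\<And>y. y \<in> cball 0 R \<Longrightarrow> norm (D y) \<le> M" using D_bounded[of R] by blast
  have "norm (F y - F z) \<le> M * norm (y - z)" if "y \<in> cball 0 R" "z \<in> cball 0 R" for y z
    using bounded_gradient_Lipschitz[OF F_deriv M(2) that] .
  then show ?thesis using M(1) by blast
qed

text \<open>
  The other particles enter with a favourable sign since \<open>F\<close> is nonnegative, so the bound is
  uniform in their positions.
\<close>

lemma boundary_value_bounded:
  "\<exists>C. \<forall>N X p. X 1 \<in> cball 0 R \<longrightarrow> p \<in> cball 0 R \<longrightarrow> boundary_value N X p \<le> C"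
proof -
  obtain M where M: "\<And>y. y \<in> cball 0 (2 * R) \<Longrightarrow> norm (F y) \<le> M"
    using locally_Lipschitz_bounded[OF F_Lipschitz, of "2 * R"] by blast
  have "boundary_value N X p \<le> M" if "X 1 \<in> cball 0 R" "p \<in> cball 0 R" for N X p
  proof -
    have "p - X 1 \<in> cball 0 (2 * R)" using that norm_triangle_ineq4[of p "X 1"] by simp
    then have "F (p - X 1) \<le> M" using M by (simp add: abs_le_iff)
    moreover have "0 \<le> (\<Sum>k=1..N. F (X k - X 1))" by (intro sum_nonneg F_nonneg)
    then have "0 \<le> 1 / real N * (\<Sum>k=1..N. F (X k - X 1))" by (intro mult_nonneg_nonneg) auto
    ultimately show ?thesis unfolding boundary_value_def by linarith
  qed
  then show ?thesis by blast
qed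

lemma boundary_value_small:
  "\<exists>C\<ge>0. \<forall>N\<ge>1. \<forall>X p. (\<forall>k\<in>{1..N}. X k \<in> cball 0 R) \<longrightarrow> p \<in> cball 0 R \<longrightarrow>
     boundary_value N X p \<le> C * (1 + others_spread N X p) / sqrt (real N)"
proof -
  obtain L where L: "L \<ge> 0" "\<And>y z. y \<in> cball 0 (2 * R) \<Longrightarrow> z \<in> cball 0 (2 * R) \<Longrightarrow> norm (F y - F z) \<le> L * norm (y - z)"
    using F_Lipschitz[of "2 * R"] by blast
  define C where "C = L * \<bar>2 * R\<bar> + L"
  have "boundary_value N X p \<le> C * (1 + others_spread N X p) / sqrt (real N)"
    if N: "N \<ge> 1" and X: "\<And>k. k \<in> {1..N} \<Longrightarrow> X k \<in> cball 0 R" and p: "p \<in> cball 0 R" for N X p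
  proof -
    define n where "n = real N"
    have n: "n \<ge> 1" using N by (simp add: n_def)
    have dd: "y - z \<in> cball 0 (2 * R)" if "y \<in> cball 0 R" "z \<in> cball 0 R" for y z :: 'a
      using that norm_triangle_ineq4[of y z] by simp
    have X1: "X 1 \<in> cball 0 R" using X N by simp
    have tk: "F (p - X 1) - F (X k - X 1) \<le> L * norm (X k - p)" if "k \<in> {1..N}" for k
      using L(2)[OF dd[OF p X1] dd[OF X[OF that] X1]] by (simp add: abs_le_iff norm_minus_commute)
    have t1: "F (p - X 1) - F (X 1 - X 1) \<le> L * \<bar>2 * R\<bar>"
    proof -
      have "F (p - X 1) - F 0 \<le> L * norm (p - X 1 - 0)"
        using L(2)[OF dd[OF p X1] , of 0] dd[OF X1 X1] by (simp add: abs_le_iff)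
      also have "\<dots> \<le> L * \<bar>2 * R\<bar>" using dd[OF p X1] L(1) by (intro mult_left_mono) auto
      finally show ?thesis by simp
    qed
    have "boundary_value N X p = (\<Sum>k=1..N. F (p - X 1) - F (X k - X 1)) / n"
      using n by (simp add: boundary_value_def sum_subtractf n_def diff_divide_distrib)
    also have "\<dots> = (F (p - X 1) - F (X 1 - X 1) + (\<Sum>k=2..N. F (p - X 1) - F (X k - X 1))) / n"
      by (subst sum_from_1[OF N]) simp
    also have "\<dots> \<le> (L * \<bar>2 * R\<bar> + (\<Sum>k=2..N. L * norm (X k - p))) / n"
      using n by (intro divide_right_mono add_mono t1 sum_mono tk) auto
    also have "\<dots> = L * \<bar>2 * R\<bar> * (1 / n) + L * ((\<Sum>k=2..N. norm (X k - p)) / real N)"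
      by (simp add: add_divide_distrib sum_distrib_left[symmetric] n_def)
    also have "\<dots> \<le> L * \<bar>2 * R\<bar> * ((1 + others_spread N X p) / sqrt n) + L * ((1 + others_spread N X p) / sqrt n)"
    proof (intro add_mono mult_left_mono)
      have Z: "0 \<le> others_spread N X p" by (simp add: others_spread_def sum_nonneg)
      have s: "sqrt n \<ge> 1" "n = sqrt n * sqrt n" using n by simp_all
      have "sqrt n * 1 \<le> sqrt n * sqrt n" using s(1) by (intro mult_left_mono) auto
      then have "sqrt n \<le> n" using s(2) by simp
      then have "1 / n \<le> 1 / sqrt n" using n by (intro divide_left_mono) auto
      also have "\<dots> \<le> (1 + others_spread N X p) / sqrt n" using Z s by (intro divide_right_mono) auto
      finally show "1 / n \<le> (1 + others_spread N X p) / sqrt n" .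
      have "(\<Sum>k=2..N. norm (X k - p)) / real N \<le> (others_spread N X p + 1) / (2 * sqrt (real N))"
        using average_le_squares[OF N, of "\<lambda>k. norm (X k - p)"] by (simp add: others_spread_def)
      also have "\<dots> \<le> (1 + others_spread N X p) / sqrt n"
        unfolding n_def[symmetric] using Z s by (intro frac_le) auto
      finally show "(\<Sum>k=2..N. norm (X k - p)) / real N \<le> (1 + others_spread N X p) / sqrt n" .
    qed (use L in auto)
    finally show ?thesis by (simp add: C_def n_def add_divide_distrib algebra_simps)
  qed
  moreover have "C \<ge> 0" using L by (simp add: C_def)
  ultimately show ?thesis by blast
qed

end

section \<open>Square-integrable functions and the Gronwall inequality\<close>

definition square_integrable :: "real \<Rightarrow> (real \<Rightarrow> 'a::euclidean_space) \<Rightarrow> bool" where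
  "square_integrable T g \<longleftrightarrow> g \<in> borel_measurable (lebesgue_on {0..T}) \<and>
     integrable (lebesgue_on {0..T}) (\<lambda>t. (norm (g t))\<^sup>2)"

lemma continuous_borel_measurable_lebesgue_on:
  fixes c :: "real \<Rightarrow> 'b::euclidean_space"
  assumes "continuous_on {0..T} c"
  shows "c \<in> borel_measurable (lebesgue_on {0..T})"
  by (rule continuous_imp_measurable_on_sets_lebesgue[OF assms]) simp

lemma continuous_integrable_lebesgue_on:
  fixes c :: "real \<Rightarrow> real"
  assumes "continuous_on {0..T} c"
  shows "integrable (lebesgue_on {0..T}) c"
  using absolutely_integrable_continuous_real[OF assms]
  by (simp add: integrable_restrict_space set_integrable_def)

lemma square_integrable_continuous:
  assumes "continuous_on {0..T} c"
  shows "square_integrable T c"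
  unfolding square_integrable_def
  by (intro conjI continuous_borel_measurable_lebesgue_on continuous_integrable_lebesgue_on
        continuous_intros assms)

lemma square_integrable_add:
  assumes "square_integrable T g" "square_integrable T h"
  shows "square_integrable T (\<lambda>t. g t + h t)"
  unfolding square_integrable_def
proof
  have m [measurable]: "g \<in> borel_measurable (lebesgue_on {0..T})" "h \<in> borel_measurable (lebesgue_on {0..T})"
    and i: "integrable (lebesgue_on {0..T}) (\<lambda>t. (norm (g t))\<^sup>2)" "integrable (lebesgue_on {0..T}) (\<lambda>t. (norm (h t))\<^sup>2)"
    using assms by (auto simp: square_integrable_def)
  show "(\<lambda>t. g t + h t) \<in> borel_measurable (lebesgue_on {0..T})" by measurable
  have "integrable (lebesgue_on {0..T}) (\<lambda>t. 2 * (norm (g t))\<^sup>2 + 2 * (norm (h t))\<^sup>2)" using i by simp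
  then show "integrable (lebesgue_on {0..T}) (\<lambda>t. (norm (g t + h t))\<^sup>2)"
  proof (rule Bochner_Integration.integrable_bound)
    show "(\<lambda>t. (norm (g t + h t))\<^sup>2) \<in> borel_measurable (lebesgue_on {0..T})" by measurable
    have "(norm (x + y))\<^sup>2 \<le> 2 * (norm x)\<^sup>2 + 2 * (norm y)\<^sup>2" for x y :: 'a
      using zero_le_power2[of "norm (x - y)"] unfolding power2_norm_eq_inner
      by (simp add: inner_diff_left inner_diff_right inner_add_left inner_add_right inner_commute)
    then show "AE t in lebesgue_on {0..T}. norm ((norm (g t + h t))\<^sup>2) \<le> norm (2 * (norm (g t))\<^sup>2 + 2 * (norm (h t))\<^sup>2)"
      by simp
  qed
qed

lemma square_integrable_minus:
  "square_integrable T g \<Longrightarrow> square_integrable T (\<lambda>t. - g t)"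
  by (simp add: square_integrable_def)

lemma square_integrable_add_continuous_iff:
  assumes c: "continuous_on {0..T} c"
  shows "square_integrable T (\<lambda>t. g t + c t) \<longleftrightarrow> square_integrable T g"
proof
  assume "square_integrable T (\<lambda>t. g t + c t)"
  from square_integrable_add[OF this square_integrable_minus[OF square_integrable_continuous[OF c]]]
  show "square_integrable T g" by simp
next
  assume "square_integrable T g"
  then show "square_integrable T (\<lambda>t. g t + c t)"
    by (rule square_integrable_add[OF _ square_integrable_continuous[OF c]])
qed

lemma square_integrable_inner:
  assumes "square_integrable T g" "square_integrable T h"
  shows "integrable (lebesgue_on {0..T}) (\<lambda>t. g t \<bullet> h t)"
proof -
  have m [measurable]: "g \<in> borel_measurable (lebesgue_on {0..T})" "h \<in> borel_measurable (lebesgue_on {0..T})"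
    and i: "integrable (lebesgue_on {0..T}) (\<lambda>t. (norm (g t))\<^sup>2)" "integrable (lebesgue_on {0..T}) (\<lambda>t. (norm (h t))\<^sup>2)"
    using assms by (auto simp: square_integrable_def)
  have "integrable (lebesgue_on {0..T}) (\<lambda>t. (norm (g t))\<^sup>2 + (norm (h t))\<^sup>2)" using i by simp
  then show ?thesis
  proof (rule Bochner_Integration.integrable_bound)
    show "(\<lambda>t. g t \<bullet> h t) \<in> borel_measurable (lebesgue_on {0..T})" by measurable
    have "\<bar>x \<bullet> y\<bar> \<le> (norm x)\<^sup>2 + (norm y)\<^sup>2" for x y :: 'a
    proof -
      have "2 * (norm x * norm y) \<le> (norm x)\<^sup>2 + (norm y)\<^sup>2"
        using zero_le_power2[of "norm x - norm y"] by (simp add: power2_eq_square algebra_simps)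
      moreover have "0 \<le> norm x * norm y" by simp
      ultimately show ?thesis using Cauchy_Schwarz_ineq2[of x y] by linarith
    qed
    then show "AE t in lebesgue_on {0..T}. norm (g t \<bullet> h t) \<le> norm ((norm (g t))\<^sup>2 + (norm (h t))\<^sup>2)"
      by simp
  qed
qed

lemma nn_integral_lebesgue_on:
  fixes f :: "real \<Rightarrow> ennreal"
  shows
  "(\<integral>\<^sup>+t\<in>{0..T}. f t \<partial>lborel) = (\<integral>\<^sup>+t. f t \<partial>lebesgue_on {0..T})"
  by (subst nn_integral_restrict_space) (auto simp: nn_integral_completion)

lemma nn_integral_square_integrable:
  assumes "square_integrable T g"
  shows "(\<integral>\<^sup>+t\<in>{0..T}. ennreal ((norm (g t))\<^sup>2) \<partial>lborel)
    = ennreal (\<integral>t. (norm (g t))\<^sup>2 \<partial>lebesgue_on {0..T})"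
  unfolding nn_integral_lebesgue_on using assms
  by (intro nn_integral_eq_integral) (auto simp: square_integrable_def)

lemma square_integrable_if_finite:
  assumes "g \<in> borel_measurable (lebesgue_on {0..T})"
    and "(\<integral>\<^sup>+t\<in>{0..T}. ennreal ((norm (g t))\<^sup>2) \<partial>lborel) < \<infinity>"
  shows "square_integrable T g"
  unfolding square_integrable_def
proof
  show "integrable (lebesgue_on {0..T}) (\<lambda>t. (norm (g t))\<^sup>2)"
    using assms unfolding nn_integral_lebesgue_on by (intro integrableI_nonneg) auto
qed (rule assms(1))

text \<open>
  The function \<open>exp (- C * s) * (A + C * integral {0..s} u)\<close> is nonincreasing.
\<close>

lemma Gronwall_integral:
  fixes u :: "real \<Rightarrow> real"
  assumes u: "continuous_on {0..T} u" and C: "C \<ge> 0" and T: "T \<ge> 0"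
    and le: "\<And>t. t \<in> {0..T} \<Longrightarrow> u t \<le> A + C * integral {0..t} u" and t: "t \<in> {0..T}" and A: "A \<ge> 0"
  shows "u t \<le> A * exp (C * T)"
proof -
  define w where "w s = - exp (- C * s) * (A + C * integral {0..s} u)" for s
  have "w 0 \<le> w t"
  proof (rule DERIV_nonneg_imp_increasing_open[of 0 t w])
    show "0 \<le> t" using t by simp
    show "continuous_on {0..t} w"
      unfolding w_def
      by (intro continuous_intros indefinite_integral_continuous_1 integrable_continuous_real
          continuous_on_subset[OF u]) (use t in auto)
    fix s assume s: "0 < s" "s < t"
    then have sT: "s \<in> {0..T}" using t by auto
    have "((\<lambda>r. integral {0..r} u) has_vector_derivative u s) (at s within {0..T})"
      by (rule integral_has_vector_derivative[OF u sT])
    moreover have "at s within {0..T} = at s"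
      using s t by (intro at_within_interior) (auto simp: interior_atLeastAtMost_real)
    ultimately have d: "DERIV (\<lambda>r. integral {0..r} u) s :> u s"
      by (simp add: has_real_derivative_iff_has_vector_derivative)
    have "DERIV w s :> C * exp (- C * s) * (A + C * integral {0..s} u) - exp (- C * s) * (C * u s)"
      unfolding w_def using d by (auto intro!: derivative_eq_intros simp: algebra_simps)
    moreover have "exp (- C * s) * (C * u s) \<le> exp (- C * s) * (C * (A + C * integral {0..s} u))"
      using le[OF sT] C by (intro mult_left_mono) auto
    ultimately show "\<exists>y. DERIV w s :> y \<and> y \<ge> 0" by (intro exI conjI) (auto simp: algebra_simps)
  qed
  then have "exp (- C * t) * (A + C * integral {0..t} u) \<le> A" by (simp add: w_def)
  then have "exp (C * t) * (exp (- C * t) * (A + C * integral {0..t} u)) \<le> exp (C * t) * A"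
    by (intro mult_left_mono) auto
  then have "A + C * integral {0..t} u \<le> exp (C * t) * A" by (simp add: mult.assoc[symmetric] exp_minus)
  also have "\<dots> \<le> exp (C * T) * A" using t C A by (intro mult_right_mono) (auto intro: mult_left_mono)
  finally show ?thesis using le[OF t] by (simp add: mult.commute)
qed

lemma measure_lebesgue_on_Icc: "0 \<le> T \<Longrightarrow> measure (lebesgue_on {0..T}) {0..T} = T" for T :: real
  by (simp add: measure_restrict_space)

section \<open>Comparison of the actions of paths\<close>

abbreviation velocity :: "real \<Rightarrow> (real \<Rightarrow> 'a::euclidean_space) \<Rightarrow> real \<Rightarrow> 'a" where
  "velocity T f t \<equiv> vector_derivative f (at t within {0..T})"

text \<open>
  A solution \<open>\<Psi>\<close> is a parameter; the comparison holds for every solution of the integral equation.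
\<close>

locale mean_field_paths = mean_field_potentials v D F \<gamma>
  for v D :: "'a::euclidean_space \<Rightarrow> 'a" and F \<gamma> +
  fixes T :: real and x :: 'a and \<Psi> :: "real \<Rightarrow> 'a"
  assumes T: "0 < T" and \<Psi>_cont: "continuous_on {0..T} \<Psi>"
    and \<Psi>_eq: "\<And>t. t \<in> {0..T} \<Longrightarrow> \<Psi> t = x - integral {0..t} (\<lambda>s. v (\<Psi> s))"
begin

lemma v_continuous: "continuous_on UNIV v"
  by (rule locally_Lipschitz_continuous[OF v_Lipschitz])

lemma D_continuous: "continuous_on UNIV D"
  by (rule locally_Lipschitz_continuous[OF D_Lipschitz])

lemma \<Psi>_0: "\<Psi> 0 = x"
  using \<Psi>_eq[of 0] T by simp

lemma \<Psi>_deriv: "t \<in> {0..T} \<Longrightarrow> (\<Psi> has_vector_derivative - v (\<Psi> t)) (at t within {0..T})"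
proof -
  assume t: "t \<in> {0..T}"
  have "continuous_on {0..T} (\<lambda>s. v (\<Psi> s))"
    by (rule continuous_on_compose2[OF v_continuous \<Psi>_cont]) simp
  from integral_has_vector_derivative[OF this t]
  have "((\<lambda>t. x - integral {0..t} (\<lambda>s. v (\<Psi> s))) has_vector_derivative 0 - v (\<Psi> t)) (at t within {0..T})"
    by (intro has_vector_derivative_diff has_vector_derivative_const)
  then show ?thesis
    using has_vector_derivative_transform[OF t \<Psi>_eq] by simp
qed

lemma \<Psi>_velocity: "t \<in> {0..T} \<Longrightarrow> velocity T \<Psi> t = - v (\<Psi> t)"
  by (rule vector_derivative_within_closed_interval[OF T _ \<Psi>_deriv])

lemma \<Psi>_abs_cont: "abs_cont_on_interval 0 T \<Psi>"
proof -
  have "continuous_on {0..T} (\<lambda>s. v (\<Psi> s))"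
    by (rule continuous_on_compose2[OF v_continuous \<Psi>_cont]) simp
  then obtain M where M: "\<And>s. s \<in> {0..T} \<Longrightarrow> norm (v (\<Psi> s)) \<le> M"
    using compact_continuous_bound[OF compact_Icc] by blast
  show ?thesis
  proof (rule abs_cont_Lipschitz[of 0 T \<Psi> M])
    fix s t :: real assume st: "0 \<le> s" "s \<le> t" "t \<le> T"
    have "norm (\<Psi> t - \<Psi> s) \<le> M * norm (t - s)"
    proof (rule differentiable_bound[OF convex_real_interval(5)])
      fix r assume r: "r \<in> {0..T}"
      show "(\<Psi> has_derivative (\<lambda>h. h *\<^sub>R - v (\<Psi> r))) (at r within {0..T})"
        using \<Psi>_deriv[OF r] by (simp add: has_vector_derivative_def)
      show "onorm (\<lambda>h. h *\<^sub>R - v (\<Psi> r)) \<le> M"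
      proof (rule onorm_le)
        fix h
        show "norm (h *\<^sub>R - v (\<Psi> r)) \<le> M * norm h"
          using mult_right_mono[OF M[OF r], of "norm h"] by (simp add: mult.commute)
      qed
    qed (use st in auto)
    then show "norm (\<Psi> t - \<Psi> s) \<le> M * (t - s)" using st by simp
  qed
qed

definition admissible :: "(real \<Rightarrow> 'a) \<Rightarrow> bool" where
  "admissible f \<longleftrightarrow> abs_cont_on_interval 0 T f \<and> f 0 = x"

text \<open>
  By the local boundedness of the drifts these are exactly the paths of finite cost.
\<close>

definition energy_path :: "(real \<Rightarrow> 'a) \<Rightarrow> bool" where
  "energy_path f \<longleftrightarrow> admissible f \<and> square_integrable T (velocity T f)"

lemma admissible_continuous: "admissible f \<Longrightarrow> continuous_on {0..T} f"
  unfolding admissible_def by (blast intro: abs_cont_imp_continuous)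

lemma admissible_v_continuous: "admissible f \<Longrightarrow> continuous_on {0..T} (\<lambda>t. v (f t))"
  by (rule continuous_on_compose2[OF v_continuous admissible_continuous]) auto

lemma admissible_D_continuous: "admissible f \<Longrightarrow> admissible g \<Longrightarrow> continuous_on {0..T} (\<lambda>t. D (f t - g t))"
  by (rule continuous_on_compose2[OF D_continuous continuous_on_diff[OF admissible_continuous admissible_continuous]]) auto

lemma energy_path_\<Psi>: "energy_path \<Psi>"
proof -
  have c: "continuous_on {0..T} (\<lambda>t. - v (\<Psi> t))"
    by (intro continuous_on_minus continuous_on_compose2[OF v_continuous \<Psi>_cont]) simp
  have "continuous_on {0..T} (velocity T \<Psi>)"
    by (rule continuous_on_eq[OF c]) (simp add: \<Psi>_velocity)
  then show ?thesis
    by (simp add: energy_path_def admissible_def \<Psi>_abs_cont \<Psi>_0 square_integrable_continuous)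
qed

text \<open>
  The upper endpoint \<open>r\<close> is arbitrary, for the Gronwall argument, while the velocities are those on
  \<open>{0..T}\<close>.
\<close>

lemma difference_chain_rule:
  assumes f: "admissible f" and g: "admissible g" and r: "r \<in> {0..T}"
    and \<phi>: "\<And>y. (\<phi> has_derivative (\<lambda>h. D' y \<bullet> h)) (at y)" and D': "continuous_on UNIV D'"
  shows "((\<lambda>t. D' (f t - g t) \<bullet> (velocity T f t - velocity T g t)) has_integral
     (\<phi> (f r - g r) - \<phi> 0)) {0..r}"
proof -
  obtain N1 N2 where N: "negligible N1" "negligible N2"
    "\<forall>t\<in>{0..T} - N1. (f has_vector_derivative velocity T f t) (at t within {0..T})"
    "\<forall>t\<in>{0..T} - N2. (g has_vector_derivative velocity T g t) (at t within {0..T})"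
    using abs_cont_vector_derivative_ae f g unfolding admissible_def by meson
  have "((\<lambda>t. D' (f t - g t) \<bullet> (velocity T f t - velocity T g t)) has_integral
     (\<phi> (f r - g r) - \<phi> (f 0 - g 0))) {0..r}"
  proof (rule abs_cont_chain_rule[where u="\<lambda>t. f t - g t" and N="N1 \<union> N2"])
    show "abs_cont_on_interval 0 r (\<lambda>t. f t - g t)"
      using f g r unfolding admissible_def by (intro abs_cont_subinterval[OF abs_cont_diff]) auto
    fix t assume t: "t \<in> {0..r} - (N1 \<union> N2)"
    then have "((\<lambda>t. f t - g t) has_vector_derivative velocity T f t - velocity T g t) (at t within {0..T})"
      using N(3,4) r by (intro has_vector_derivative_diff) auto
    then show "((\<lambda>t. f t - g t) has_vector_derivative velocity T f t - velocity T g t) (at t within {0..r})"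
      by (rule has_vector_derivative_within_subset) (use r in auto)
  qed (use N r \<phi> D' in \<open>auto intro: negligible_Un\<close>)
  then show ?thesis using f g by (simp add: admissible_def)
qed

text \<open>
  Up to the factor 4, the functionals \<open>J\<^sub>\<infinity>\<close> and, below, \<open>I\<^sup>N\<close>, as real numbers on paths of finite
  energy.
\<close>

definition limit_action :: "(real \<Rightarrow> 'a) \<Rightarrow> real" where
  "limit_action f = (\<integral>t. (norm (velocity T f t + v (f t) + D (f t - \<Psi> t)))\<^sup>2 \<partial>lebesgue_on {0..T})"

definition particle_action :: "nat \<Rightarrow> (nat \<Rightarrow> real \<Rightarrow> 'a) \<Rightarrow> real" where
  "particle_action N fs = (\<Sum>i=1..N. \<integral>t. (norm (velocity T (fs i) t + drift N (\<lambda>k. fs k t) i))\<^sup>2 \<partial>lebesgue_on {0..T})"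

lemma drift_continuous:
  assumes "\<And>k. k \<in> {1..N} \<Longrightarrow> admissible (fs k)" "i \<in> {1..N}"
  shows "continuous_on {0..T} (\<lambda>t. drift N (\<lambda>k. fs k t) i)"
  unfolding drift_def
  by (intro continuous_on_add continuous_on_scaleR continuous_on_const continuous_on_sum
      admissible_v_continuous admissible_D_continuous assms)

lemma boundary_rate_integral:
  assumes fs: "\<And>k. k \<in> {1..N} \<Longrightarrow> energy_path (fs k)" and N: "N \<ge> 1"
  shows "integrable (lebesgue_on {0..T}) (\<lambda>t. boundary_rate N (\<lambda>k. fs k t) (\<Psi> t) (\<lambda>k. velocity T (fs k) t))"
    and "(\<integral>t. boundary_rate N (\<lambda>k. fs k t) (\<Psi> t) (\<lambda>k. velocity T (fs k) t) \<partial>lebesgue_on {0..T})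
       = boundary_value N (\<lambda>k. fs k T) (\<Psi> T)"
proof -
  let ?b = "\<lambda>t. boundary_rate N (\<lambda>k. fs k t) (\<Psi> t) (\<lambda>k. velocity T (fs k) t)"
  have p: "admissible (fs k)" "square_integrable T (velocity T (fs k))" if "k \<in> {1..N}" for k
    using fs[OF that] by (auto simp: energy_path_def)
  have p1: "admissible (fs 1)" "square_integrable T (velocity T (fs 1))" using p N by auto
  have pP: "admissible \<Psi>" using energy_path_\<Psi> by (simp add: energy_path_def)
  have TT: "T \<in> {0..T}" using T by simp
  have sd: "square_integrable T (\<lambda>t. g t - h t)" if "square_integrable T g" "square_integrable T h" for g h :: "real \<Rightarrow> 'a"
    using square_integrable_add[OF that(1) square_integrable_minus[OF that(2)]] by simp
  have cv: "continuous_on {0..T} (\<lambda>t. - v (\<Psi> t))"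
    by (intro continuous_on_minus continuous_on_compose2[OF v_continuous \<Psi>_cont]) simp
  show int: "integrable (lebesgue_on {0..T}) ?b"
    unfolding boundary_rate_def
    by (intro Bochner_Integration.integrable_diff Bochner_Integration.integrable_mult_right
        Bochner_Integration.integrable_sum square_integrable_inner sd p p1
        square_integrable_continuous admissible_D_continuous pP cv) auto
  have h1: "((\<lambda>t. D (\<Psi> t - fs 1 t) \<bullet> (velocity T \<Psi> t - velocity T (fs 1) t)) has_integral
     (F (\<Psi> T - fs 1 T) - F 0)) {0..T}"
    by (rule difference_chain_rule[OF pP p1(1) TT F_deriv D_continuous])
  have h2: "((\<lambda>t. D (fs k t - fs 1 t) \<bullet> (velocity T (fs k) t - velocity T (fs 1) t)) has_integral
     (F (fs k T - fs 1 T) - F 0)) {0..T}" if "k \<in> {1..N}" for k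
    by (rule difference_chain_rule[OF p(1)[OF that] p1(1) TT F_deriv D_continuous])
  have "((\<lambda>t. D (\<Psi> t - fs 1 t) \<bullet> (velocity T \<Psi> t - velocity T (fs 1) t)
      - 1 / real N * (\<Sum>k=1..N. D (fs k t - fs 1 t) \<bullet> (velocity T (fs k) t - velocity T (fs 1) t)))
     has_integral ((F (\<Psi> T - fs 1 T) - F 0) - 1 / real N * (\<Sum>k=1..N. F (fs k T - fs 1 T) - F 0))) {0..T}"
    by (intro has_integral_diff h1 has_integral_mult_right has_integral_sum h2) auto
  then have "(?b has_integral boundary_value N (\<lambda>k. fs k T) (\<Psi> T)) {0..T}"
    by (rule has_integral_eq[rotated, THEN iffD1[OF arg_cong[of _ _ "\<lambda>I. (?b has_integral I) {0..T}"], rotated]])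
       (auto simp: boundary_rate_def boundary_value_def F_0 \<Psi>_velocity)
  then show "(\<integral>t. ?b t \<partial>lebesgue_on {0..T}) = boundary_value N (\<lambda>k. fs k T) (\<Psi> T)"
    using lebesgue_integral_eq_integral[OF int] by (simp add: integral_unique)
qed

lemma others_cost_integrable:
  assumes fs: "\<And>k. k \<in> {1..N} \<Longrightarrow> energy_path (fs k)"
  shows "integrable (lebesgue_on {0..T}) (\<lambda>t. others_cost N (\<lambda>k. fs k t) (\<lambda>k. velocity T (fs k) t))"
proof -
  have p: "admissible (fs k)" "square_integrable T (velocity T (fs k))" if "k \<in> {1..N}" for k
    using fs[OF that] by (auto simp: energy_path_def)
  have "square_integrable T (\<lambda>t. velocity T (fs k) t + drift N (\<lambda>k. fs k t) k)" if "k \<in> {1..N}" for k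
    by (intro square_integrable_add p that square_integrable_continuous drift_continuous)
  then show ?thesis
    unfolding others_cost_def by (intro Bochner_Integration.integrable_sum) (auto simp: square_integrable_def)
qed

lemma action_difference:
  assumes fs: "\<And>k. k \<in> {1..N} \<Longrightarrow> energy_path (fs k)" and N: "N \<ge> 1"
  shows "integrable (lebesgue_on {0..T}) (\<lambda>t. defect N (\<lambda>k. fs k t) (\<Psi> t) (\<lambda>k. velocity T (fs k) t))"
    and "particle_action N fs - limit_action (fs 1)
      = (\<integral>t. defect N (\<lambda>k. fs k t) (\<Psi> t) (\<lambda>k. velocity T (fs k) t) \<partial>lebesgue_on {0..T})
        - 2 * boundary_value N (\<lambda>k. fs k T) (\<Psi> T)"
proof -
  let ?M = "lebesgue_on {0..T}"
  let ?b = "\<lambda>t. boundary_rate N (\<lambda>k. fs k t) (\<Psi> t) (\<lambda>k. velocity T (fs k) t)"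
  let ?d = "\<lambda>t. defect N (\<lambda>k. fs k t) (\<Psi> t) (\<lambda>k. velocity T (fs k) t)"
  let ?s = "\<lambda>i t. (norm (velocity T (fs i) t + drift N (\<lambda>k. fs k t) i))\<^sup>2"
  let ?a = "\<lambda>t. (norm (velocity T (fs 1) t + v (fs 1 t) + D (fs 1 t - \<Psi> t)))\<^sup>2"
  have p: "admissible (fs k)" "square_integrable T (velocity T (fs k))" if "k \<in> {1..N}" for k
    using fs[OF that] by (auto simp: energy_path_def)
  have p1: "admissible (fs 1)" "square_integrable T (velocity T (fs 1))" using p N by auto
  have isq: "integrable ?M (?s i)" if "i \<in> {1..N}" for i
    using square_integrable_add[OF p(2)[OF that] square_integrable_continuous[OF drift_continuous[OF p(1) that]]]
    by (simp add: square_integrable_def)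
  have pP: "admissible \<Psi>" using energy_path_\<Psi> by (simp add: energy_path_def)
  have "square_integrable T (\<lambda>t. velocity T (fs 1) t + v (fs 1 t) + D (fs 1 t - \<Psi> t))"
    by (intro square_integrable_add p1 square_integrable_continuous admissible_v_continuous admissible_D_continuous pP)
  then have ia: "integrable ?M ?a" by (simp add: square_integrable_def)
  have ib: "integrable ?M ?b" "(\<integral>t. ?b t \<partial>?M) = boundary_value N (\<lambda>k. fs k T) (\<Psi> T)"
    using boundary_rate_integral[of N fs] fs N by auto
  have pt: "?d t = (\<Sum>i=1..N. ?s i t) - ?a t + 2 * ?b t" for t
    using cost_difference[OF N, of "\<lambda>k. velocity T (fs k) t" "\<lambda>k. fs k t" "\<Psi> t"] by simp
  show "integrable ?M ?d"
    unfolding pt by (intro Bochner_Integration.integrable_add Bochner_Integration.integrable_diff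
        Bochner_Integration.integrable_sum Bochner_Integration.integrable_mult_right isq ia ib(1))
  have iS: "integrable ?M (\<lambda>t. \<Sum>i=1..N. ?s i t)" by (intro Bochner_Integration.integrable_sum isq)
  have i2: "integrable ?M (\<lambda>t. 2 * ?b t)" by (intro Bochner_Integration.integrable_mult_right ib(1))
  have "(\<integral>t. ?d t \<partial>?M) = (\<integral>t. (\<Sum>i=1..N. ?s i t) \<partial>?M) - (\<integral>t. ?a t \<partial>?M) + (\<integral>t. 2 * ?b t \<partial>?M)"
    unfolding pt Bochner_Integration.integral_add[OF Bochner_Integration.integrable_diff[OF iS ia] i2]
      Bochner_Integration.integral_diff[OF iS ia] ..
  also have "(\<integral>t. (\<Sum>i=1..N. ?s i t) \<partial>?M) = (\<Sum>i=1..N. \<integral>t. ?s i t \<partial>?M)"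
    by (rule Bochner_Integration.integral_sum) (rule isq)
  finally show "particle_action N fs - limit_action (fs 1) = (\<integral>t. ?d t \<partial>?M) - 2 * boundary_value N (\<lambda>k. fs k T) (\<Psi> T)"
    by (simp add: particle_action_def limit_action_def ib(2))
qed

lemma \<Psi>_bounded: "\<exists>R\<ge>0. \<forall>t\<in>{0..T}. norm (\<Psi> t) \<le> R"
  by (rule compact_continuous_bound[OF compact_Icc \<Psi>_cont])

text \<open>
  Integrate \<open>rate\<close> along the paths: all particles start at \<open>x\<close> like \<open>\<Psi>\<close>, so that the spread is initially
  zero.
\<close>

lemma spread_Gronwall:
  assumes fs: "\<And>k. k \<in> {1..N} \<Longrightarrow> energy_path (fs k)" and N: "N \<ge> 1"
    and C: "C \<ge> 0"
    and rate: "\<And>t. t \<in> {0..T} \<Longrightarrow> (\<Sum>k=2..N. 2 * ((fs k t - \<Psi> t) \<bullet> (velocity T (fs k) t + v (\<Psi> t))))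
        \<le> C * others_spread N (\<lambda>k. fs k t) (\<Psi> t) + others_cost N (\<lambda>k. fs k t) (\<lambda>k. velocity T (fs k) t) + C"
    and B: "(\<integral>t. others_cost N (\<lambda>k. fs k t) (\<lambda>k. velocity T (fs k) t) \<partial>lebesgue_on {0..T}) \<le> B"
    and r: "r \<in> {0..T}"
  shows "others_spread N (\<lambda>k. fs k r) (\<Psi> r) \<le> (B + C * T) * exp (C * T)"
proof -
  define Z where "Z t = others_spread N (\<lambda>k. fs k t) (\<Psi> t)" for t
  define oc where "oc t = others_cost N (\<lambda>k. fs k t) (\<lambda>k. velocity T (fs k) t)" for t
  have oc0: "0 \<le> oc t" for t by (simp add: oc_def others_cost_def sum_nonneg)
  have p: "admissible (fs k)" if "k \<in> {1..N}" for k using fs[OF that] by (simp add: energy_path_def)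
  have pP: "admissible \<Psi>" using energy_path_\<Psi> by (simp add: energy_path_def)
  have Zc: "continuous_on {0..T} Z"
    unfolding Z_def others_spread_def
    by (intro continuous_on_sum continuous_on_power continuous_on_norm continuous_on_diff admissible_continuous pP p) auto
  have oci: "integrable (lebesgue_on {0..T}) oc"
    unfolding oc_def by (rule others_cost_integrable) (rule fs)
  have och: "(oc has_integral (\<integral>t. oc t \<partial>lebesgue_on {0..T})) {0..T}"
    by (rule has_integral_integral_lebesgue_on[OF oci]) simp
  then have ocT: "oc integrable_on {0..T}" "integral {0..T} oc \<le> B"
    using B by (auto simp: oc_def[abs_def] integral_unique has_integral_integrable)
  have B0: "B \<ge> 0" using ocT oc0 integral_nonneg[OF ocT(1)] by fastforce
  have "Z t \<le> (B + C * T) + C * integral {0..t} Z" if t: "t \<in> {0..T}" for t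
  proof -
    have sub: "{0..t} \<subseteq> {0..T}" using t by auto
    have "((\<lambda>s. (2 *\<^sub>R (fs k s - \<Psi> s)) \<bullet> (velocity T (fs k) s - velocity T \<Psi> s)) has_integral
       ((fs k t - \<Psi> t) \<bullet> (fs k t - \<Psi> t) - (0::'a) \<bullet> 0)) {0..t}" if "k \<in> {2..N}" for k
    proof (rule difference_chain_rule[OF p pP t])
      show "((\<lambda>y. y \<bullet> y) has_derivative (\<lambda>h. (2 *\<^sub>R y) \<bullet> h)) (at y)" for y :: 'a
        by (auto intro!: derivative_eq_intros simp: inner_commute)
    qed (use that in \<open>auto intro!: continuous_intros\<close>)
    then have "((\<lambda>s. \<Sum>k=2..N. (2 *\<^sub>R (fs k s - \<Psi> s)) \<bullet> (velocity T (fs k) s - velocity T \<Psi> s)) has_integral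
       (\<Sum>k=2..N. (fs k t - \<Psi> t) \<bullet> (fs k t - \<Psi> t) - (0::'a) \<bullet> 0)) {0..t}"
      by (intro has_integral_sum) auto
    moreover have "(\<Sum>k=2..N. (fs k t - \<Psi> t) \<bullet> (fs k t - \<Psi> t) - (0::'a) \<bullet> 0) = Z t"
      by (simp add: Z_def others_spread_def power2_norm_eq_inner)
    ultimately have h1: "((\<lambda>s. \<Sum>k=2..N. (2 *\<^sub>R (fs k s - \<Psi> s)) \<bullet> (velocity T (fs k) s - velocity T \<Psi> s)) has_integral Z t) {0..t}"
      by simp
    have Zi: "Z integrable_on {0..t}"
      by (intro integrable_continuous_real continuous_on_subset[OF Zc] sub)
    have oi: "oc integrable_on {0..t}" by (rule integrable_on_subinterval[OF ocT(1) sub])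
    have "((\<lambda>s. C * Z s + oc s + C) has_integral (C * integral {0..t} Z + integral {0..t} oc + C * t)) {0..t}"
      using has_integral_const_real[of C 0 t] t
      by (intro has_integral_add has_integral_mult_right integrable_integral Zi oi) (auto simp: mult.commute)
    from has_integral_le[OF h1 this] have "Z t \<le> C * integral {0..t} Z + integral {0..t} oc + C * t"
      using rate sub by (auto simp: Z_def oc_def \<Psi>_velocity)
    moreover have "integral {0..t} oc \<le> integral {0..T} oc"
      by (rule integral_subset_le[OF sub oi ocT(1)]) (simp add: oc0)
    moreover have "C * t \<le> C * T" using t C by (intro mult_left_mono) auto
    ultimately show ?thesis using ocT(2) by linarith
  qed
  then have "Z r \<le> (B + C * T) * exp (C * T)"
    using T B0 C by (intro Gronwall_integral[OF Zc C _ _ r]) auto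
  then show ?thesis by (simp add: Z_def)
qed

text \<open>
  If the claim fails then the particles are cheaper than the limit, and \<open>defect_coercive\<close> bounds the cost of the other
  particles by a constant \<open>B\<close> that depends on \<open>R\<close> only. Then the spread is bounded, all particles stay in one ball, and the
  fine estimates of that ball apply.
\<close>

lemma action_lower_bound:
  "\<exists>K\<ge>0. \<exists>N1. \<forall>N\<ge>N1. \<forall>fs. (\<forall>k\<in>{1..N}. energy_path (fs k)) \<longrightarrow>
     (\<forall>t\<in>{0..T}. fs 1 t \<in> cball 0 R) \<longrightarrow>
     limit_action (fs 1) \<le> particle_action N fs + K / sqrt (real N)"
proof -
  obtain Rp where Rp: "\<And>t. t \<in> {0..T} \<Longrightarrow> norm (\<Psi> t) \<le> Rp" using \<Psi>_bounded by blast
  define R0 where "R0 = max R Rp"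
  have PR0: "\<Psi> t \<in> cball 0 R0" if "t \<in> {0..T}" for t using Rp[OF that] by (simp add: R0_def)
  obtain C1 N1 where C1: "\<And>N X p U. N \<ge> N1 \<Longrightarrow> X 1 \<in> cball 0 R0 \<Longrightarrow> p \<in> cball 0 R0 \<Longrightarrow>
      others_cost N X U / 2 - C1 \<le> defect N X p U"
    using defect_coercive[of R0] by blast
  obtain Cb where Cb: "\<And>N X p. X 1 \<in> cball 0 R0 \<Longrightarrow> p \<in> cball 0 R0 \<Longrightarrow> boundary_value N X p \<le> Cb"
    using boundary_value_bounded[of R0] by blast
  define B where "B = \<bar>2 * (C1 * T + 2 * Cb)\<bar>"
  obtain C where C: "C \<ge> 0" "\<And>N X p U. N \<ge> 1 \<Longrightarrow> X 1 \<in> cball 0 R0 \<Longrightarrow> p \<in> cball 0 R0 \<Longrightarrow>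
     (\<Sum>k=2..N. 2 * ((X k - p) \<bullet> (U k + v p))) \<le> C * others_spread N X p + others_cost N X U + C"
    using spread_rate[of R0] by blast
  define C3 where "C3 = (B + C * T) * exp (C * T)"
  have B0: "B \<ge> 0" by (simp add: B_def)
  have C30: "C3 \<ge> 0" using B0 C T by (simp add: C3_def)
  \<comment> \<open>Each single distance to \<open>\<Psi>\<close> is at most the root of the total spread.\<close>
  define R2 where "R2 = R0 + sqrt C3"
  obtain Cd where Cd: "Cd \<ge> 0" "\<And>N X p U. N \<ge> 1 \<Longrightarrow> (\<forall>k\<in>{1..N}. X k \<in> cball 0 R2) \<Longrightarrow> p \<in> cball 0 R2 \<Longrightarrow>
     - Cd * (1 + others_spread N X p + others_cost N X U) / sqrt (real N) \<le> defect N X p U"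
    using defect_small[of R2] by blast
  obtain Ce where Ce: "Ce \<ge> 0" "\<And>N X p. N \<ge> 1 \<Longrightarrow> (\<forall>k\<in>{1..N}. X k \<in> cball 0 R2) \<Longrightarrow> p \<in> cball 0 R2 \<Longrightarrow>
     boundary_value N X p \<le> Ce * (1 + others_spread N X p) / sqrt (real N)"
    using boundary_value_small[of R2] by blast
  define K where "K = Cd * ((1 + C3) * T + B) + 2 * (Ce * (1 + C3))"
  have K0: "K \<ge> 0" using Cd Ce C30 B0 T by (simp add: K_def)
  have "limit_action (fs 1) \<le> particle_action N fs + K / sqrt (real N)"
    if NN: "N \<ge> max N1 1" and fs: "\<And>k. k \<in> {1..N} \<Longrightarrow> energy_path (fs k)"
      and f1: "\<And>t. t \<in> {0..T} \<Longrightarrow> fs 1 t \<in> cball 0 R" for N fs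
  proof (cases "limit_action (fs 1) \<le> particle_action N fs")
    case True
    moreover have "0 \<le> K / sqrt (real N)" using K0 by simp
    ultimately show ?thesis by linarith
  next
    case False
    let ?M = "lebesgue_on {0..T}"
    have N: "N \<ge> 1" "N \<ge> N1" using NN by auto
    define s where "s = sqrt (real N)"
    have s: "s > 0" using N by (simp add: s_def)
    define d where "d t = defect N (\<lambda>k. fs k t) (\<Psi> t) (\<lambda>k. velocity T (fs k) t)" for t
    define oc where "oc t = others_cost N (\<lambda>k. fs k t) (\<lambda>k. velocity T (fs k) t)" for t
    define Z where "Z t = others_spread N (\<lambda>k. fs k t) (\<Psi> t)" for t
    define b where "b = boundary_value N (\<lambda>k. fs k T) (\<Psi> T)"
    have TT: "T \<in> {0..T}" using T by simp
    have f1R: "fs 1 t \<in> cball 0 R0" if "t \<in> {0..T}" for t using f1[OF that] by (simp add: R0_def)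
    have di: "integrable ?M d" unfolding d_def by (rule action_difference(1)[OF fs N(1)])
    have oi: "integrable ?M oc" unfolding oc_def by (rule others_cost_integrable) (rule fs)
    have diff: "particle_action N fs - limit_action (fs 1) = (\<integral>t. d t \<partial>?M) - 2 * b"
      unfolding d_def b_def by (rule action_difference(2)[OF fs N(1)])
    have ci: "integrable ?M (\<lambda>t. c)" for c :: real by (intro continuous_integrable_lebesgue_on continuous_intros)
    have "(\<integral>t. oc t / 2 - C1 \<partial>?M) \<le> (\<integral>t. d t \<partial>?M)"
    proof (rule integral_mono)
      show "oc t / 2 - C1 \<le> d t" if "t \<in> space ?M" for t
        unfolding oc_def d_def using that by (intro C1 N f1R PR0) auto
    qed (use di oi ci in auto)
    moreover have "(\<integral>t. oc t / 2 - C1 \<partial>?M) = (\<integral>t. oc t \<partial>?M) / 2 - C1 * T"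
      using oi ci T by (simp add: measure_lebesgue_on_Icc)
    moreover have "b \<le> Cb" unfolding b_def by (intro Cb f1R PR0 TT)
    ultimately have oB: "(\<integral>t. oc t \<partial>?M) \<le> B" using diff False by (simp add: B_def)
    have rate: "(\<Sum>k=2..N. 2 * ((fs k t - \<Psi> t) \<bullet> (velocity T (fs k) t + v (\<Psi> t))))
        \<le> C * others_spread N (\<lambda>k. fs k t) (\<Psi> t) + others_cost N (\<lambda>k. fs k t) (\<lambda>k. velocity T (fs k) t) + C"
      if t: "t \<in> {0..T}" for t
      using C(2)[of N "\<lambda>k. fs k t" "\<Psi> t" "\<lambda>k. velocity T (fs k) t"] N(1) f1R[OF t] PR0[OF t] by simp
    have ZC: "Z t \<le> C3" if t: "t \<in> {0..T}" for t
      unfolding Z_def C3_def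
      by (rule spread_Gronwall[OF fs N(1) C(1) _ oB[unfolded oc_def] t])
         (assumption, rule rate)
    have R02: "R0 \<le> R2" using C30 by (simp add: R2_def)
    have XR: "\<forall>k\<in>{1..N}. fs k t \<in> cball 0 R2" if t: "t \<in> {0..T}" for t
    proof
      fix k assume k: "k \<in> {1..N}"
      show "fs k t \<in> cball 0 R2"
      proof (cases "k = 1")
        case True
        then show ?thesis using f1R[OF t] R02 by simp
      next
        case False
        then have k2: "k \<in> {2..N}" using k by auto
        have "(norm (fs k t - \<Psi> t))\<^sup>2 \<le> Z t"
          unfolding Z_def others_spread_def by (rule member_le_sum[OF k2]) auto
        then have "norm (fs k t - \<Psi> t) \<le> sqrt C3" using ZC[OF t] by (intro real_le_rsqrt) simp
        then show ?thesis
          using PR0[OF t] norm_triangle_sub[of "fs k t" "\<Psi> t"] by (simp add: R2_def)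
      qed
    qed
    have PR2: "\<Psi> t \<in> cball 0 R2" if "t \<in> {0..T}" for t using PR0[OF that] R02 by simp
    have "(\<integral>t. - (Cd * (1 + C3) / s) - Cd / s * oc t \<partial>?M) \<le> (\<integral>t. d t \<partial>?M)"
    proof (rule integral_mono)
      fix t assume "t \<in> space ?M"
      then have t: "t \<in> {0..T}" by simp
      have "Cd * (1 + Z t + oc t) / s \<le> Cd * (1 + C3 + oc t) / s"
        using ZC[OF t] Cd(1) s by (intro divide_right_mono mult_left_mono) auto
      moreover have "- Cd * (1 + Z t + oc t) / s \<le> d t"
        unfolding Z_def oc_def d_def s_def by (rule Cd(2)[OF N(1) XR[OF t] PR2[OF t]])
      moreover have "Cd * (1 + C3 + oc t) / s = Cd * (1 + C3) / s + Cd / s * oc t"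
        by (simp add: distrib_left add_divide_distrib)
      ultimately show "- (Cd * (1 + C3) / s) - Cd / s * oc t \<le> d t" by simp
    qed (use di oi ci in auto)
    moreover have "(\<integral>t. - (Cd * (1 + C3) / s) - Cd / s * oc t \<partial>?M) = - (Cd * (1 + C3) / s) * T - Cd / s * (\<integral>t. oc t \<partial>?M)"
      using oi ci T by (subst Bochner_Integration.integral_diff) (auto simp: measure_lebesgue_on_Icc)
    moreover have "Cd / s * (\<integral>t. oc t \<partial>?M) \<le> Cd / s * B" using oB Cd(1) s by (intro mult_left_mono) auto
    moreover have "b \<le> Ce * (1 + C3) / s"
    proof -
      have "b \<le> Ce * (1 + Z T) / s"
        unfolding b_def Z_def s_def by (rule Ce(2)[OF N(1) XR[OF TT] PR2[OF TT]])
      also have "\<dots> \<le> Ce * (1 + C3) / s"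
        using ZC[OF TT] Ce(1) s by (intro divide_right_mono mult_left_mono) auto
      finally show ?thesis .
    qed
    moreover have "K / s = Cd * (1 + C3) / s * T + Cd / s * B + 2 * (Ce * (1 + C3) / s)"
      by (simp add: K_def add_divide_distrib algebra_simps)
    ultimately show ?thesis using diff unfolding s_def[symmetric] by linarith
  qed
  then show ?thesis using K0 by blast
qed

text \<open>
  Along \<open>\<Psi>\<close> the residual of each other particle is the force \<open>D (\<Psi> - f) / N\<close> of the first one. The total cost of
  these is of order \<open>1/N\<close>, and so is the change in the force on the first particle.
\<close>

lemma action_upper_bound:
  "\<exists>K\<ge>0. \<forall>N\<ge>1. \<forall>f. energy_path f \<longrightarrow> (\<forall>t\<in>{0..T}. f t \<in> cball 0 R) \<longrightarrow>
     particle_action N (\<lambda>k. if k = 1 then f else \<Psi>) \<le> limit_action f + K / real N"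
proof -
  obtain Rp where Rp: "\<And>t. t \<in> {0..T} \<Longrightarrow> norm (\<Psi> t) \<le> Rp" using \<Psi>_bounded by blast
  define R0 where "R0 = max R Rp"
  have PR0: "\<Psi> t \<in> cball 0 R0" if "t \<in> {0..T}" for t using Rp[OF that] by (simp add: R0_def)
  obtain m1 where m1: "m1 \<ge> 0" "\<And>y. y \<in> cball 0 R0 \<Longrightarrow> norm (v y) \<le> m1" using v_bounded[of R0] by blast
  obtain m2 where m2: "m2 \<ge> 0" "\<And>y. y \<in> cball 0 (2 * R0) \<Longrightarrow> norm (D y) \<le> m2" using D_bounded[of "2 * R0"] by blast
  define m where "m = m1 + m2"
  have m: "m \<ge> 0" "m1 \<le> m" "m2 \<le> m" using m1 m2 by (auto simp: m_def)
  have "particle_action N (\<lambda>k. if k = 1 then f else \<Psi>) \<le> limit_action f + 7 * m\<^sup>2 * T / real N"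
    if N: "N \<ge> 1" and f: "energy_path f" and fR: "\<And>t. t \<in> {0..T} \<Longrightarrow> f t \<in> cball 0 R" for N f
  proof -
    let ?M = "lebesgue_on {0..T}"
    define fs where "fs k = (if k = (1::nat) then f else \<Psi>)" for k
    define n where "n = real N"
    have n: "n \<ge> 1" using N by (simp add: n_def)
    have fs: "energy_path (fs k)" for k using f energy_path_\<Psi> by (simp add: fs_def)
    define d where "d t = defect N (\<lambda>k. fs k t) (\<Psi> t) (\<lambda>k. velocity T (fs k) t)" for t
    define b where "b = boundary_value N (\<lambda>k. fs k T) (\<Psi> T)"
    have di: "integrable ?M d" unfolding d_def by (rule action_difference(1)[OF fs N])
    have diff: "particle_action N fs - limit_action (fs 1) = (\<integral>t. d t \<partial>?M) - 2 * b"
      unfolding d_def b_def by (rule action_difference(2)[OF fs N])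
    have nN: "real (N - Suc 0) = n - 1" using N by (simp add: n_def of_nat_diff)
    have b0: "b \<ge> 0"
    proof -
      have "(\<Sum>k=1..N. F (fs k T - fs 1 T)) = (n - 1) * F (\<Psi> T - f T)"
        by (subst sum_from_1[OF N]) (simp add: fs_def F_0 nN)
      then have "b = F (\<Psi> T - f T) / n"
        using n by (simp add: b_def boundary_value_def fs_def n_def field_simps)
      then show ?thesis using n F_nonneg by simp
    qed
    have dle: "d t \<le> 7 * m\<^sup>2 / n" if t: "t \<in> {0..T}" for t
    proof -
      define y where "y = D (\<Psi> t - f t)"
      define V where "V = v (\<Psi> t)"
      define w where "w = v (f t) + D (f t - \<Psi> t)"
      have fR0: "f t \<in> cball 0 R0" using fR[OF t] by (simp add: R0_def)
      have dd: "a - c \<in> cball 0 (2 * R0)" if "a \<in> cball 0 R0" "c \<in> cball 0 R0" for a c :: 'a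
        using that norm_triangle_ineq4[of a c] by simp
      have ny: "norm y \<le> m" unfolding y_def using m2(2)[OF dd[OF PR0[OF t] fR0]] m by linarith
      have nV: "norm V \<le> m" unfolding V_def using m1(2)[OF PR0[OF t]] m by linarith
      have nw: "norm w \<le> m + m" unfolding w_def
        using m1(2)[OF fR0] m2(2)[OF dd[OF fR0 PR0[OF t]]] m by (intro norm_triangle_mono) linarith+
      have fg: "force_gap N (\<lambda>k. fs k t) (\<Psi> t) = - (1 / n) *\<^sub>R y"
      proof -
        have "(\<Sum>k=1..N. D (fs k t - fs 1 t)) = (n - 1) *\<^sub>R y"
          by (subst sum_from_1[OF N]) (simp add: fs_def D_0 nN y_def sum_constant_scaleR)
        then have "force_gap N (\<lambda>k. fs k t) (\<Psi> t) = ((n - 1) / n) *\<^sub>R y - 1 *\<^sub>R y"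
          by (simp add: force_gap_def fs_def y_def n_def)
        also have "\<dots> = ((n - 1) / n - 1) *\<^sub>R y" by (simp only: scaleR_diff_left)
        also have "(n - 1) / n - 1 = - (1 / n)" using n by (simp add: field_simps)
        finally show ?thesis .
      qed
      have oc: "others_cost N (\<lambda>k. fs k t) (\<lambda>k. velocity T (fs k) t) = (n - 1) * (norm y / n)\<^sup>2"
      proof -
        have "velocity T (fs k) t + drift N (\<lambda>k. fs k t) k = (1 / n) *\<^sub>R y" if "k \<in> {2..N}" for k
          using that sum_from_1[OF N, of "\<lambda>j. D (\<Psi> t - fs j t)"]
          by (simp add: drift_def fs_def \<Psi>_velocity[OF t] y_def n_def D_0)
        then have "others_cost N (\<lambda>k. fs k t) (\<lambda>k. velocity T (fs k) t) = (\<Sum>k=2..N. (norm ((1 / n) *\<^sub>R y))\<^sup>2)"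
          unfolding others_cost_def by (intro sum.cong) auto
        also have "\<dots> = (n - 1) * (norm y / n)\<^sup>2" using n nN by simp
        finally show ?thesis .
      qed
      have q: "(\<Sum>k=1..N. D (fs k t - fs 1 t) \<bullet> velocity T (fs k) t) = - ((n - 1) * (y \<bullet> V))"
        by (subst sum_from_1[OF N]) (simp add: fs_def D_0 nN y_def V_def \<Psi>_velocity[OF t])
      have "d t = (n - 1) * (norm y / n)\<^sup>2 + (norm y / n)\<^sup>2 + 2 / n * (w \<bullet> y) - 2 * (y \<bullet> V)
          + 2 / n * ((n - 1) * (y \<bullet> V))"
        unfolding d_def defect_def oc fg q using n
        by (simp add: fs_def w_def[symmetric] y_def[symmetric] V_def[symmetric] n_def[symmetric])
      also have "\<dots> = ((norm y)\<^sup>2 + 2 * (w \<bullet> y) - 2 * (y \<bullet> V)) / n"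
        using n by (simp add: field_simps power2_eq_square)
      also have "\<dots> \<le> 7 * m\<^sup>2 / n"
      proof (rule divide_right_mono)
        have "(norm y)\<^sup>2 \<le> m\<^sup>2" using ny by (intro power_mono) auto
        moreover have "w \<bullet> y \<le> 2 * m\<^sup>2"
        proof -
          have "norm w * norm y \<le> (m + m) * m" using nw ny m by (intro mult_mono) auto
          then show ?thesis using norm_cauchy_schwarz[of w y] by (simp add: power2_eq_square)
        qed
        moreover have "- (y \<bullet> V) \<le> m\<^sup>2"
        proof -
          have "norm y * norm V \<le> m * m" using nV ny m by (intro mult_mono) auto
          then show ?thesis using Cauchy_Schwarz_ineq2[of y V] by (simp add: power2_eq_square abs_le_iff)
        qed
        ultimately show "(norm y)\<^sup>2 + 2 * (w \<bullet> y) - 2 * (y \<bullet> V) \<le> 7 * m\<^sup>2" by linarith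
      qed (use n in simp)
      finally show ?thesis .
    qed
    have "(\<integral>t. d t \<partial>?M) \<le> (\<integral>t. 7 * m\<^sup>2 / n \<partial>?M)"
      by (rule integral_mono[OF di]) (auto intro!: continuous_integrable_lebesgue_on continuous_intros dle)
    also have "\<dots> = 7 * m\<^sup>2 * T / n" using T by (simp add: measure_lebesgue_on_Icc)
    finally have "particle_action N fs \<le> limit_action f + 7 * m\<^sup>2 * T / n"
      using diff b0 by (simp add: fs_def)
    then show ?thesis by (simp add: fs_def[abs_def] n_def)
  qed
  moreover have "7 * m\<^sup>2 * T \<ge> 0" using T by simp
  ultimately show ?thesis by blast
qed

end

section \<open>Convergence of the rate functions\<close>

lemma compact_path_space_bounded:
  fixes \<K> :: "(real \<Rightarrow> real ^ 'n) set"
  assumes "compactin (mtopology_of (path_space T)) \<K>"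
  shows "\<exists>R. \<forall>f\<in>\<K>. \<forall>t\<in>{0..T}. norm (f t) \<le> R"
proof (cases "\<K> = {} \<or> {0..T} = {}")
  case True
  then show ?thesis by auto
next
  case False
  let ?M = "mspace (path_space T :: (real \<Rightarrow> real ^ 'n) metric)"
  let ?d = "mdist (path_space T :: (real \<Rightarrow> real ^ 'n) metric)"
  have "Metric_space.mbounded ?M ?d \<K>"
    using Metric_space.compactin_imp_mbounded[OF Metric_space_mspace_mdist] assms
    by (simp add: mtopology_of_def)
  then obtain c B where cB: "\<K> \<subseteq> Metric_space.mcball ?M ?d c B"
    using Metric_space.mbounded_def[OF Metric_space_mspace_mdist] by metis
  have mem: "c \<in> ?M" "f \<in> ?M" "?d c f \<le> B" if "f \<in> \<K>" for f
    using subsetD[OF cB that] Metric_space.in_mcball[OF Metric_space_mspace_mdist] by metis+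
  have c: "c \<in> ?M" using mem(1) False by blast
  then have "Metric_space.mbounded UNIV dist (c ` {0..T})"
    by (simp add: path_space_def)
  then obtain R where R: "\<forall>t\<in>{0..T}. norm (c t) \<le> R"
    by (auto simp: mbounded_iff_bounded bounded_iff)
  have "norm (f t) \<le> R + B" if f: "f \<in> \<K>" and t: "t \<in> {0..T}" for f t
  proof -
    have "dist (c t) (f t) \<le> B"
      using cfunspace_mdist_le[of c "top_of_set {0..T}" euclidean_metric f B] mem[OF f] t False
      by (simp add: path_space_def)
    then show ?thesis using bspec[OF R t] norm_triangle_sub[of "f t" "c t"] by (simp add: dist_norm norm_minus_commute)
  qed
  then show ?thesis by blast
qed

text \<open>
  An even polynomial of \<open>norm y\<close> is a polynomial of \<open>y \<bullet> y\<close>, so the interaction is smooth with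
  radial gradient, and the growth of \<open>G\<close> forces a positive leading coefficient.
\<close>

lemma mean_field_potentials_if_polynomial:
  fixes V F :: "real ^ 'n \<Rightarrow> real" and G :: "real \<Rightarrow> real"
  assumes V1: "class_C2 V"
    and V2: "\<exists>K. compact K \<and> (\<forall>y. y \<notin> K \<longrightarrow> pos_semidef (hessian V y))"
    and F1: "\<forall>r\<ge>0. 0 \<le> G r" "\<forall>y. F y = G (norm y)"
    and F2: "\<exists>p :: real poly. (\<forall>r\<ge>0. G r = poly p r) \<and> (\<forall>r. poly p (- r) = poly p r)
               \<and> 2 \<le> degree p"
            "G 0 = 0"
    and F3: "filterlim G at_top at_top"
  shows "\<exists>\<gamma>. mean_field_potentials (gradient V) (gradient F) F \<gamma>"
proof -
  obtain p :: "real poly" where p: "\<And>r. 0 \<le> r \<Longrightarrow> G r = poly p r" "\<And>r. poly p (- r) = poly p r"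
    using F2(1) by blast
  obtain q where q: "\<And>y. F y = poly q (y \<bullet> y)" "lead_coeff (smult 2 (pderiv q)) > 0"
    by (rule even_polynomial_potential[of G F p]) (use F1 p F3 in auto)
  define g where "g = smult 2 (pderiv q)"
  define \<gamma> where "\<gamma> y = poly g (y \<bullet> y)" for y :: "real ^ 'n"
  have g: "lead_coeff g > 0" using q(2) by (simp only: g_def)
  have Fq: "F = (\<lambda>y. poly q (y \<bullet> y))" using q(1) by blast
  have Fder: "(F has_derivative (\<lambda>h. (\<gamma> y *\<^sub>R y) \<bullet> h)) (at y)" for y
    unfolding Fq \<gamma>_def g_def by (rule radial_poly_has_derivative)
  then have grad: "gradient F y = poly g (y \<bullet> y) *\<^sub>R y" for y
    using gradient_eqI[OF Fder] by (simp add: \<gamma>_def)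
  obtain K where K: "compact K" "\<And>y. y \<notin> K \<Longrightarrow> pos_semidef (hessian V y)" using V2 by blast
  obtain n where n: "\<And>s. s \<ge> n \<Longrightarrow> poly g s \<ge> lead_coeff g" using poly_pinfty_gt_lc[OF g] by blast
  have "mean_field_potentials (gradient V) (gradient F) F \<gamma>"
  proof
    show "\<exists>S. \<forall>y. S \<le> norm y \<longrightarrow> 0 \<le> \<gamma> y"
    proof (intro exI[of _ "max 1 n"] allI impI)
      fix y :: "real ^ 'n" assume y: "max 1 n \<le> norm y"
      then have "norm y * 1 \<le> norm y * norm y" by (intro mult_left_mono) auto
      then have "n \<le> y \<bullet> y" using y by (simp add: power2_norm_eq_inner[symmetric] power2_eq_square)
      then show "0 \<le> \<gamma> y" using n[of "y \<bullet> y"] g by (simp add: \<gamma>_def)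
    qed
    show "\<exists>C\<ge>0. \<forall>y. - C \<le> \<gamma> y"
    proof -
      have pc: "continuous_on A (poly p)" for A and p :: "real poly" by (intro continuous_intros)
      obtain C where C0: "C \<ge> 0" and C: "\<And>s. s \<in> {0..max 0 n} \<Longrightarrow> norm (poly g s) \<le> C"
        using compact_continuous_bound[OF compact_Icc pc] by blast
      have "- C \<le> \<gamma> y" for y
      proof (cases "y \<bullet> y \<ge> n")
        case True
        then show ?thesis using n[of "y \<bullet> y"] g C0 by (simp add: \<gamma>_def)
      next
        case False
        then have "y \<bullet> y \<in> {0..max 0 n}" by (simp add: le_max_iff_disj)
        from C[OF this] show ?thesis by (simp add: \<gamma>_def abs_le_iff)
      qed
      then show ?thesis using C0 by blast
    qed
    show "(F has_derivative (\<lambda>h. gradient F y \<bullet> h)) (at y)" for y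
      using Fder[of y] by (simp add: grad \<gamma>_def)
    show "F 0 = 0" "0 \<le> F y" for y using F1 F2(2) by auto
  qed (use grad gradient_Lipschitz_cball[OF V1] convex_at_infinity_gradient_bound[OF V1 K]
        radial_poly_Lipschitz[OF grad] pair_coercive[OF g grad] in \<open>auto simp: \<gamma>_def\<close>)
  then show ?thesis by blast
qed

lemma mean_field_paths_Psi_inf:
  fixes V F :: "real ^ 'n \<Rightarrow> real"
  assumes "mean_field_potentials (gradient V) (gradient F) F \<gamma>" and T: "0 < T"
  shows "mean_field_paths (gradient V) (gradient F) F \<gamma> T x (Psi_inf T x V)"
proof -
  interpret mean_field_potentials "gradient V" "gradient F" F \<gamma> by fact
  obtain M where M: "M \<ge> 0" "\<forall>a\<in>cball 0 (norm x). \<forall>w. - M * norm w \<le> w \<bullet> gradient V (a + w)"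
    using v_growth[of "norm x"] by blast
  have "\<exists>\<Psi>. is_Psi T x V \<Psi>"
    unfolding is_Psi_def
    by (rule dissipative_ode_exists[OF v_Lipschitz M(1)]) (use M(2) T in auto)
  then have "is_Psi T x V (Psi_inf T x V)" unfolding Psi_inf_def by (rule someI_ex)
  then show ?thesis using T by unfold_locales (auto simp: is_Psi_def)
qed

locale rate_functions = mean_field_paths "gradient V" "gradient F" F \<gamma> T x "Psi_inf T x V"
  for V F \<gamma> :: "real ^ 'n \<Rightarrow> real" and T :: real and x :: "real ^ 'n"
begin

lemma admissible_HH: "admissible f \<longleftrightarrow> f \<in> HH T x"
  by (simp add: admissible_def HH_def)

lemma velocity_measurable:
  "admissible f \<Longrightarrow> velocity T f \<in> borel_measurable (lebesgue_on {0..T})"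
  unfolding admissible_def using T by (intro abs_cont_vector_derivative_measurable) auto

lemma admissible_\<Psi>: "admissible (Psi_inf T x V)"
  using energy_path_\<Psi> by (simp add: energy_path_def)

text \<open>
  On \<open>{0..T}\<close> a continuous drift is square integrable, so finite cost means square integrable
  velocity.
\<close>

lemma energy_path_if_finite:
  assumes f: "admissible f" and c: "continuous_on {0..T} c"
    and fin: "(\<integral>\<^sup>+t\<in>{0..T}. ennreal ((norm (velocity T f t + c t))\<^sup>2) \<partial>lborel) < \<infinity>"
  shows "energy_path f"
proof -
  have "square_integrable T (\<lambda>t. velocity T f t + c t)"
    by (rule square_integrable_if_finite[OF _ fin])
       (intro borel_measurable_add velocity_measurable f continuous_borel_measurable_lebesgue_on c)
  then show ?thesis
    using f by (simp add: energy_path_def square_integrable_add_continuous_iff[OF c])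
qed

lemma quarter_finite: "ennreal (1/4) * X < \<infinity> \<Longrightarrow> X < \<infinity>"
  by (auto simp: ennreal_mult_less_top)

lemma limit_drift_continuous:
  "admissible f \<Longrightarrow> continuous_on {0..T} (\<lambda>t. gradient V (f t) + gradient F (f t - Psi_inf T x V t))"
  by (intro continuous_on_add admissible_v_continuous admissible_D_continuous admissible_\<Psi>)

lemma J_inf_energy_path:
  assumes "energy_path f"
  shows "J_inf T x V F f = ennreal (limit_action f / 4)"
proof -
  have p: "admissible f" "square_integrable T (velocity T f)" using assms by (auto simp: energy_path_def)
  have "square_integrable T (\<lambda>t. velocity T f t + gradient V (f t) + gradient F (f t - Psi_inf T x V t))"
    using square_integrable_add[OF p(2) square_integrable_continuous[OF limit_drift_continuous[OF p(1)]]]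
    by (simp add: add.assoc)
  from nn_integral_square_integrable[OF this] show ?thesis
    using p(1) by (simp add: J_inf_def admissible_HH limit_action_def ennreal_mult''[symmetric] del: ennreal_plus)
qed

lemma J_inf_finite:
  assumes "J_inf T x V F f < \<infinity>"
  shows "energy_path f"
proof -
  have p: "admissible f" using assms by (auto simp: J_inf_def admissible_HH split: if_splits)
  have "(\<integral>\<^sup>+t\<in>{0..T}. ennreal ((norm (velocity T f t + gradient V (f t)
      + gradient F (f t - Psi_inf T x V t)))\<^sup>2) \<partial>lborel) < \<infinity>"
    using assms p by - (rule quarter_finite, simp add: J_inf_def admissible_HH)
  then show ?thesis
    by (intro energy_path_if_finite[OF p limit_drift_continuous[OF p]]) (simp add: add.assoc)
qed

lemma I_N_energy_paths:
  assumes fs: "\<And>k. k \<in> {1..N} \<Longrightarrow> energy_path (fs k)"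
  shows "I_N T x V F N fs = ennreal (particle_action N fs / 4)"
proof -
  have p: "admissible (fs k)" "square_integrable T (velocity T (fs k))" if "k \<in> {1..N}" for k
    using fs[OF that] by (auto simp: energy_path_def)
  have "(\<integral>\<^sup>+t\<in>{0..T}. ennreal ((norm (velocity T (fs i) t + gradient V (fs i t)
            + (1 / real N) *\<^sub>R (\<Sum>k=1..N. gradient F (fs i t - fs k t))))\<^sup>2) \<partial>lborel)
      = ennreal (\<integral>t. (norm (velocity T (fs i) t + drift N (\<lambda>k. fs k t) i))\<^sup>2 \<partial>lebesgue_on {0..T})"
    if i: "i \<in> {1..N}" for i
    using nn_integral_square_integrable[OF square_integrable_add[OF p(2)[OF i]
      square_integrable_continuous[OF drift_continuous[OF p(1) i]]]]
    by (simp add: drift_def add.assoc)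
  then have "I_N T x V F N fs = ennreal (1/4) * (\<Sum>i=1..N. ennreal (\<integral>t. (norm (velocity T (fs i) t
      + drift N (\<lambda>k. fs k t) i))\<^sup>2 \<partial>lebesgue_on {0..T}))"
    using p(1) by (simp add: I_N_def admissible_HH)
  also have "\<dots> = ennreal (1/4) * ennreal (particle_action N fs)"
    unfolding particle_action_def by (subst sum_ennreal) auto
  also have "\<dots> = ennreal (particle_action N fs / 4)"
    by (subst ennreal_mult''[symmetric]) (auto simp: particle_action_def intro!: sum_nonneg)
  finally show ?thesis .
qed

lemma I_N_finite:
  assumes fin: "I_N T x V F N fs < \<infinity>" and k: "k \<in> {1..N}"
  shows "energy_path (fs k)"
proof -
  have p: "admissible (fs k)" if "k \<in> {1..N}" for k
    using fin that by (auto simp: I_N_def admissible_HH split: if_splits)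
  have "(\<Sum>i=1..N. \<integral>\<^sup>+t\<in>{0..T}. ennreal ((norm (velocity T (fs i) t + gradient V (fs i t)
            + (1 / real N) *\<^sub>R (\<Sum>k=1..N. gradient F (fs i t - fs k t))))\<^sup>2) \<partial>lborel) < \<infinity>"
    using fin p by - (rule quarter_finite, simp add: I_N_def admissible_HH)
  then have "(\<integral>\<^sup>+t\<in>{0..T}. ennreal ((norm (velocity T (fs k) t + gradient V (fs k t)
            + (1 / real N) *\<^sub>R (\<Sum>j=1..N. gradient F (fs k t - fs j t))))\<^sup>2) \<partial>lborel) < \<infinity>"
    using k by (auto simp: less_top)
  then show ?thesis
    by (intro energy_path_if_finite[OF p[OF k] drift_continuous[OF p k]]) (auto simp: drift_def add.assoc)
qed

text \<open>
  If the functional on the larger side is infinite there is nothing to prove; otherwise all paths involved have finite energy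
  and the two bounds on the actions apply.
\<close>

lemma rate_functions_uniformly_close:
  assumes \<epsilon>: "0 < \<epsilon>"
  shows "\<exists>N0\<ge>2. \<forall>N\<ge>N0. \<forall>f. (\<forall>t\<in>{0..T}. norm (f t) \<le> R) \<longrightarrow>
     J_N T x V F N f \<le> J_inf T x V F f + ennreal \<epsilon> \<and>
     J_inf T x V F f \<le> J_N T x V F N f + ennreal \<epsilon>"
proof -
  obtain K1 N1 where K1: "K1 \<ge> 0" "\<And>N fs. N \<ge> N1 \<Longrightarrow> (\<forall>k\<in>{1..N}. energy_path (fs k)) \<Longrightarrow>
     (\<forall>t\<in>{0..T}. fs 1 t \<in> cball 0 R) \<Longrightarrow> limit_action (fs 1) \<le> particle_action N fs + K1 / sqrt (real N)"
    using action_lower_bound[of R] by blast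
  obtain K2 where K2: "K2 \<ge> 0" "\<And>N f. N \<ge> 1 \<Longrightarrow> energy_path f \<Longrightarrow> (\<forall>t\<in>{0..T}. f t \<in> cball 0 R) \<Longrightarrow>
     particle_action N (\<lambda>k. if k = 1 then f else Psi_inf T x V) \<le> limit_action f + K2 / real N"
    using action_upper_bound[of R] by blast
  obtain N2 where N2: "real N2 > (K1 / \<epsilon>)\<^sup>2" using reals_Archimedean2 by blast
  obtain N3 where N3: "real N3 > K2 / \<epsilon>" using reals_Archimedean2 by blast
  define N0 where "N0 = max (max N1 2) (max N2 N3)"
  have "J_N T x V F N f \<le> J_inf T x V F f + ennreal \<epsilon> \<and> J_inf T x V F f \<le> J_N T x V F N f + ennreal \<epsilon>"
    if N: "N \<ge> N0" and f: "\<forall>t\<in>{0..T}. norm (f t) \<le> R" for N f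
  proof
    have NN: "N \<ge> N1" "N \<ge> 2" "N \<ge> N2" "N \<ge> N3" using N by (auto simp: N0_def)
    have e1: "K1 / sqrt (real N) \<le> \<epsilon>"
    proof -
      have "(K1 / \<epsilon>)\<^sup>2 \<le> real N" using N2 NN by linarith
      then have "K1 / \<epsilon> \<le> sqrt (real N)" by (rule real_le_rsqrt)
      then show ?thesis using \<epsilon> NN by (simp add: field_simps)
    qed
    have e2: "K2 / real N \<le> \<epsilon>"
    proof -
      have "K2 / \<epsilon> \<le> real N" using N3 NN by linarith
      then show ?thesis using \<epsilon> NN by (simp add: field_simps)
    qed
    have fR: "\<forall>t\<in>{0..T}. f t \<in> cball 0 R" using f by simp
    show "J_N T x V F N f \<le> J_inf T x V F f + ennreal \<epsilon>"
    proof (cases "J_inf T x V F f < \<infinity>")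
      case True
      then have ef: "energy_path f" by (rule J_inf_finite)
      define fs where "fs k = (if k = (1::nat) then f else Psi_inf T x V)" for k
      have "J_N T x V F N f \<le> I_N T x V F N fs"
        unfolding J_N_def using admissible_\<Psi> by (intro INF_lower) (auto simp: fs_def admissible_HH)
      also have "\<dots> = ennreal (particle_action N fs / 4)"
        using ef energy_path_\<Psi> by (intro I_N_energy_paths) (simp add: fs_def)
      also have "\<dots> \<le> ennreal (limit_action f / 4 + \<epsilon>)"
      proof (rule ennreal_leI)
        have "particle_action N fs \<le> limit_action f + K2 / real N"
          using K2(2)[of N f] NN ef fR by (simp add: fs_def[abs_def])
        then show "particle_action N fs / 4 \<le> limit_action f / 4 + \<epsilon>" using e2 \<epsilon> by simp
      qed
      also have "\<dots> = J_inf T x V F f + ennreal \<epsilon>"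
        using \<epsilon> unfolding J_inf_energy_path[OF ef] by (intro ennreal_plus) (auto simp: limit_action_def)
      finally show ?thesis .
    qed (simp add: less_top[symmetric])
    have "J_inf T x V F f - ennreal \<epsilon> \<le> J_N T x V F N f"
      unfolding J_N_def
    proof (rule INF_greatest)
      fix fs assume "fs \<in> {fs. fs 1 = f \<and> (\<forall>i\<in>{2..N}. fs i \<in> HH T x)}"
      then have fs1: "fs 1 = f" by simp
      show "J_inf T x V F f - ennreal \<epsilon> \<le> I_N T x V F N fs"
      proof (cases "I_N T x V F N fs < \<infinity>")
        case True
        then have efs: "\<And>k. k \<in> {1..N} \<Longrightarrow> energy_path (fs k)" by (rule I_N_finite)
        then have ef: "energy_path f" using fs1 NN by force
        have "limit_action f / 4 \<le> particle_action N fs / 4 + \<epsilon>"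
          using K1(2)[OF NN(1), of fs] efs fR fs1 e1 \<epsilon> by simp
        then have "ennreal (limit_action f / 4) \<le> ennreal (particle_action N fs / 4 + \<epsilon>)" by (rule ennreal_leI)
        also have "\<dots> = ennreal (particle_action N fs / 4) + ennreal \<epsilon>"
          using \<epsilon> by (intro ennreal_plus) (auto simp: particle_action_def intro!: sum_nonneg)
        finally have "J_inf T x V F f \<le> I_N T x V F N fs + ennreal \<epsilon>"
          using J_inf_energy_path[OF ef] I_N_energy_paths[of N fs] efs by simp
        then show ?thesis by (simp add: ennreal_minus_le_iff add.commute)
      qed (simp add: less_top[symmetric])
    qed
    then show "J_inf T x V F f \<le> J_N T x V F N f + ennreal \<epsilon>"
      by (simp add: ennreal_minus_le_iff add.commute)
  qed
  then show ?thesis by (intro exI[of _ N0]) (auto simp: N0_def)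
qed

end

text \<open>
  Two-sided additive closeness also settles an infinite limit, since then \<open>X N\<close> is eventually
  infinite.
\<close>

lemma ennreal_tendsto_if_close:
  fixes X :: "nat \<Rightarrow> ennreal"
  assumes "\<And>\<epsilon>::real. 0 < \<epsilon> \<Longrightarrow> \<exists>N0. \<forall>N\<ge>N0. X N \<le> L + ennreal \<epsilon> \<and> L \<le> X N + ennreal \<epsilon>"
  shows "X \<longlonglongrightarrow> L"
proof (cases L)
  case top
  obtain N0 where "\<forall>N\<ge>N0. L \<le> X N + ennreal 1" using assms[of 1] by auto
  then have "\<forall>N\<ge>N0. X N = L" using top by (auto simp: top_unique)
  then show ?thesis by (intro tendsto_eventually) (auto simp: eventually_sequentially)
next
  case (real l)
  obtain N1 where N1: "\<forall>N\<ge>N1. X N \<le> L + ennreal 1" using assms[of 1] by auto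
  have fin: "X N = ennreal (enn2real (X N))" if "N \<ge> N1" for N
  proof -
    have "X N < top" using N1 that real by (metis ennreal_add_less_top ennreal_less_top order_le_less_trans)
    then show ?thesis by simp
  qed
  have "(\<lambda>N. enn2real (X N)) \<longlonglongrightarrow> l"
  proof (rule LIMSEQ_I)
    fix r :: real assume r: "0 < r"
    obtain N0 where N0: "\<forall>N\<ge>N0. X N \<le> L + ennreal (r/2) \<and> L \<le> X N + ennreal (r/2)"
      using assms[of "r/2"] r by auto
    have "norm (enn2real (X N) - l) < r" if N: "N \<ge> max N0 N1" for N
    proof -
      define y where "y = enn2real (X N)"
      have y: "X N = ennreal y" "y \<ge> 0" using fin[of N] N by (auto simp: y_def)
      have "ennreal y \<le> ennreal (l + r/2)" "ennreal l \<le> ennreal (y + r/2)"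
        using N0 N y real r by (auto simp: ennreal_plus)
      then have "y \<le> l + r/2" "l \<le> y + r/2"
        using y real r ennreal_le_iff[of "l + r/2" y] ennreal_le_iff[of "y + r/2" l]
        by (simp_all del: ennreal_plus)
      then show ?thesis using r by (auto simp: y_def[symmetric] abs_less_iff)
    qed
    then show "\<exists>no. \<forall>n\<ge>no. norm (enn2real (X n) - l) < r" by blast
  qed
  then have "(\<lambda>N. ennreal (enn2real (X N))) \<longlonglongrightarrow> ennreal l" by (rule tendsto_ennrealI)
  moreover have "\<forall>\<^sub>F N in sequentially. ennreal (enn2real (X N)) = X N"
    unfolding eventually_sequentially using fin by metis
  ultimately show ?thesis using real Lim_transform_eventually by blast
qed

theorem theorem2p1:
  fixes T :: real and x :: "real ^ 'n"
    and V F :: "real ^ 'n \<Rightarrow> real" and G :: "real \<Rightarrow> real"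
  assumes T: "0 < T"
    and V1: "class_C2 V"
    and V2: "\<exists>K. compact K \<and> (\<forall>y. y \<notin> K \<longrightarrow> pos_semidef (hessian V y))"
    and F1: "\<forall>r\<ge>0. 0 \<le> G r" "\<forall>y. F y = G (norm y)"
    and F2: "\<exists>p :: real poly. (\<forall>r\<ge>0. G r = poly p r) \<and> (\<forall>r. poly p (- r) = poly p r)
               \<and> 2 \<le> degree p"
            "G 0 = 0"
    and F3: "filterlim G at_top at_top"
  shows "(\<forall>f. abs_cont_on_interval 0 T f \<and> f 0 = x \<longrightarrow>
            (\<lambda>N. J_N T x V F N f) \<longlonglongrightarrow> J_inf T x V F f) \<and>
         (\<forall>\<K>. compactin (mtopology_of (path_space T)) \<K> \<longrightarrow>
            (\<forall>\<epsilon>::real. 0 < \<epsilon> \<longrightarrow> (\<exists>N\<^sub>0\<ge>2. \<forall>N\<ge>N\<^sub>0. \<forall>f\<in>\<K>.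
               J_N T x V F N f \<le> J_inf T x V F f + ennreal \<epsilon> \<and>
               J_inf T x V F f \<le> J_N T x V F N f + ennreal \<epsilon>)))"
proof -
  obtain \<gamma> where "mean_field_potentials (gradient V) (gradient F) F \<gamma>"
    using mean_field_potentials_if_polynomial[OF V1 V2 F1 F2 F3] by blast
  then interpret mean_field_paths "gradient V" "gradient F" F \<gamma> T x "Psi_inf T x V"
    using T by (rule mean_field_paths_Psi_inf)
  interpret rate_functions V F \<gamma> T x ..
  show ?thesis
  proof (intro conjI allI impI)
    fix f assume f: "abs_cont_on_interval 0 T f \<and> f 0 = x"
    then have "continuous_on {0..T} f" by (blast intro: abs_cont_imp_continuous)
    then obtain R where R: "\<And>t. t \<in> {0..T} \<Longrightarrow> norm (f t) \<le> R"
      using compact_continuous_bound[OF compact_Icc] by blast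
    show "(\<lambda>N. J_N T x V F N f) \<longlonglongrightarrow> J_inf T x V F f"
    proof (rule ennreal_tendsto_if_close)
      fix \<epsilon> :: real assume "0 < \<epsilon>"
      from rate_functions_uniformly_close[OF this, of R]
      show "\<exists>N0. \<forall>N\<ge>N0. J_N T x V F N f \<le> J_inf T x V F f + ennreal \<epsilon> \<and> J_inf T x V F f \<le> J_N T x V F N f + ennreal \<epsilon>"
        using R by blast
    qed
  next
    fix \<K> :: "(real \<Rightarrow> real ^ 'n) set" and \<epsilon> :: real
    assume "compactin (mtopology_of (path_space T)) \<K>" and \<epsilon>: "0 < \<epsilon>"
    then obtain R where R: "\<forall>f\<in>\<K>. \<forall>t\<in>{0..T}. norm (f t) \<le> R"
      using compact_path_space_bounded by blast
    from rate_functions_uniformly_close[OF \<epsilon>, of R]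
    show "\<exists>N\<^sub>0\<ge>2. \<forall>N\<ge>N\<^sub>0. \<forall>f\<in>\<K>. J_N T x V F N f \<le> J_inf T x V F f + ennreal \<epsilon> \<and>
               J_inf T x V F f \<le> J_N T x V F N f + ennreal \<epsilon>"
      using R by blast
  qed
qed

end
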